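(* Let $\mathcal R:K\to K$ be the return map (defined in the context) of the equation $u'(t)=0.32\,u(t)-\max_{s\in[t-3\pi/2,\,t]}u(s)+1-\sin t$. Then $\mathcal R$ has exactly two points of discontinuity $p_1\approx1.11$ and $p_2\approx2.61$ on the interval $[0,p_2]$, where $[0,p_2]\supset\mathcal R(K)$, and $$\mathcal R(p_1)=\mathcal R(p_2)=\mathcal R(0)\approx2.23,\qquad \mathcal R(p_1-)=\mathcal R(p_2-)=0.$$ Furthermore, $\mathcal R$ is differentiable on $[0,1.316]\setminus\{p_1\}$ and has a unique critical point $p_c\approx0.108$ on this interval, where it reaches its absolute maximum. Finally, $\mathcal R'(p_1-)<\mathcal R'(p_1+)$, $\mathcal R(p)>p$ for all $p\in[0,0.9]$, and $\mathcal R(\mathcal R(0))<0.9$.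
   Context: Put $\tilde f(t)=(1-\sin t)/0.68$ and $K=\tilde f([-\pi/2,\pi/2])=[0,2/0.68]$; $\tilde f$ is strictly decreasing on $[-\pi/2,\pi/2]$. For $p\in K$ let $q\in[-\pi/2,\pi/2]$ be the unique point with $\tilde f(q)=p$, and let $u(\cdot,p)$ be the solution of the equation for $t\ge q$ with $u(s,p)=p$ for $s\in[q-3\pi/2,q]$. Let $\nu^*=\nu^*(q)$ be the smallest $\nu>q$ for which there is $\varepsilon>0$ with $u(\nu,p)=\max_{r\in[\nu-3\pi/2,\,\nu+\varepsilon]}u(r,p)$ (such $\nu$ exists). The return map is $\mathcal R(p)=u(\nu^*,p)$; it maps $K$ into $K$. $g(x-)$ and $g(x+)$ denote the left and right limits of $g$ at $x$. The symbol $\approx$ indicates an approximate numerical value.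
   Formalization: The printed value p_1≈1.11 is not correct to two decimals (the true value exceeds 1.12, numerically about 1.19); the formal statement asserts only |p_1−1.11|<0.1, while the other approximations hold to within one unit of the last printed digit. *)

theory Defs
  imports "HOL-Analysis.Analysis"
begin

definition ftilde :: "real \<Rightarrow> real" where
  "ftilde t = (1 - sin t) / 0.68"

definition K :: "real set" where
  "K = ftilde ` {-(pi/2)..pi/2}"

lemma K_eq_interval: "K = {0..2 / 0.68}"
proof
  show "K \<subseteq> {0..2 / 0.68}"
  proof
    fix p assume "p \<in> K"
    then obtain t where t: "p = (1 - sin t) / 0.68"
      unfolding K_def ftilde_def by blast
    have "-1 \<le> sin t" "sin t \<le> 1" by simp_all
    then show "p \<in> {0..2 / 0.68}"
      unfolding t atLeastAtMost_iff
      by (intro conjI divide_nonneg_nonneg divide_right_mono) simp_all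
  qed
next
  show "{0..2 / 0.68} \<subseteq> K"
  proof
    fix p :: real assume p: "p \<in> {0..2 / 0.68}"
    let ?y = "1 - 0.68 * p"
    have y: "-1 \<le> ?y" "?y \<le> 1" using p by (auto simp: field_simps)
    have "p = ftilde (arcsin ?y)"
      using y by (simp add: ftilde_def)
    moreover have "arcsin ?y \<in> {-(pi/2)..pi/2}"
      using arcsin_bounded[OF y] by simp
    ultimately show "p \<in> K" unfolding K_def by blast
  qed
qed

definition start_time :: "real \<Rightarrow> real" where
  "start_time p = (THE q. q \<in> {-(pi/2)..pi/2} \<and> ftilde q = p)"

text \<open>
  Every maximum over a compact interval is written as a supremum: a solution is continuous on
  the half-line from \<open>q - 3 * pi / 2\<close> onwards, where \<open>q = start_time p\<close>, so each of
  these suprema is attained. At \<open>t = q\<close> the derivative is the one-sided derivative from the right.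
\<close>

definition is_solution :: "real \<Rightarrow> (real \<Rightarrow> real) \<Rightarrow> bool" where
  "is_solution p u \<longleftrightarrow>
     (\<forall>s \<in> {start_time p - 3 * pi / 2 .. start_time p}. u s = p) \<and>
     (\<forall>t \<ge> start_time p.
        (u has_real_derivative
           0.32 * u t - (SUP s \<in> {t - 3 * pi / 2 .. t}. u s) + 1 - sin t)
          (at t within {start_time p..}))"

text \<open>
  The initial value problem determines a solution only from \<open>start_time p - 3 * pi / 2\<close>
  onwards; the choice below leaves the earlier values arbitrary, and the return map never
  refers to them.
\<close>

definition sol :: "real \<Rightarrow> real \<Rightarrow> real" where
  "sol p = (SOME u. is_solution p u)"

definition return_time :: "real \<Rightarrow> real" where
  "return_time p =
     (LEAST \<nu>. \<nu> > start_time p \<and>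
        (\<exists>\<epsilon>>0. sol p \<nu> = (SUP r \<in> {\<nu> - 3 * pi / 2 .. \<nu> + \<epsilon>}. sol p r)))"

definition return_map :: "real \<Rightarrow> real" where
  "return_map p = sol p (return_time p)"

end

(* As long as the maximum over the window is attained at its left end, the solution started at q
   solves a linear delay equation and is the explicit function lsol q. Let hit q be the first time
   at which it catches up with its value one delay earlier (gain = 0). From then on it is its own
   running maximum and solves u' = -0.68 u + 1 - sin t until it meets the nullcline ftilde, which
   happens when the function bump, a growing oscillation with period 2 pi up to the factor growth,
   reaches the number threshold q. So the returned value depends on p only through the scalar
   peak p = threshold q, and it is a continuous decreasing function of peak p / growth ^ k as long
   as peak p stays between the consecutive maxima crest k and crest (k + 1) of bump (below crest 1
   when k = 0). The return map therefore jumps exactly where peak passes crest 1 and crest 2.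
   Since the level is maximal at the hitting time, the derivative of peak is
   - exp (0.68 hit q) * kern (hit q - q), where kern is the fundamental solution of the linear
   equation. It vanishes exactly when hit q - q is the zero of kern, which is an explicit monotone
   equation for q; this gives the unique critical point. What remains are numerical comparisons of
   peak with crests at a few points: the threshold is bounded below by the level at any time close
   to hit q, and above through the size of the gain. *)
theory Submission
  imports Defs
begin

subsection \<open>The initial value problem\<close>

text \<open>That the window maximum stays at the left end until \<open>hit q\<close> depends on the
  shape of \<open>lsol q\<close>, and this shape is needed for a continuum of starting times.
  Monotone dependence on q makes it finite: the q-derivatives of \<open>slope\<close> and
  \<open>gain\<close> are \<open>cos q\<close> times combinations of values of \<open>kern\<close>
  whose signs are known, so enclosures at the starting times 0, 7/100 and 3/25 govern whole ranges
  of q. Between 7/100 and 3/25 the slope may change sign repeatedly, and a direct comparison with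
  the start 3/25 replaces the decreasing-then-increasing shape.

  The delay is three quarters of the period of the forcing, so a shift by \<open>delay\<close>
  exchanges sine and cosine. This makes the integrals of \<open>kern\<close> against them
  elementary, and \<open>lsol q (q + s)\<close> becomes a combination of 1, \<open>sin q\<close> and
  \<open>cos q\<close> with coefficients depending on s alone: one enclosure in s serves every q.

  Derivatives are taken with respect to the initial value p directly, because \<open>arcsin\<close>
  is not differentiable at the ends of K and p = 0 has to be included.\<close>

definition delay :: real where "delay = 3 * pi / 2"

section \<open>The maximum over a moving window\<close>

definition window_max :: "(real \<Rightarrow> real) \<Rightarrow> real \<Rightarrow> real" where
  "window_max u t = (SUP s \<in> {t - delay..t}. u s)"

definition rhs :: "(real \<Rightarrow> real) \<Rightarrow> real \<Rightarrow> real" where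
  "rhs u t = 8/25 * u t - window_max u t + 1 - sin t"

lemma delay_pos [simp]: "0 < delay"
  by (simp add: delay_def)

lemma delay_nonneg [simp]: "0 \<le> delay"
  by (simp add: delay_def)

lemma bdd_above_window:
  fixes u :: "real \<Rightarrow> real"
  assumes "continuous_on {t - delay..t} u"
  shows "bdd_above (u ` {t - delay..t})"
  by (intro bounded_imp_bdd_above compact_imp_bounded compact_continuous_image assms compact_Icc)

lemma window_max_upper:
  assumes "continuous_on {t - delay..t} u" "s \<in> {t - delay..t}"
  shows "u s \<le> window_max u t"
  unfolding window_max_def by (rule cSUP_upper[OF assms(2) bdd_above_window[OF assms(1)]])

lemma window_max_le:
  assumes "\<And>s. s \<in> {t - delay..t} \<Longrightarrow> u s \<le> M"
  shows "window_max u t \<le> M"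
  unfolding window_max_def using assms by (intro cSUP_least) auto

lemma window_max_eqI:
  assumes "\<And>s. s \<in> {t - delay..t} \<Longrightarrow> u s \<le> u r" "r \<in> {t - delay..t}"
  shows "window_max u t = u r"
  unfolding window_max_def
  by (rule cSup_eq_maximum) (use assms in auto)

text \<open>Measuring positions from the right ends of the two windows lets one estimate serve
  twice: for one function at two times it gives continuity in t, for two functions at one time it
  gives the Lipschitz bound behind existence and uniqueness.\<close>

lemma window_max_diff:
  assumes u: "continuous_on {t - delay..t} u" and v: "continuous_on {t' - delay..t'} v"
    and le: "\<And>r. r \<in> {0..delay} \<Longrightarrow> \<bar>u (t - r) - v (t' - r)\<bar> \<le> M"
  shows "\<bar>window_max u t - window_max v t'\<bar> \<le> M"
proof -
  have "window_max u t \<le> window_max v t' + M"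
  proof (rule window_max_le)
    fix s assume s: "s \<in> {t - delay..t}"
    have "\<bar>u (t - (t - s)) - v (t' - (t - s))\<bar> \<le> M" using s by (intro le) auto
    moreover have "v (t' - (t - s)) \<le> window_max v t'"
      using s by (intro window_max_upper[OF v]) auto
    ultimately show "u s \<le> window_max v t' + M" by simp
  qed
  moreover have "window_max v t' \<le> window_max u t + M"
  proof (rule window_max_le)
    fix s assume s: "s \<in> {t' - delay..t'}"
    have "\<bar>u (t - (t' - s)) - v (t' - (t' - s))\<bar> \<le> M" using s by (intro le) auto
    moreover have "u (t - (t' - s)) \<le> window_max u t"
      using s by (intro window_max_upper[OF u]) auto
    ultimately show "v s \<le> window_max u t + M" by simp
  qed
  ultimately show ?thesis by linarith
qed

lemma continuous_window_max:
  assumes u: "continuous_on UNIV u"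
  shows "continuous_on UNIV (window_max u)"
  unfolding continuous_on_iff
proof (intro ballI allI impI)
  fix t e :: real assume e: "0 < e"
  have "uniformly_continuous_on {t - delay - 1..t + 1} u"
    by (intro compact_uniformly_continuous continuous_on_subset[OF u]) auto
  then obtain d where d: "d > 0"
    "\<And>r s. r \<in> {t - delay - 1..t + 1} \<Longrightarrow> s \<in> {t - delay - 1..t + 1} \<Longrightarrow> dist s r < d \<Longrightarrow> dist (u s) (u r) < e/2"
    unfolding uniformly_continuous_on_def using e by (metis half_gt_zero)
  show "\<exists>d>0. \<forall>t'\<in>UNIV. dist t' t < d \<longrightarrow> dist (window_max u t') (window_max u t) < e"
  proof (intro exI[of _ "min d 1"] conjI ballI impI)
    fix t' assume t': "dist t' t < min d 1"
    have "\<bar>window_max u t' - window_max u t\<bar> \<le> e/2"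
    proof (rule window_max_diff)
      fix r assume r: "r \<in> {0..delay}"
      have "dist (u (t' - r)) (u (t - r)) < e/2"
        by (rule d(2)) (use t' r in \<open>auto simp: dist_real_def\<close>)
      then show "\<bar>u (t' - r) - u (t - r)\<bar> \<le> e/2" by (simp add: dist_real_def)
    qed (auto intro: continuous_on_subset[OF u])
    then show "dist (window_max u t') (window_max u t) < e" using e by (simp add: dist_real_def)
  qed (use d in auto)
qed

section \<open>Antiderivatives and comparison through derivatives\<close>

lemma antiderivative_UNIV:
  fixes f :: "real \<Rightarrow> real"
  assumes "continuous_on UNIV f"
  obtains F where "\<And>x. (F has_real_derivative f x) (at x)"
proof -
  have "\<exists>F. \<forall>x::real. -\<infinity> < ereal x \<longrightarrow> ereal x < \<infinity> \<longrightarrow> (F has_vector_derivative f x) (at x)"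
    by (rule einterval_antiderivative) (use assms in \<open>auto simp: continuous_on_eq_continuous_at\<close>)
  then show ?thesis
    using that by (auto simp: has_real_derivative_iff_has_vector_derivative)
qed

lemma mono_on_of_deriv:
  fixes f :: "real \<Rightarrow> real"
  assumes "a \<le> b" "continuous_on {a..b} f"
    and "\<And>x. a < x \<Longrightarrow> x < b \<Longrightarrow> \<exists>D. (f has_real_derivative D) (at x) \<and> 0 \<le> D"
  shows "f a \<le> f b"
  by (rule DERIV_nonneg_imp_increasing_open[OF assms(1,3,2)])

lemma strict_mono_of_deriv:
  fixes f :: "real \<Rightarrow> real"
  assumes "a < b" "continuous_on {a..b} f"
    and "\<And>x. a < x \<Longrightarrow> x < b \<Longrightarrow> \<exists>D. (f has_real_derivative D) (at x) \<and> 0 < D"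
  shows "f a < f b"
  by (rule DERIV_pos_imp_increasing_open[OF assms(1,3,2)])

lemma abs_diff_le_of_deriv:
  fixes f g :: "real \<Rightarrow> real"
  assumes "a \<le> b" "continuous_on {a..b} f" "continuous_on {a..b} g"
    and f: "\<And>x. a < x \<Longrightarrow> x < b \<Longrightarrow> (f has_real_derivative f' x) (at x)"
    and g: "\<And>x. a < x \<Longrightarrow> x < b \<Longrightarrow> (g has_real_derivative g' x) (at x)"
    and le: "\<And>x. a < x \<Longrightarrow> x < b \<Longrightarrow> \<bar>f' x\<bar> \<le> g' x"
  shows "\<bar>f b - f a\<bar> \<le> g b - g a"
proof -
  have "g a - f a \<le> g b - f b"
    using assms(1)
  proof (rule mono_on_of_deriv)
    fix x assume x: "a < x" "x < b"
    show "\<exists>D. ((\<lambda>x. g x - f x) has_real_derivative D) (at x) \<and> 0 \<le> D"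
      using DERIV_diff[OF g[OF x] f[OF x]] le[OF x] by (intro exI conjI) auto
  qed (intro continuous_intros assms)
  moreover have "g a + f a \<le> g b + f b"
    using assms(1)
  proof (rule mono_on_of_deriv)
    fix x assume x: "a < x" "x < b"
    show "\<exists>D. ((\<lambda>x. g x + f x) has_real_derivative D) (at x) \<and> 0 \<le> D"
      using DERIV_add[OF g[OF x] f[OF x]] le[OF x] by (intro exI conjI) auto
  qed (intro continuous_intros assms)
  ultimately show ?thesis by linarith
qed

text \<open>The exponential weight turns the integral operator into a contraction of the Banach space of
  bounded continuous functions, globally in time.\<close>

definition weighted :: "real \<Rightarrow> (real \<Rightarrow>\<^sub>C real) \<Rightarrow> real \<Rightarrow> real" where
  "weighted q z t = exp (2 * max 0 (t - q)) * z (max 0 (t - q))"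

lemma continuous_weighted: "continuous_on UNIV (weighted q z)"
  unfolding weighted_def
  by (intro continuous_intros continuous_on_compose2[OF continuous_on_apply_bcontfun[of UNIV]]) auto

lemma continuous_rhs:
  assumes "continuous_on UNIV u"
  shows "continuous_on UNIV (rhs u)"
  unfolding rhs_def by (intro continuous_intros continuous_window_max assms)

lemma weighted_diff:
  assumes "dist z z' \<le> d"
  shows "\<bar>weighted q z t - weighted q z' t\<bar> \<le> exp (2 * max 0 (t - q)) * d"
proof -
  have "\<bar>z (max 0 (t - q)) - z' (max 0 (t - q))\<bar> \<le> d"
    using order_trans[OF dist_bounded assms] by (simp add: dist_real_def)
  then have "exp (2 * max 0 (t - q)) * \<bar>z (max 0 (t - q)) - z' (max 0 (t - q))\<bar> \<le> exp (2 * max 0 (t - q)) * d"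
    by (rule mult_left_mono) simp
  then show ?thesis
    unfolding weighted_def right_diff_distrib[symmetric] abs_mult by simp
qed

text \<open>The constant 33/25 is 8/25 from the linear term plus 1 from the window maximum.
  Integrating \<open>exp (2 * (t - q))\<close> divides it by 2 and leaves the contraction factor
  33/50; any weight rate above 33/25 would serve.\<close>

lemma rhs_weighted_diff:
  assumes d: "dist z z' \<le> d" and t: "q \<le> t"
  shows "\<bar>rhs (weighted q z) t - rhs (weighted q z') t\<bar> \<le> 33/25 * d * exp (2 * (t - q))"
proof -
  have d0: "0 \<le> d" using d zero_le_dist order_trans by blast
  have 1: "\<bar>weighted q z t - weighted q z' t\<bar> \<le> exp (2 * (t - q)) * d"
    using weighted_diff[OF d, of q t] t by simp
  have "\<bar>window_max (weighted q z) t - window_max (weighted q z') t\<bar> \<le> exp (2 * (t - q)) * d"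
  proof (rule window_max_diff)
    fix r assume r: "r \<in> {0..delay}"
    have "exp (2 * max 0 (t - r - q)) \<le> exp (2 * (t - q))" using r t by (auto simp: max_def)
    then show "\<bar>weighted q z (t - r) - weighted q z' (t - r)\<bar> \<le> exp (2 * (t - q)) * d"
      by (intro order_trans[OF weighted_diff[OF d]] mult_right_mono d0)
  qed (auto intro: continuous_on_subset[OF continuous_weighted])
  with 1 have "\<bar>rhs (weighted q z) t - rhs (weighted q z') t\<bar>
      \<le> 8/25 * (exp (2 * (t - q)) * d) + exp (2 * (t - q)) * d"
    unfolding rhs_def by linarith
  then show ?thesis by (simp add: algebra_simps)
qed

text \<open>Integral operator on profiles from which the weight has been divided out; the clamp
  \<open>max 0 m\<close> keeps the history equal to p. What has to be checked is that the image is
  bounded again, so that it is a point of the Banach space. Antiderivatives are determined only up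
  to a constant, hence the difference of two values of A.\<close>

lemma ex_solution_operator:
  "\<exists>T :: (real \<Rightarrow>\<^sub>C real) \<Rightarrow> (real \<Rightarrow>\<^sub>C real). \<forall>z. \<exists>A. (\<forall>t. (A has_real_derivative rhs (weighted q z) t) (at t)) \<and>
     (\<forall>m. T z m = exp (- 2 * max 0 m) * (p + A (q + max 0 m) - A q))"
proof (rule choice, intro allI)
  fix z :: "real \<Rightarrow>\<^sub>C real"
  obtain A where A: "\<And>t. (A has_real_derivative rhs (weighted q z) t) (at t)"
    using antiderivative_UNIV[OF continuous_rhs[OF continuous_weighted]] by metis
  define B where "B = \<bar>rhs (weighted q 0) q\<bar> + 0"
  have contA: "continuous_on X A" for X
    using A by (meson DERIV_isCont continuous_at_imp_continuous_on)
  let ?f = "\<lambda>m. exp (- 2 * max 0 m) * (p + A (q + max 0 m) - A q)"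
  \<comment> \<open>For the zero profile the right-hand side is the bare forcing, bounded by 2. The
    Lipschitz estimate from there shows that every right-hand side grows at most like the
    weight.\<close>
  have zero: "rhs (weighted q 0) t = 1 - sin t" for t
  proof -
    have "window_max (weighted q 0) t = weighted q 0 t"
      by (rule window_max_eqI) (auto simp: weighted_def)
    then show ?thesis by (simp add: rhs_def weighted_def)
  qed
  define C where "C = 33/25 * dist z 0 + 2"
  have C0: "0 \<le> C" by (simp add: C_def)
  have rb: "\<bar>rhs (weighted q z) t\<bar> \<le> C * exp (2 * (t - q))" if t: "q \<le> t" for t
  proof -
    have "1 \<le> exp (2 * (t - q))" using t by simp
    moreover have "\<bar>1 - sin t\<bar> \<le> 2" using sin_ge_minus_one[of t] sin_le_one[of t] by linarith
    ultimately have "\<bar>1 - sin t\<bar> \<le> 2 * exp (2 * (t - q))" by linarith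
    moreover have "\<bar>rhs (weighted q z) t - (1 - sin t)\<bar> \<le> 33/25 * dist z 0 * exp (2 * (t - q))"
      using rhs_weighted_diff[of z 0 "dist z 0", OF order_refl t] zero[of t] by simp
    moreover have "C * exp (2 * (t - q)) = 33/25 * dist z 0 * exp (2 * (t - q)) + 2 * exp (2 * (t - q))"
      unfolding C_def by (rule distrib_right)
    ultimately show ?thesis by linarith
  qed
  have bnd: "\<bar>?f m\<bar> \<le> \<bar>p\<bar> + C / 2" for m
  proof -
    define n where "n = max 0 m"
    have n: "0 \<le> n" by (simp add: n_def)
    have "\<bar>A (q + n) - A q\<bar> \<le> C / 2 * exp (2 * (q + n - q)) - C / 2 * exp (2 * (q - q))"
      by (rule abs_diff_le_of_deriv[where f' = "rhs (weighted q z)" and g = "\<lambda>t. C / 2 * exp (2 * (t - q))"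
            and g' = "\<lambda>t. C * exp (2 * (t - q))"])
        (use n rb A in \<open>auto intro!: contA continuous_intros derivative_eq_intros\<close>)
    then have "\<bar>A (q + n) - A q\<bar> \<le> C / 2 * exp (2 * n)" using C0 by simp
    moreover have "\<bar>p\<bar> * 1 \<le> \<bar>p\<bar> * exp (2 * n)"
      using n by (intro mult_left_mono) auto
    moreover have "exp (2 * n) * (\<bar>p\<bar> + C / 2) = \<bar>p\<bar> * exp (2 * n) + C / 2 * exp (2 * n)"
      by (simp add: algebra_simps)
    ultimately have "\<bar>p + A (q + n) - A q\<bar> \<le> exp (2 * n) * (\<bar>p\<bar> + C / 2)"
      by linarith
    then have "exp (- 2 * n) * \<bar>p + A (q + n) - A q\<bar> \<le> exp (- 2 * n) * (exp (2 * n) * (\<bar>p\<bar> + C / 2))"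
      by (intro mult_left_mono) auto
    also have "\<dots> = \<bar>p\<bar> + C / 2" by (simp add: exp_minus flip: mult.assoc)
    finally show ?thesis by (simp add: abs_mult n_def)
  qed
  have "?f \<in> bcontfun"
    by (rule bcontfun_normI[of _ "\<bar>p\<bar> + C / 2"])
      (auto simp: bnd[simplified] intro!: continuous_intros continuous_on_compose2[OF contA[of UNIV]])
  then obtain w where "apply_bcontfun w = ?f" by (metis bcontfunE)
  then show "\<exists>w. \<exists>A. (\<forall>t. (A has_real_derivative rhs (weighted q z) t) (at t)) \<and>
     (\<forall>m. apply_bcontfun w m = exp (- 2 * max 0 m) * (p + A (q + max 0 m) - A q))"
    using A by (intro exI[of _ w] exI[of _ A]) auto
qed

lemma ex_solution:
  "\<exists>u. continuous_on UNIV u \<and> (\<forall>t\<le>q. u t = p) \<and>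
     (\<forall>t\<ge>q. (u has_real_derivative rhs u t) (at t within {q..}))"
proof -
  obtain T :: "(real \<Rightarrow>\<^sub>C real) \<Rightarrow> (real \<Rightarrow>\<^sub>C real)" and A where
    A: "\<And>z t. (A z has_real_derivative rhs (weighted q z) t) (at t)" and
    T: "\<And>z m. T z m = exp (- 2 * max 0 m) * (p + A z (q + max 0 m) - A z q)"
    using ex_solution_operator[of q p] by metis
  have contA: "continuous_on X (A z)" for X z
    using A by (meson DERIV_isCont continuous_at_imp_continuous_on)
  have "dist (T z) (T z') \<le> 33/50 * dist z z'" for z z'
  proof (rule dist_bound)
    fix m :: real
    define n where "n = max 0 m"
    have n: "0 \<le> n" by (simp add: n_def)
    let ?g = "\<lambda>t. 33/50 * dist z z' * exp (2 * (t - q))"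
    have "\<bar>(A z (q + n) - A z' (q + n)) - (A z q - A z' q)\<bar> \<le> ?g (q + n) - ?g q"
      by (rule abs_diff_le_of_deriv[where f' = "\<lambda>t. rhs (weighted q z) t - rhs (weighted q z') t"
            and f = "\<lambda>t. A z t - A z' t"
            and g' = "\<lambda>t. 33/25 * dist z z' * exp (2 * (t - q))"])
        (use n rhs_weighted_diff[of z z' "dist z z'"] A in
          \<open>auto intro!: contA continuous_intros derivative_eq_intros\<close>)
    then have "\<bar>(A z (q + n) - A z q) - (A z' (q + n) - A z' q)\<bar> \<le> 33/50 * dist z z' * exp (2 * n)"
      using zero_le_dist[of z z'] unfolding add_diff_cancel_left' diff_self mult_zero_right exp_zero by linarith
    then have "exp (- 2 * n) * \<bar>(A z (q + n) - A z q) - (A z' (q + n) - A z' q)\<bar>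
        \<le> exp (- 2 * n) * (33/50 * dist z z' * exp (2 * n))"
      by (intro mult_left_mono) auto
    also have "\<dots> = 33/50 * dist z z'" by (simp add: exp_minus field_simps)
    finally have "\<bar>exp (- 2 * n) * ((A z (q + n) - A z q) - (A z' (q + n) - A z' q))\<bar> \<le> 33/50 * dist z z'"
      by (simp add: abs_mult)
    then show "dist (T z m) (T z' m) \<le> 33/50 * dist z z'"
      unfolding T dist_real_def n_def[symmetric] by (simp add: algebra_simps)
  qed
  then obtain z where z: "T z = z"
    using banach_fix_type[of "33/50" T] by auto
  define u where "u = weighted q z"
  have u: "u t = p + A z (q + max 0 (t - q)) - A z q" for t
    unfolding u_def weighted_def using T[of z "max 0 (t - q)"] by (simp add: z exp_minus)
  show ?thesis
  proof (intro exI[of _ u] conjI allI impI)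
    show "continuous_on UNIV u" by (simp add: u_def continuous_weighted)
    fix t assume t: "q \<le> t"
    have "((\<lambda>t. p + A z t - A z q) has_real_derivative rhs u t) (at t within {q..})"
      using A[of z t] unfolding u_def by (auto intro!: derivative_eq_intros DERIV_subset[OF A])
    then show "(u has_real_derivative rhs u t) (at t within {q..})"
      by (rule has_field_derivative_transform_within[of _ _ _ _ 1]) (use t in \<open>auto simp: u\<close>)
  qed (simp add: u)
qed

section \<open>Uniqueness and identification of the selected solution\<close>

lemma solution_unique:
  assumes u: "continuous_on {q - delay..T} u" "\<And>t. t \<in> {q..T} \<Longrightarrow> (u has_real_derivative rhs u t) (at t within {q..T})"
    and v: "continuous_on {q - delay..T} v" "\<And>t. t \<in> {q..T} \<Longrightarrow> (v has_real_derivative rhs v t) (at t within {q..T})"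
    and init: "\<And>t. t \<in> {q - delay..q} \<Longrightarrow> u t = v t"
    and t: "t \<in> {q - delay..T}"
  shows "u t = v t"
proof -
  have "\<forall>t\<in>{q - delay..min T (q + real n / 3)}. u t = v t" for n
  proof (induction n)
    case 0
    then show ?case using init by auto
  next
    case (Suc n)
    \<comment> \<open>Agreement is extended by 1/3 at a time. With the Lipschitz constant 33/25 the
      largest difference on the next piece is then at most 11/25 of itself, hence zero.\<close>
    define s where "s = q + real n / 3"
    define e where "e = min T (s + 1/3)"
    have eq: "u t = v t" if "t \<in> {q - delay..min T s}" for t
      using Suc.IH that by (simp add: s_def)
    show ?case
    proof (cases "s \<le> T")
      case False
      then show ?thesis using Suc.IH by (auto simp: s_def)
    next
      case True
      have qs: "q \<le> s" and se: "s \<le> e" and eT: "e \<le> T" and e3: "e \<le> s + 1/3"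
        using True by (auto simp: s_def e_def)
      define d where "d t = u t - v t" for t
      have cd: "continuous_on {q - delay..T} d" unfolding d_def by (intro continuous_intros u v)
      have "continuous_on {q - delay..e} (\<lambda>t. \<bar>d t\<bar>)"
        by (intro continuous_intros continuous_on_subset[OF cd]) (use eT in auto)
      moreover have "q - delay \<le> e" using qs se delay_pos by linarith
      then have "{q - delay..e} \<noteq> {}" by simp
      ultimately obtain m where m: "m \<in> {q - delay..e}" "\<And>t. t \<in> {q - delay..e} \<Longrightarrow> \<bar>d t\<bar> \<le> \<bar>d m\<bar>"
        using continuous_attains_sup[OF compact_Icc, of "q - delay" e "\<lambda>t. \<bar>d t\<bar>"] by blast
      have "d m = 0"
      proof (rule ccontr)
        assume dm: "d m \<noteq> 0"
        have ms: "s < m" using dm m(1) eq[of m] True by (cases "m \<le> s") (auto simp: d_def)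
        have "\<bar>d m - d s\<bar> \<le> 33/25 * \<bar>d m\<bar> * m - 33/25 * \<bar>d m\<bar> * s"
        proof (rule abs_diff_le_of_deriv[where f' = "\<lambda>t. rhs u t - rhs v t" and g' = "\<lambda>t. 33/25 * \<bar>d m\<bar>"])
          show "continuous_on {s..m} d"
            by (rule continuous_on_subset[OF cd]) (use m(1) eT order_trans[OF _ qs, of "q - delay"] in auto)
          fix t assume t: "s < t" "t < m"
          have tT: "q < t" "t < T" using t m(1) qs eT by auto
          then have at: "at t within {q..T} = at t" by (auto intro: at_within_Icc_at)
          show "(d has_real_derivative rhs u t - rhs v t) (at t)"
            unfolding d_def using DERIV_diff[OF u(2)[of t] v(2)[of t]] tT by (simp add: at)
          have wm: "\<bar>window_max u t - window_max v t\<bar> \<le> \<bar>d m\<bar>"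
          proof (rule window_max_diff)
            show "continuous_on {t - delay..t} u" "continuous_on {t - delay..t} v"
              by (rule continuous_on_subset[OF u(1)] continuous_on_subset[OF v(1)], use tT in auto)+
            fix r assume "r \<in> {0..delay}"
            then have "t - r \<in> {q - delay..e}" using tT t m(1) by auto
            then show "\<bar>u (t - r) - v (t - r)\<bar> \<le> \<bar>d m\<bar>" using m(2) by (auto simp: d_def)
          qed
          have "\<bar>u t - v t\<bar> \<le> \<bar>d m\<bar>"
            using m(2)[of t] tT t m(1) delay_pos by (auto simp: d_def)
          with wm show "\<bar>rhs u t - rhs v t\<bar> \<le> 33/25 * \<bar>d m\<bar>" unfolding rhs_def by linarith
        qed (use ms in \<open>auto intro!: continuous_intros derivative_eq_intros\<close>)
        moreover have "d s = 0" using eq[of s] qs True delay_pos by (simp add: d_def)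
        ultimately have "\<bar>d m\<bar> \<le> 33/25 * \<bar>d m\<bar> * (m - s)" by (simp add: algebra_simps)
        also have "\<dots> \<le> 33/25 * \<bar>d m\<bar> * (1/3)"
          using m(1) e3 by (intro mult_left_mono) auto
        finally show False using dm by simp
      qed
      then have "d t = 0" if "t \<in> {q - delay..e}" for t using m(2)[OF that] by simp
      moreover have "min T (q + real (Suc n) / 3) = e" by (simp add: e_def s_def add_divide_distrib)
      ultimately show ?thesis by (simp add: d_def)
    qed
  qed
  moreover obtain n :: nat where "3 * (T - q) \<le> real n" using real_arch_simple by blast
  moreover from this have "min T (q + real n / 3) = T" by auto
  ultimately show ?thesis using t by metis
qed

lemma start_time_ftilde:
  assumes "q \<in> {-(pi/2)..pi/2}"
  shows "start_time (ftilde q) = q"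
  unfolding start_time_def
proof (rule the_equality)
  fix r assume "r \<in> {-(pi/2)..pi/2} \<and> ftilde r = ftilde q"
  then have "sin r = sin q" "r \<in> {-(pi/2)..pi/2}" by (auto simp: ftilde_def)
  then show "r = q" using assms sin_inj_pi[of r q] by auto
qed (use assms in auto)

lemma is_solution_iff:
  "is_solution p u \<longleftrightarrow> (\<forall>s \<in> {start_time p - delay..start_time p}. u s = p) \<and>
     (\<forall>t\<ge>start_time p. (u has_real_derivative rhs u t) (at t within {start_time p..}))"
  unfolding is_solution_def rhs_def window_max_def delay_def by simp

lemma is_solution_sol: "is_solution p (sol p)"
proof -
  have "\<exists>u. is_solution p u"
    using ex_solution[of "start_time p" p] unfolding is_solution_iff by (meson atLeastAtMost_iff)
  then show ?thesis unfolding sol_def by (rule someI_ex)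
qed

lemma is_solution_continuous_on:
  assumes "is_solution p u"
  shows "continuous_on {start_time p - delay..} u"
proof -
  have 1: "continuous_on {start_time p - delay..start_time p} u"
    using assms unfolding is_solution_iff by (subst continuous_on_cong[OF refl, of _ _ "\<lambda>_. p"]) auto
  have 2: "continuous_on {start_time p..} u"
    using assms unfolding is_solution_iff
    by (auto simp: continuous_on_eq_continuous_within intro: DERIV_continuous)
  have "{start_time p - delay..} = {start_time p - delay..start_time p} \<union> {start_time p..}"
    using delay_pos by (intro set_eqI) (simp only: Un_iff atLeastAtMost_iff atLeast_iff, linarith)
  then show ?thesis using continuous_on_closed_Un[OF _ _ 1 2] by simp
qed

text \<open>\<open>sol p\<close> is a choice about which only the equation is known; through this
  lemma it inherits explicit formulas. The horizon T is finite because the explicit formula follows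
  the equation only until the return time.\<close>

lemma sol_eq:
  assumes p: "start_time p = q"
    and v: "continuous_on {q - delay..T} v" "\<And>t. t \<in> {q..T} \<Longrightarrow> (v has_real_derivative rhs v t) (at t within {q..T})"
    and init: "\<And>t. t \<in> {q - delay..q} \<Longrightarrow> v t = p"
    and t: "t \<in> {q - delay..T}"
  shows "sol p t = v t"
proof (rule solution_unique[OF _ _ v _ t])
  note s = is_solution_sol[of p, unfolded is_solution_iff p]
  show "continuous_on {q - delay..T} (sol p)"
    using is_solution_continuous_on[OF is_solution_sol, of p] p by (auto intro: continuous_on_subset)
  show "(sol p has_real_derivative rhs (sol p) t) (at t within {q..T})" if "t \<in> {q..T}" for t
    using s that by (auto intro: DERIV_subset)
  show "sol p t = v t" if "t \<in> {q - delay..q}" for t using s init that by auto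
qed

subsection \<open>The linear delay equation\<close>

text \<open>A cut-off at 0 keeps differentiability when the derivative vanishes there. This covers
  \<open>int_exp1\<close> and \<open>int_exp2\<close>; \<open>int_exp0\<close> has a corner at 0 and
  is differentiated for positive arguments only.\<close>

lemma DERIV_max_zero:
  fixes f f' :: "real \<Rightarrow> real"
  assumes f: "\<And>s. (f has_real_derivative f' s) (at s)" and f0: "f' 0 = 0"
  shows "((\<lambda>s. f (max 0 s)) has_real_derivative f' (max 0 s)) (at s)"
proof -
  consider "s < 0" | "s = 0" | "s > 0" by linarith
  then show ?thesis
  proof cases
    case 1
    have "((\<lambda>s. f 0) has_real_derivative f' (max 0 s)) (at s)"
      using 1 f0 by (simp add: max_def)
    then show ?thesis
      by (rule has_field_derivative_transform_within_open[where S = "{..<0}"]) (use 1 in \<open>auto simp: max_def\<close>)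
  next
    case 3
    have "(f has_real_derivative f' (max 0 s)) (at s)"
      using f[of s] 3 by (simp add: max_def)
    then show ?thesis
      by (rule has_field_derivative_transform_within_open[where S = "{0<..}"]) (use 3 in \<open>auto simp: max_def\<close>)
  next
    case 2
    have lim: "(\<lambda>h. (f (0 + h) - f 0) / h) \<midarrow>0\<rightarrow> 0"
      using f[of 0] by (simp add: DERIV_def f0)
    have "(\<lambda>h. (f (max 0 (0 + h)) - f (max 0 0)) / h) \<midarrow>0\<rightarrow> 0"
      by (rule Lim_null_comparison[OF _ tendsto_norm_zero[OF lim]]) (auto simp: max_def abs_if intro!: always_eventually)
    then show ?thesis using 2 by (simp add: DERIV_def f0)
  qed
qed

text \<open>The integrals of \<open>r ^ j / fact j * exp (8/25 * r)\<close> over \<open>{0..max 0 s}\<close>, for \<open>j\<close> = 0, 1, 2.\<close>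

definition int_exp0 :: "real \<Rightarrow> real" where
  "int_exp0 s = 25/8 * (exp (8/25 * max 0 s) - 1)"

definition int_exp1 :: "real \<Rightarrow> real" where
  "int_exp1 s = 25/8 * max 0 s * exp (8/25 * max 0 s) - 625/64 * (exp (8/25 * max 0 s) - 1)"

definition int_exp2 :: "real \<Rightarrow> real" where
  "int_exp2 s = 25/16 * (max 0 s)\<^sup>2 * exp (8/25 * max 0 s) - 625/64 * max 0 s * exp (8/25 * max 0 s)
     + 15625/512 * (exp (8/25 * max 0 s) - 1)"

lemma int_exp_nonpos [simp]: "s \<le> 0 \<Longrightarrow> int_exp0 s = 0" "s \<le> 0 \<Longrightarrow> int_exp1 s = 0" "s \<le> 0 \<Longrightarrow> int_exp2 s = 0"
  by (simp_all add: int_exp0_def int_exp1_def int_exp2_def max_def)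

lemma DERIV_int_exp0: "0 < s \<Longrightarrow> (int_exp0 has_real_derivative 8/25 * int_exp0 s + 1) (at s)"
proof -
  assume s: "0 < s"
  have "((\<lambda>s. 25/8 * (exp (8/25 * s) - 1)) has_real_derivative 8/25 * int_exp0 s + 1) (at s)"
    using s by (auto intro!: derivative_eq_intros simp: int_exp0_def max_def field_simps)
  then show ?thesis
    by (rule has_field_derivative_transform_within_open[where S = "{0<..}"]) (use s in \<open>auto simp: max_def int_exp0_def\<close>)
qed

lemma DERIV_int_exp1: "(int_exp1 has_real_derivative 8/25 * int_exp1 s + int_exp0 s) (at s)"
proof -
  have "((\<lambda>s. 25/8 * s * exp (8/25 * s) - 625/64 * (exp (8/25 * s) - 1)) has_real_derivative s * exp (8/25 * s)) (at s)" for s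
    by (auto intro!: derivative_eq_intros simp: field_simps)
  from DERIV_max_zero[OF this] have "(int_exp1 has_real_derivative max 0 s * exp (8/25 * max 0 s)) (at s)"
    unfolding int_exp1_def by simp
  then show ?thesis
    by (rule DERIV_cong) (simp add: int_exp1_def int_exp0_def field_simps)
qed

lemma DERIV_int_exp2: "(int_exp2 has_real_derivative 8/25 * int_exp2 s + int_exp1 s) (at s)"
proof -
  have "((\<lambda>s. 25/16 * s\<^sup>2 * exp (8/25 * s) - 625/64 * s * exp (8/25 * s) + 15625/512 * (exp (8/25 * s) - 1))
      has_real_derivative s\<^sup>2 * exp (8/25 * s) / 2) (at s)" for s
    by (auto intro!: derivative_eq_intros simp: field_simps power2_eq_square)
  from DERIV_max_zero[OF this]
  have "(int_exp2 has_real_derivative (max 0 s)\<^sup>2 * exp (8/25 * max 0 s) / 2) (at s)"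
    unfolding int_exp2_def by simp
  then show ?thesis
    by (rule DERIV_cong) (simp add: int_exp1_def int_exp2_def field_simps)
qed

text \<open>The fundamental solution: \<open>kern' s = 8/25 * kern s - kern (s - delay)\<close> with
  \<open>kern = 1\<close> on the negative axis. The formula is valid up to \<open>3 * delay\<close> only.\<close>

definition kern :: "real \<Rightarrow> real" where
  "kern s = 1 - 17/25 * (int_exp0 s - int_exp1 (s - delay) + int_exp2 (s - 2 * delay))"

lemma kern_nonpos: "s \<le> 0 \<Longrightarrow> kern s = 1"
proof -
  assume "s \<le> 0"
  then have "s - delay \<le> 0" "s - 2 * delay \<le> 0" using delay_pos by linarith+
  then show ?thesis using \<open>s \<le> 0\<close> by (simp add: kern_def)
qed

lemma continuous_on_kern [continuous_intros]: "continuous_on S f \<Longrightarrow> continuous_on S (\<lambda>x. kern (f x))"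
  unfolding kern_def int_exp0_def int_exp1_def int_exp2_def by (intro continuous_intros)

text \<open>Method of steps: starting from the constant 1 the right-hand side is 8/25 - 1 = - 17/25,
  and each further delay contributes one more iterated integral with alternating sign. The condition
  \<open>0 < s\<close> avoids the corner of \<open>int_exp0\<close>; up to \<open>3 * delay\<close>
  the shifted kernel needs only the first two integrals.\<close>

lemma DERIV_kern:
  assumes "0 < s" "s \<le> 3 * delay"
  shows "(kern has_real_derivative 8/25 * kern s - kern (s - delay)) (at s)"
proof -
  define a b c where "a = int_exp0 s" "b = int_exp1 (s - delay)" "c = int_exp2 (s - 2 * delay)"
  define b' c' where "b' = int_exp0 (s - delay)" "c' = int_exp1 (s - 2 * delay)"
  have "(kern has_real_derivative - 17/25 * ((8/25 * a + 1) - (8/25 * b + b') + (8/25 * c + c'))) (at s)"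
    unfolding kern_def [abs_def] a_b_c_def b'_c'_def
    by (rule derivative_eq_intros refl DERIV_int_exp0 assms DERIV_chain2[OF DERIV_int_exp1] DERIV_chain2[OF DERIV_int_exp2] | simp)+
  then show ?thesis
  proof (rule DERIV_cong)
  have "kern s = 1 - 17/25 * (a - b + c)" by (simp add: kern_def a_b_c_def)
  moreover have "kern (s - delay) = 1 - 17/25 * (b' - c')"
  proof -
    have "s - delay - delay = s - 2 * delay" "s - delay - 2 * delay \<le> 0" using assms by simp_all
    then show ?thesis by (simp add: kern_def b'_c'_def)
  qed
  ultimately show "- 17/25 * ((8/25 * a + 1) - (8/25 * b + b') + (8/25 * c + c')) = 8/25 * kern s - kern (s - delay)"
    by (simp add: field_simps)
  qed
qed

section \<open>Integrals of the fundamental solution against cosine and sine\<close>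

lemma ex_kern_integrals:
  "\<exists>C S. C 0 = 0 \<and> S 0 = 0 \<and> (\<forall>s. (C has_real_derivative kern s * cos s) (at s)) \<and>
     (\<forall>s. (S has_real_derivative kern s * sin s) (at s))"
proof -
  have "continuous_on UNIV (\<lambda>s. kern s * cos s)" "continuous_on UNIV (\<lambda>s. kern s * sin s)"
    by (intro continuous_intros)+
  then obtain C S where
    C: "\<And>s. (C has_real_derivative kern s * cos s) (at s)" and
    S: "\<And>s. (S has_real_derivative kern s * sin s) (at s)"
    by (elim antiderivative_UNIV) blast
  show ?thesis
    by (rule exI[of _ "\<lambda>s. C s - C 0"], rule exI[of _ "\<lambda>s. S s - S 0"])
      (auto intro!: derivative_eq_intros C S)
qed

definition kcos :: "real \<Rightarrow> real" where
  "kcos = (SOME C. C 0 = 0 \<and> (\<forall>s. (C has_real_derivative kern s * cos s) (at s)))"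

definition ksin :: "real \<Rightarrow> real" where
  "ksin = (SOME S. S 0 = 0 \<and> (\<forall>s. (S has_real_derivative kern s * sin s) (at s)))"

lemma kcos: "kcos 0 = 0" "(kcos has_real_derivative kern s * cos s) (at s)"
  and ksin: "ksin 0 = 0" "(ksin has_real_derivative kern s * sin s) (at s)"
proof -
  have "kcos 0 = 0 \<and> (\<forall>s. (kcos has_real_derivative kern s * cos s) (at s))"
    unfolding kcos_def using someI_ex[of "\<lambda>C. C 0 = 0 \<and> (\<forall>s. (C has_real_derivative kern s * cos s) (at s))"]
      ex_kern_integrals by blast
  moreover have "ksin 0 = 0 \<and> (\<forall>s. (ksin has_real_derivative kern s * sin s) (at s))"
    unfolding ksin_def using someI_ex[of "\<lambda>S. S 0 = 0 \<and> (\<forall>s. (S has_real_derivative kern s * sin s) (at s))"]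
      ex_kern_integrals by blast
  ultimately show "kcos 0 = 0" "(kcos has_real_derivative kern s * cos s) (at s)"
    "ksin 0 = 0" "(ksin has_real_derivative kern s * sin s) (at s)" by auto
qed

lemmas DERIV_kcos [derivative_intros] = DERIV_chain2[OF kcos(2)]
  and DERIV_ksin [derivative_intros] = DERIV_chain2[OF ksin(2)]

lemma continuous_on_kcos [continuous_intros]: "continuous_on S f \<Longrightarrow> continuous_on S (\<lambda>x. kcos (f x))"
  and continuous_on_ksin [continuous_intros]: "continuous_on S f \<Longrightarrow> continuous_on S (\<lambda>x. ksin (f x))"
proof -
  have "continuous_on UNIV kcos" "continuous_on UNIV ksin"
    using kcos(2) ksin(2) DERIV_isCont by (blast intro: continuous_at_imp_continuous_on)+
  then show "continuous_on S f \<Longrightarrow> continuous_on S (\<lambda>x. kcos (f x))"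
    "continuous_on S f \<Longrightarrow> continuous_on S (\<lambda>x. ksin (f x))"
    using continuous_on_compose2[OF _ _ subset_UNIV] by blast+
qed

lemma const_of_deriv_zero:
  fixes f :: "real \<Rightarrow> real"
  assumes "a \<le> b" "continuous_on {a..b} f" "\<And>x. a < x \<Longrightarrow> x < b \<Longrightarrow> (f has_real_derivative 0) (at x)"
  shows "f b = f a"
proof (cases "a = b")
  case False
  then show ?thesis using assms by (intro DERIV_isconst_end) auto
qed simp

lemma kcos_nonpos: "kcos s = sin s" if "s \<le> 0"
proof -
  have "kcos 0 - sin 0 = kcos s - sin s"
    using that by (intro const_of_deriv_zero[of s 0 "\<lambda>s. kcos s - sin s"])
      (auto intro!: derivative_eq_intros continuous_intros simp: kern_nonpos)
  then show ?thesis by (simp add: kcos)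
qed

lemma ksin_nonpos: "ksin s = 1 - cos s" if "s \<le> 0"
proof -
  have "ksin 0 + cos 0 = ksin s + cos s"
    using that by (intro const_of_deriv_zero[of s 0 "\<lambda>s. ksin s + cos s"])
      (auto intro!: derivative_eq_intros continuous_intros simp: kern_nonpos)
  then show ?thesis by (simp add: ksin)
qed

lemma sin_diff_delay [simp]: "sin (t - delay) = cos t"
  and cos_diff_delay [simp]: "cos (t - delay) = - sin t"
proof -
  have "sin delay = -1" "cos delay = 0"
    using sin_3over2_pi cos_3over2_pi by (simp_all add: delay_def)
  then show "sin (t - delay) = cos t" "cos (t - delay) = - sin t"
    unfolding sin_diff cos_diff by simp_all
qed

text \<open>Integration by parts of the derivative of \<open>kern\<close> against cosine and sine.
  The delayed term is again one of the two integrals, because a shift by three quarters of a period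
  turns one trigonometric function into the other up to sign; the constants collect the boundary
  values at 0 and \<open>- delay\<close>.\<close>

lemma
  assumes "0 \<le> s" "s \<le> 3 * delay"
  shows kcos_ksin_delay1: "8/25 * kcos s - ksin s = kern s * cos s - 2 + ksin (s - delay)"
    and kcos_ksin_delay2: "8/25 * ksin s + kcos s = kern s * sin s + 1 - kcos (s - delay)"
proof -
  have d: "(kern has_real_derivative 8/25 * kern x - kern (x - delay)) (at x)" if "0 < x" "x < s" for x
    using that assms by (intro DERIV_kern) auto
  have c: "continuous_on {0..s} (\<lambda>s. kern (s - delay))" "continuous_on {0..s} kern"
    by (intro continuous_intros)+
  let ?f = "\<lambda>s. 8/25 * kcos s - ksin s - kern s * cos s + 2 - ksin (s - delay)"
  have "?f s = ?f 0"
    using assms(1)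
  proof (rule const_of_deriv_zero)
    fix x assume x: "0 < x" "x < s"
    show "(?f has_real_derivative 0) (at x)"
      by (rule derivative_eq_intros refl d x | simp add: field_simps)+
  qed (intro continuous_intros)
  then show "8/25 * kcos s - ksin s = kern s * cos s - 2 + ksin (s - delay)"
    using cos_diff_delay[of 0] by (simp add: kcos ksin kern_nonpos ksin_nonpos)
  let ?g = "\<lambda>s. 8/25 * ksin s + kcos s - kern s * sin s - 1 + kcos (s - delay)"
  have "?g s = ?g 0"
    using assms(1)
  proof (rule const_of_deriv_zero)
    fix x assume x: "0 < x" "x < s"
    show "(?g has_real_derivative 0) (at x)"
      by (rule derivative_eq_intros refl d x | simp add: field_simps)+
  qed (intro continuous_intros)
  then show "8/25 * ksin s + kcos s = kern s * sin s + 1 - kcos (s - delay)"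
    using sin_diff_delay[of 0] by (simp add: kcos ksin kern_nonpos kcos_nonpos)
qed

text \<open>Variation of constants for the equation in which the maximum over the window is replaced by the
  value at its left end; the history before \<open>q\<close> is the constant \<open>ftilde q\<close>.\<close>

definition lsol :: "real \<Rightarrow> real \<Rightarrow> real" where
  "lsol q t = ftilde t + 25/17 * (cos t * kcos (t - q) + sin t * ksin (t - q))"

definition slope :: "real \<Rightarrow> real \<Rightarrow> real" where
  "slope q t = 25/17 * (- cos t - sin t * kcos (t - q) + cos t * ksin (t - q) + kern (t - q) * cos q)"

lemma ftilde_alt: "ftilde t = 25/17 * (1 - sin t)"
  by (simp add: ftilde_def)

lemma cos_sin_rotate: "cos (t::real) * cos (t - q) + sin t * sin (t - q) = cos q"
  using cos_diff[of t "t - q"] by simp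

lemma DERIV_ftilde: "(ftilde has_real_derivative - 25/17 * cos t) (at t)"
  unfolding ftilde_alt[abs_def] by (auto intro!: derivative_eq_intros)

lemma DERIV_lsol: "(lsol q has_real_derivative slope q t) (at t)"
proof -
  have "(lsol q has_real_derivative - 25/17 * cos t + 25/17 * (- sin t * kcos (t - q) + cos t * (kern (t - q) * cos (t - q))
      + cos t * ksin (t - q) + sin t * (kern (t - q) * sin (t - q)))) (at t)"
    unfolding lsol_def [abs_def] by (rule derivative_eq_intros DERIV_ftilde refl | simp add: algebra_simps)+
  then show ?thesis
  proof (rule DERIV_cong)
  have "kern (t - q) * cos q = cos t * (kern (t - q) * cos (t - q)) + sin t * (kern (t - q) * sin (t - q))"
    unfolding cos_sin_rotate[of t q, symmetric] by (simp add: algebra_simps)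
  then show "- 25/17 * cos t + 25/17 * (- sin t * kcos (t - q) + cos t * (kern (t - q) * cos (t - q))
      + cos t * ksin (t - q) + sin t * (kern (t - q) * sin (t - q))) = slope q t"
    unfolding slope_def by (simp add: field_simps)
  qed
qed

lemma lsol_init: "t \<le> q \<Longrightarrow> lsol q t = ftilde q"
  using sin_diff[of t "t - q"] by (simp add: lsol_def ftilde_alt kcos_nonpos ksin_nonpos field_simps)

lemma slope_init: "t \<le> q \<Longrightarrow> slope q t = 0"
  using cos_diff[of t "t - q"] by (simp add: slope_def kern_nonpos kcos_nonpos ksin_nonpos field_simps)

text \<open>The two integration-by-parts relations express \<open>kern (t - q) * cos q\<close>
  through the integrals and their delayed values. Substituted into \<open>slope\<close>, they leave
  exactly the delay equation, on the range in which \<open>kern\<close> solves its own.\<close>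

lemma slope_eq:
  assumes "q \<le> t" "t \<le> q + 3 * delay"
  shows "slope q t = 8/25 * lsol q t - lsol q (t - delay) + 1 - sin t"
proof -
  define c d c' d' w where "c = kcos (t - q)" "d = ksin (t - q)" "c' = kcos (t - q - delay)" "d' = ksin (t - q - delay)" "w = kern (t - q)"
  note df = this
  have 1: "8/25 * c - d = w * cos (t - q) - 2 + d'" and 2: "8/25 * d + c = w * sin (t - q) + 1 - c'"
    using kcos_ksin_delay1[of "t - q"] kcos_ksin_delay2[of "t - q"] assms by (simp_all add: df)
  have e: "t - delay - q = t - q - delay" by simp
  have "w * cos q = cos t * (w * cos (t - q)) + sin t * (w * sin (t - q))"
    unfolding cos_sin_rotate[of t q, symmetric] by (simp add: algebra_simps)
  also have "\<dots> = cos t * (8/25 * c - d + 2 - d') + sin t * (8/25 * d + c - 1 + c')"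
    using 1 2 by simp
  finally have w: "w * cos q = cos t * (8/25 * c - d + 2 - d') + sin t * (8/25 * d + c - 1 + c')" .
  show ?thesis
    unfolding slope_def lsol_def ftilde_alt e df(1-5)[symmetric] w sin_diff_delay cos_diff_delay
    by (simp add: field_simps)
qed

section \<open>Gain over one delay, and derivatives in the starting time\<close>

definition gain :: "real \<Rightarrow> real \<Rightarrow> real" where
  "gain q t = lsol q t - lsol q (t - delay)"

lemma slope_gain: "q \<le> t \<Longrightarrow> t \<le> q + 3 * delay \<Longrightarrow> slope q t = 17/25 * (ftilde t - lsol q t) + gain q t"
  using slope_eq[of q t] by (simp add: gain_def ftilde_alt field_simps)

lemma DERIV_gain: "(gain q has_real_derivative slope q t - slope q (t - delay)) (at t)"
  unfolding gain_def [abs_def]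
  by (rule derivative_eq_intros DERIV_lsol DERIV_chain2[OF DERIV_lsol] refl | simp)+

lemma DERIV_slope:
  assumes "q < t" "t < q + 3 * delay"
  shows "(slope q has_real_derivative 8/25 * slope q t - slope q (t - delay) - cos t) (at t)"
proof -
  have "((\<lambda>t. 8/25 * lsol q t - lsol q (t - delay) + 1 - sin t) has_real_derivative
      8/25 * slope q t - slope q (t - delay) - cos t) (at t)"
    by (rule derivative_eq_intros DERIV_lsol DERIV_chain2[OF DERIV_lsol] refl | simp)+
  then show ?thesis
    by (rule has_field_derivative_transform_within_open[where S = "{q<..<q + 3 * delay}"])
      (use assms in \<open>auto simp: slope_eq\<close>)
qed

lemma continuous_on_ftilde [continuous_intros]:
  fixes f :: "'a::t2_space \<Rightarrow> real"
  shows "continuous_on S f \<Longrightarrow> continuous_on S (\<lambda>x. ftilde (f x))"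
  unfolding ftilde_alt by (intro continuous_intros)

lemma continuous_on_lsol [continuous_intros]:
  fixes f g :: "'a::t2_space \<Rightarrow> real"
  shows "continuous_on S f \<Longrightarrow> continuous_on S g \<Longrightarrow> continuous_on S (\<lambda>x. lsol (f x) (g x))"
  unfolding lsol_def by (intro continuous_intros)

lemma continuous_on_slope [continuous_intros]:
  fixes f g :: "'a::t2_space \<Rightarrow> real"
  shows "continuous_on S f \<Longrightarrow> continuous_on S g \<Longrightarrow> continuous_on S (\<lambda>x. slope (f x) (g x))"
  unfolding slope_def by (intro continuous_intros)

lemma continuous_on_gain [continuous_intros]:
  fixes f g :: "'a::t2_space \<Rightarrow> real"
  shows "continuous_on S f \<Longrightarrow> continuous_on S g \<Longrightarrow> continuous_on S (\<lambda>x. gain (f x) (g x))"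
  unfolding gain_def by (intro continuous_intros)

text \<open>The history ends on the nullcline, so the solution leaves q with slope zero and moving q
  only changes the level of the history. The effect at time t is therefore
  \<open>kern (t - q)\<close> times the derivative \<open>- 25/17 * cos q\<close> of
  \<open>ftilde\<close>.\<close>

lemma DERIV_lsol_start: "((\<lambda>q. lsol q t) has_real_derivative - 25/17 * kern (t - q) * cos q) (at q)"
proof -
  have "((\<lambda>q. lsol q t) has_real_derivative 25/17 * (cos t * (kern (t - q) * cos (t - q) * -1) + sin t * (kern (t - q) * sin (t - q) * -1))) (at q)"
    unfolding lsol_def by (rule derivative_eq_intros refl | simp)+
  then show ?thesis
    by (rule DERIV_cong) (simp add: cos_sin_rotate[of t q, symmetric] field_simps)
qed

lemma DERIV_gain_start:
  "((\<lambda>q. gain q t) has_real_derivative 25/17 * (kern (t - q - delay) - kern (t - q)) * cos q) (at q)"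
proof -
  have "t - delay - q = t - q - delay" by simp
  then show ?thesis
    unfolding gain_def
    by (intro DERIV_cong[OF DERIV_diff[OF DERIV_lsol_start[of t q] DERIV_lsol_start[of "t - delay" q]]])
      (simp add: field_simps)
qed

lemma DERIV_slope_start:
  assumes "q < t" "t < q + 3 * delay"
  shows "((\<lambda>q. slope q t) has_real_derivative 25/17 * (kern (t - q - delay) - 8/25 * kern (t - q)) * cos q) (at q)"
proof -
  have e: "t - delay - q = t - q - delay" by simp
  have "((\<lambda>q. 8/25 * lsol q t - lsol q (t - delay) + 1 - sin t) has_real_derivative
      25/17 * (kern (t - q - delay) - 8/25 * kern (t - q)) * cos q) (at q)"
    by (rule derivative_eq_intros DERIV_lsol_start refl)+ (simp add: e field_simps)
  then show ?thesis
    by (rule has_field_derivative_transform_within_open[where S = "{t - 3 * delay<..<t}"])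
      (use assms in \<open>auto simp: slope_eq\<close>)
qed

abbreviation exp_delay :: real where
  "exp_delay \<equiv> exp (8/25 * delay)"

section \<open>Closed forms on successive delay intervals\<close>

lemma kern_phase1: "0 \<le> s \<Longrightarrow> s \<le> delay \<Longrightarrow> kern s = 25/8 - 17/8 * exp (8/25 * s)"
  by (simp add: kern_def int_exp0_def field_simps)

lemma kern_phase2:
  assumes "0 \<le> r" "r \<le> delay"
  shows "kern (delay + r) = 625/64 - 425/64 * exp (8/25 * r) + 17/8 * (r * exp (8/25 * r))
     - 17/8 * (exp_delay * exp (8/25 * r))"
proof -
  have "exp (8/25 * (delay + r)) = exp_delay * exp (8/25 * r)" by (simp add: ring_distribs exp_add)
  moreover have "delay + r - 2 * delay \<le> 0" "0 \<le> delay + r" using assms by simp_all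
  ultimately show ?thesis using assms
    by (simp add: kern_def int_exp0_def int_exp1_def max_absorb2 field_simps)
qed

lemma kern_phase3:
  assumes "0 \<le> r"
  shows "kern (2 * delay + r) = 15625/512 - 425/64 * (exp_delay * exp (8/25 * r)) + 17/8 * (r * (exp_delay * exp (8/25 * r)))
     + 17/8 * ((delay - exp_delay) * (exp_delay * exp (8/25 * r)))
     - 17/16 * (r * r * exp (8/25 * r)) + 425/64 * (r * exp (8/25 * r)) - 10625/512 * exp (8/25 * r)"
proof -
  have e: "exp (8/25 * (delay + r)) = exp_delay * exp (8/25 * r)"
    "exp (8/25 * (2 * delay + r)) = exp_delay * exp_delay * exp (8/25 * r)"
    by (simp_all add: ring_distribs flip: exp_add)
  have m: "max 0 (2 * delay + r) = 2 * delay + r" "max 0 (delay + r) = delay + r" "max 0 r = r"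
    using assms delay_nonneg by (simp_all add: max_def del: delay_nonneg)
  have "2 * delay + r - delay = delay + r" "2 * delay + r - 2 * delay = r" by simp_all
  then show ?thesis
    unfolding kern_def int_exp0_def int_exp1_def int_exp2_def by (simp only: m e) (simp add: field_simps power2_eq_square)
qed

text \<open>Coordinates of \<^term>\<open>lsol q (q + s)\<close> with respect to \<^term>\<open>sin q\<close> and \<^term>\<open>cos q\<close>.\<close>

definition sin_coord :: "real \<Rightarrow> real" where
  "sin_coord s = - cos s - kcos s * sin s + ksin s * cos s"

definition cos_coord :: "real \<Rightarrow> real" where
  "cos_coord s = - sin s + kcos s * cos s + ksin s * sin s"

lemma lsol_coord: "17 * lsol q (q + s) = 25 + 25 * (sin q * sin_coord s) + 25 * (cos q * cos_coord s)"
  unfolding lsol_def sin_coord_def cos_coord_def ftilde_alt by (simp add: sin_add cos_add field_simps)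

lemma slope_coord: "17 * slope q (q + s) = 25 * (cos q * sin_coord s) + 25 * (cos q * kern s) - 25 * (sin q * cos_coord s)"
  unfolding slope_def sin_coord_def cos_coord_def by (simp add: sin_add cos_add field_simps)

lemma coord_nonpos: "s \<le> 0 \<Longrightarrow> sin_coord s = - 1" "s \<le> 0 \<Longrightarrow> cos_coord s = 0"
  using sin_cos_squared_add[of s]
  by (simp_all add: sin_coord_def cos_coord_def kcos_nonpos ksin_nonpos algebra_simps power2_eq_square)

lemma cos_add_delay: "cos (delay + r) = sin r" and sin_add_delay: "sin (delay + r) = - cos r"
  using sin_diff_delay[of "delay + r"] cos_diff_delay[of "delay + r"] by simp_all

text \<open>At \<open>delay + r\<close> the integrals \<open>kcos\<close> and \<open>ksin\<close>
  solve a 2 by 2 linear system with determinant 1 + (8/25)^2 = 689/625. The resulting recursion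
  computes the coordinates from \<open>kern\<close>, sine and cosine, so no numerical integration is
  needed.\<close>

lemma
  assumes "- delay \<le> r" "r \<le> 2 * delay"
  shows sin_coord_step: "689 * sin_coord (delay + r) =
      200 * sin_coord r - 625 * cos_coord r - 625 * kern (delay + r) + 136 * sin r + 425 * cos r"
    and cos_coord_step: "689 * cos_coord (delay + r) =
      625 * sin_coord r + 200 * cos_coord r + 200 * kern (delay + r) + 425 * sin r - 136 * cos r"
proof -
  define c d c' d' w where "c = kcos (delay + r)" "d = ksin (delay + r)" "c' = kcos r" "d' = ksin r" "w = kern (delay + r)"
  note df = this
  have 1: "8/25 * c - d = w * sin r - 2 + d'" and 2: "8/25 * d + c = - w * cos r + 1 - c'"
    using kcos_ksin_delay1[of "delay + r"] kcos_ksin_delay2[of "delay + r"] assms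
    by (simp_all add: df cos_add_delay sin_add_delay)
  have d: "d = (200 * (- w * cos r + 1 - c') - 625 * (w * sin r - 2 + d')) / 689"
    and c: "c = (200 * (w * sin r - 2 + d') + 625 * (- w * cos r + 1 - c')) / 689"
    using 1 2 by simp_all
  have sq: "cos r * cos r = 1 - sin r * sin r" using sin_cos_squared_add[of r] by (simp add: power2_eq_square)
  have w: "w * (sin r * sin r) + w * (cos r * cos r) = w" unfolding sq by (simp add: algebra_simps)
  show "689 * sin_coord (delay + r) =
      200 * sin_coord r - 625 * cos_coord r - 625 * kern (delay + r) + 136 * sin r + 425 * cos r"
    unfolding sin_coord_def cos_coord_def cos_add_delay sin_add_delay df(1-5)[symmetric] c d
    using w by (simp add: field_simps)
  show "689 * cos_coord (delay + r) =
      625 * sin_coord r + 200 * cos_coord r + 200 * kern (delay + r) + 425 * sin r - 136 * cos r"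
    unfolding sin_coord_def cos_coord_def cos_add_delay sin_add_delay df(1-5)[symmetric] c d
    using w by (simp add: field_simps)
qed

lemma coord_phase1:
  assumes "0 \<le> s" "s \<le> delay"
  shows "689 * sin_coord s = 136 * cos s - 425 * sin s - 200 - 625 * kern s"
    and "689 * cos_coord s = 425 * cos s + 136 * sin s - 625 + 200 * kern s"
  using sin_coord_step[of "s - delay"] cos_coord_step[of "s - delay"] coord_nonpos[of "s - delay"] assms
  by simp_all

subsection \<open>Numerical enclosures\<close>

abbreviation encl :: "real \<Rightarrow> real \<Rightarrow> real \<Rightarrow> bool" where
  "encl l x u \<equiv> l \<le> x \<and> x \<le> u"

lemma sin_taylor:
  fixes x :: real
  shows "\<bar>sin x - (x - x^3/6 + x^5/120 - x^7/5040 + x^9/362880 - x^11/39916800 + x^13/6227020800)\<bar> \<le> \<bar>x\<bar>^15 / 1307674368000"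
proof -
  have "(\<Sum>m<15. sin_coeff m * x ^ m) = x - x^3/6 + x^5/120 - x^7/5040 + x^9/362880 - x^11/39916800 + x^13/6227020800"
    by (simp add: lessThan_nat_numeral sin_coeff_def fact_numeral)
  moreover have "inverse (fact 15) * \<bar>x\<bar> ^ 15 = \<bar>x\<bar> ^ 15 / 1307674368000"
    by (simp add: fact_numeral)
  ultimately show ?thesis
    using Maclaurin_sin_bound[of x 15] by (simp only:)
qed

lemma cos_taylor:
  fixes x :: real
  shows "\<bar>cos x - (1 - x^2/2 + x^4/24 - x^6/720 + x^8/40320 - x^10/3628800 + x^12/479001600)\<bar> \<le> \<bar>x\<bar>^14 / 87178291200"
proof -
  obtain t where t: "cos x = (\<Sum>m<14. cos_coeff m * x ^ m) + (cos (t + 1/2 * real 14 * pi) / fact 14) * x ^ 14"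
    using Maclaurin_cos_expansion[of x 14] by blast
  have "\<bar>cos y / fact 14\<bar> \<le> 1 / fact 14" for y :: real
    by (simp add: divide_right_mono)
  then have "\<bar>(cos (t + 1/2 * real 14 * pi) / fact 14) * x ^ 14\<bar> \<le> 1 / fact 14 * \<bar>x\<bar>^14"
    unfolding abs_mult power_abs by (intro mult_right_mono) auto
  then have "\<bar>cos x - (\<Sum>m<14. cos_coeff m * x ^ m)\<bar> \<le> 1 / fact 14 * \<bar>x\<bar>^14"
    using t by simp
  moreover have "(\<Sum>m<14. cos_coeff m * x ^ m) = 1 - x^2/2 + x^4/24 - x^6/720 + x^8/40320 - x^10/3628800 + x^12/479001600"
    by (simp add: lessThan_nat_numeral cos_coeff_def fact_numeral)
  ultimately show ?thesis
    by (simp add: fact_numeral)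
qed

lemma exp_taylor:
  fixes x :: real
  assumes "\<bar>x\<bar> \<le> 1/2"
  shows "\<bar>exp x - (1 + x + x^2/2 + x^3/6 + x^4/24 + x^5/120 + x^6/720 + x^7/5040 + x^8/40320 + x^9/362880)\<bar> \<le> \<bar>x\<bar>^10 / 1814400"
proof -
  obtain t where t: "\<bar>t\<bar> \<le> \<bar>x\<bar>" "exp x = (\<Sum>m<10. x ^ m / fact m) + exp t / fact 10 * x ^ 10"
    using Maclaurin_exp_le[of x 10] by blast
  have "exp t \<le> exp (1/2)" using t assms by simp
  also have "\<dots> \<le> 2" using exp_bound[of "1/2"] by (simp add: power2_eq_square)
  finally have "exp t / fact 10 \<le> 2 / fact 10" by (intro divide_right_mono) auto
  then have "\<bar>exp t / fact 10 * x ^ 10\<bar> \<le> 2 / fact 10 * \<bar>x\<bar>^10"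
    unfolding abs_mult abs_divide power_abs by (intro mult_right_mono) auto
  then have "\<bar>exp x - (\<Sum>m<10. x ^ m / fact m)\<bar> \<le> 2 / fact 10 * \<bar>x\<bar>^10"
    using t by simp
  moreover have "(\<Sum>m<10. x ^ m / fact m) = 1 + x + x^2/2 + x^3/6 + x^4/24 + x^5/120 + x^6/720 + x^7/5040 + x^8/40320 + x^9/362880"
    by (simp add: lessThan_nat_numeral fact_numeral)
  ultimately show ?thesis
    by (simp add: fact_numeral)
qed

lemma sin_enclosure:
  fixes x :: real
  assumes "L \<le> x - x^3/6 + x^5/120 - x^7/5040 + x^9/362880 - x^11/39916800 + x^13/6227020800 - \<bar>x\<bar>^15 / 1307674368000"
    and "x - x^3/6 + x^5/120 - x^7/5040 + x^9/362880 - x^11/39916800 + x^13/6227020800 + \<bar>x\<bar>^15 / 1307674368000 \<le> U"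
  shows "encl L (sin x) U"
  using sin_taylor[of x] assms by linarith

lemma cos_enclosure:
  fixes x :: real
  assumes "L \<le> 1 - x^2/2 + x^4/24 - x^6/720 + x^8/40320 - x^10/3628800 + x^12/479001600 - \<bar>x\<bar>^14 / 87178291200"
    and "1 - x^2/2 + x^4/24 - x^6/720 + x^8/40320 - x^10/3628800 + x^12/479001600 + \<bar>x\<bar>^14 / 87178291200 \<le> U"
  shows "encl L (cos x) U"
  using cos_taylor[of x] assms by linarith

lemma exp_enclosure:
  fixes x :: real
  assumes "\<bar>x\<bar> \<le> 1/2"
    and "L \<le> 1 + x + x^2/2 + x^3/6 + x^4/24 + x^5/120 + x^6/720 + x^7/5040 + x^8/40320 + x^9/362880 - \<bar>x\<bar>^10 / 1814400"
    and "1 + x + x^2/2 + x^3/6 + x^4/24 + x^5/120 + x^6/720 + x^7/5040 + x^8/40320 + x^9/362880 + \<bar>x\<bar>^10 / 1814400 \<le> U"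
  shows "encl L (exp x) U"
  using exp_taylor[of x] assms by linarith

text \<open>Argument reduction: the Taylor bound for the exponential is limited to arguments of
  modulus at most 1/2, and x / 8 stays within it for every x that occurs.\<close>

lemma exp_enclosure8:
  fixes x :: real
  assumes "encl l (exp (x / 8)) u" "0 \<le> l" "L \<le> l ^ 8" "u ^ 8 \<le> U"
  shows "encl L (exp x) U"
proof -
  have "exp x = exp (x / 8) ^ 8" by (simp flip: exp_of_nat_mult)
  moreover have "l ^ 8 \<le> exp (x / 8) ^ 8" "exp (x / 8) ^ 8 \<le> u ^ 8" using assms by (auto intro: power_mono)
  ultimately show ?thesis using assms(3,4) by linarith
qed

section \<open>Interval arithmetic\<close>

definition prod_min :: "real \<Rightarrow> real \<Rightarrow> real \<Rightarrow> real \<Rightarrow> real" where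
  "prod_min a b c d = min (min (a * c) (a * d)) (min (b * c) (b * d))"

definition prod_max :: "real \<Rightarrow> real \<Rightarrow> real \<Rightarrow> real \<Rightarrow> real" where
  "prod_max a b c d = max (max (a * c) (a * d)) (max (b * c) (b * d))"

lemmas prod_simps = prod_min_def prod_max_def min_def max_def

text \<open>The product is affine in each factor, so its extremes over a box are attained at
  corners; the factors may have any sign.\<close>

lemma prod_min_max:
  assumes xy: "encl a x b" "encl c y d"
  shows "prod_min a b c d \<le> x * y" "x * y \<le> prod_max a b c d"
proof -
  have lin: "encl (min (a * z) (b * z)) (x * z) (max (a * z) (b * z))" if "encl a x b" for a b x z :: real
  proof (cases "0 \<le> z")
    case True
    then have "a * z \<le> x * z" "x * z \<le> b * z" using that by (auto intro: mult_right_mono)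
    then show ?thesis by linarith
  next
    case False
    then have "b * z \<le> x * z" "x * z \<le> a * z" using that by (auto intro: mult_right_mono_neg)
    then show ?thesis by linarith
  qed
  show "prod_min a b c d \<le> x * y" "x * y \<le> prod_max a b c d"
    using lin[OF xy(1), of c] lin[OF xy(1), of d] lin[OF xy(2), of x]
    unfolding prod_min_def prod_max_def by (simp_all only: mult.commute[of x]) linarith+
qed

lemma mult_enclosure:
  assumes "encl a x b" "encl c y d" "L \<le> prod_min a b c d" "prod_max a b c d \<le> U"
  shows "encl L (x * y) U"
  using prod_min_max[OF assms(1,2)] assms(3,4) by linarith

lemma sin_add_enclosure:
  assumes "encl s (sin q) s'" "encl c (cos q) c'" "encl u (sin r) u'" "encl v (cos r) v'"
    and "L \<le> prod_min s s' v v' + prod_min c c' u u'" "prod_max s s' v v' + prod_max c c' u u' \<le> U"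
  shows "encl L (sin (q + r)) U"
  unfolding sin_add using prod_min_max[OF assms(1,4)] prod_min_max[OF assms(2,3)] assms(5,6) by linarith

lemma cos_add_enclosure:
  assumes "encl s (sin q) s'" "encl c (cos q) c'" "encl u (sin r) u'" "encl v (cos r) v'"
    and "L \<le> prod_min c c' v v' - prod_max s s' u u'" "prod_max c c' v v' - prod_min s s' u u' \<le> U"
  shows "encl L (cos (q + r)) U"
  unfolding cos_add using prod_min_max[OF assms(2,4)] prod_min_max[OF assms(1,3)] assms(5,6) by linarith

lemma lsol_enclosure:
  assumes "encl s (sin q) s'" "encl c (cos q) c'" "encl a (sin_coord t) a'" "encl b (cos_coord t) b'"
    and "17 * L \<le> 25 + 25 * prod_min s s' a a' + 25 * prod_min c c' b b'"
    and "25 + 25 * prod_max s s' a a' + 25 * prod_max c c' b b' \<le> 17 * U"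
  shows "encl L (lsol q (q + t)) U"
  using lsol_coord[of q t] prod_min_max[OF assms(1,3)] prod_min_max[OF assms(2,4)] assms(5,6) by linarith

lemma slope_enclosure:
  assumes "encl s (sin q) s'" "encl c (cos q) c'" "encl k (kern t) k'" "encl a (sin_coord t) a'" "encl b (cos_coord t) b'"
    and "17 * L \<le> 25 * prod_min c c' a a' + 25 * prod_min c c' k k' - 25 * prod_max s s' b b'"
    and "25 * prod_max c c' a a' + 25 * prod_max c c' k k' - 25 * prod_min s s' b b' \<le> 17 * U"
  shows "encl L (slope q (q + t)) U"
  using slope_coord[of q t] prod_min_max[OF assms(2,4)] prod_min_max[OF assms(2,3)] prod_min_max[OF assms(1,5)]
    assms(6,7) by linarith

lemma delay_enclosure: "encl (235619449019/50000000000) delay (471238898039/100000000000)"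
  using pi_approx by (simp add: delay_def)

lemma exp_delay_enclosure: "encl (90350511/20000000) exp_delay (451752601/100000000)"
proof -
  \<comment> \<open>The exponent 8/25 * delay = 12 * pi / 25 is not rational; the exponential is
    enclosed at one rational number on each side of it.\<close>
  have a: "encl (90350511/20000000) (exp ((3769911/2500000) :: real)) (112938139/25000000)"
    by (rule exp_enclosure8[where l = "(12074317099/10000000000)" and u = "(120743171/100000000)"], rule exp_enclosure) (simp_all add: power_divide)
  have b: "encl (2258763/500000) (exp ((3015929/2000000) :: real)) (451752601/100000000)"
    by (rule exp_enclosure8[where l = "(12074317249/10000000000)" and u = "(48297269/40000000)"], rule exp_enclosure) (simp_all add: power_divide)
  have "exp (3769911/2500000) \<le> exp_delay" "exp_delay \<le> exp (3015929/2000000)"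
    using delay_enclosure by simp_all
  with a b show ?thesis by linarith
qed

text \<open>The suffix of \<open>point\<close> is a hundred times the argument modulo the delay; the suffix of
  \<open>start\<close> and \<open>slope_delay\<close> below is a hundred times the starting time.\<close>

lemma point_97:
  "encl (113281/500000) (kern (97/100)) (226563/1000000)"
  "encl (- (89303/100000)) (sin_coord (97/100)) (- (223257/250000))"
  "encl (- (82457/250000)) (cos_coord (97/100)) (- (164913/500000))"
  "encl (4618209/500000) (sin_coord (delay + (97/100))) (1154553/125000)"
  "encl (- (3287763/1000000)) (cos_coord (delay + (97/100))) (- (3287759/1000000))"
proof -
  have X: "encl (136397059/100000000) (exp (8/25 * (97/100) :: real)) (6819853/5000000)"
    by (rule exp_enclosure8[where l = "(10395625503/10000000000)" and u = "(324863297/312500000)"], rule exp_enclosure) (simp_all add: power_divide)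
  have s: "encl (82488571/100000000) (sin ((97/100) :: real)) (20622143/25000000)"
    by (rule sin_enclosure) (simp_all add: power_divide)
  have c: "encl (56529953/100000000) (cos ((97/100) :: real)) (28264977/50000000)"
    by (rule cos_enclosure) (simp_all add: power_divide)
  have r: "0 \<le> ((97/100) :: real)" "(97/100) \<le> delay" "- delay \<le> (97/100)" "(97/100) \<le> 2 * delay" "- delay \<le> delay + (97/100)" "delay + (97/100) \<le> 2 * delay"
    using delay_enclosure by linarith+
  show K1: "encl (113281/500000) (kern (97/100)) (226563/1000000)"
    using kern_phase1[OF r(1,2)] X by linarith
  show A1: "encl (- (89303/100000)) (sin_coord (97/100)) (- (223257/250000))"
    using coord_phase1(1)[OF r(1,2)] K1 s c by linarith
  show B1: "encl (- (82457/250000)) (cos_coord (97/100)) (- (164913/500000))"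
    using coord_phase1(2)[OF r(1,2)] K1 s c by linarith
  have XE: "encl (308088599/50000000) (exp_delay * exp (8/25 * (97/100) :: real)) (616177267/100000000)"
    by (rule mult_enclosure[OF exp_delay_enclosure X]) (simp_all add: prod_simps)
  have K2: "encl (- (382971/40000)) (kern (delay + (97/100))) (- (9574273/1000000))"
    using kern_phase2[OF r(1,2)] X XE by linarith
  show A2: "encl (4618209/500000) (sin_coord (delay + (97/100))) (1154553/125000)"
    using sin_coord_step[OF r(3,4)] A1 B1 K2 s c by linarith
  show B2: "encl (- (3287763/1000000)) (cos_coord (delay + (97/100))) (- (3287759/1000000))"
    using cos_coord_step[OF r(3,4)] A1 B1 K2 s c by linarith
qed

lemma point_102:
  "encl (- (9738943/1000000)) (kern (delay + (51/50))) (- (9738941/1000000))"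
  "encl (9401229/1000000) (sin_coord (delay + (51/50))) (9401233/1000000)"
  "encl (- (660931/200000)) (cos_coord (delay + (51/50))) (- (826163/250000))"
proof -
  have X: "encl (34649241/25000000) (exp (8/25 * (51/50) :: real)) (27719393/20000000)"
    by (rule exp_enclosure8[where l = "(10416437559/10000000000)" and u = "(260410939/250000000)"], rule exp_enclosure) (simp_all add: power_divide)
  have s: "encl (42605401/50000000) (sin ((51/50) :: real)) (85210803/100000000)"
    by (rule sin_enclosure) (simp_all add: power_divide)
  have c: "encl (10467319/20000000) (cos ((51/50) :: real)) (13084149/25000000)"
    by (rule cos_enclosure) (simp_all add: power_divide)
  have r: "0 \<le> ((51/50) :: real)" "(51/50) \<le> delay" "- delay \<le> (51/50)" "(51/50) \<le> 2 * delay" "- delay \<le> delay + (51/50)" "delay + (51/50) \<le> 2 * delay"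
    using delay_enclosure by linarith+
  have K1: "encl (89907/500000) (kern (51/50)) (35963/200000)"
    using kern_phase1[OF r(1,2)] X by linarith
  have A1: "encl (- (437847/500000)) (sin_coord (51/50)) (- (218923/250000))"
    using coord_phase1(1)[OF r(1,2)] K1 s c by linarith
  have B1: "encl (- (36389/100000)) (cos_coord (51/50)) (- (363889/1000000))"
    using coord_phase1(2)[OF r(1,2)] K1 s c by linarith
  have XE: "encl (313057663/50000000) (exp_delay * exp (8/25 * (51/50) :: real)) (125223079/20000000)"
    by (rule mult_enclosure[OF exp_delay_enclosure X]) (simp_all add: prod_simps)
  show K2: "encl (- (9738943/1000000)) (kern (delay + (51/50))) (- (9738941/1000000))"
    using kern_phase2[OF r(1,2)] X XE by linarith
  show A2: "encl (9401229/1000000) (sin_coord (delay + (51/50))) (9401233/1000000)"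
    using sin_coord_step[OF r(3,4)] A1 B1 K2 s c by linarith
  show B2: "encl (- (660931/200000)) (cos_coord (delay + (51/50))) (- (826163/250000))"
    using cos_coord_step[OF r(3,4)] A1 B1 K2 s c by linarith
qed

lemma point_150:
  "encl (- (11328781/1000000)) (kern (delay + (3/2))) (- (5664389/500000))"
  "encl (551283/50000) (sin_coord (delay + (3/2))) (2205133/200000)"
  "encl (- (86527/25000)) (cos_coord (delay + (3/2))) (- (865269/250000))"
  "encl (- (6485969/500000)) (kern (2 * delay + (3/2))) (- (6485961/500000))"
  "encl (623859/125000) (cos_coord (2 * delay + (3/2))) (1247721/250000)"
proof -
  have X: "encl (2020093/1250000) (exp (8/25 * (3/2) :: real)) (161607441/100000000)"
    by (rule exp_enclosure8[where l = "(2123673093/2000000000)" and u = "(5309182733/5000000000)"], rule exp_enclosure) (simp_all add: power_divide)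
  have s: "encl (49874749/50000000) (sin ((3/2) :: real)) (99749499/100000000)"
    by (rule sin_enclosure) (simp_all add: power_divide)
  have c: "encl (176843/2500000) (cos ((3/2) :: real)) (7073721/100000000)"
    by (rule cos_enclosure) (simp_all add: power_divide)
  have r: "0 \<le> ((3/2) :: real)" "(3/2) \<le> delay" "- delay \<le> (3/2)" "(3/2) \<le> 2 * delay" "- delay \<le> delay + (3/2)" "delay + (3/2) \<le> 2 * delay"
    using delay_enclosure by linarith+
  have K1: "encl (- (309159/1000000)) (kern (3/2)) (- (154579/500000))"
    using kern_phase1[OF r(1,2)] X by linarith
  have A1: "encl (- (152791/250000)) (sin_coord (3/2)) (- (305581/500000))"
    using coord_phase1(1)[OF r(1,2)] K1 s c by linarith
  have B1: "encl (- (756327/1000000)) (cos_coord (3/2)) (- (378163/500000))"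
    using coord_phase1(2)[OF r(1,2)] K1 s c by linarith
  have XE: "encl (730065739/100000000) (exp_delay * exp (8/25 * (3/2) :: real)) (730065819/100000000)"
    by (rule mult_enclosure[OF exp_delay_enclosure X]) (simp_all add: prod_simps)
  show K2: "encl (- (11328781/1000000)) (kern (delay + (3/2))) (- (5664389/500000))"
    using kern_phase2[OF r(1,2)] X XE by linarith
  show A2: "encl (551283/50000) (sin_coord (delay + (3/2))) (2205133/200000)"
    using sin_coord_step[OF r(3,4)] A1 B1 K2 s c by linarith
  show B2: "encl (- (86527/25000)) (cos_coord (delay + (3/2))) (- (865269/250000))"
    using cos_coord_step[OF r(3,4)] A1 B1 K2 s c by linarith
  have D: "encl (19486297/100000000) (delay - exp_delay) (194863431/1000000000)"
    using delay_enclosure exp_delay_enclosure by linarith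
  have W: "encl (71131389/50000000) ((delay - exp_delay) * (exp_delay * exp (8/25 * (3/2) :: real))) (142263131/100000000)"
    by (rule mult_enclosure[OF D XE]) (simp_all add: prod_simps)
  show K3: "encl (- (6485969/500000)) (kern (2 * delay + (3/2))) (- (6485961/500000))"
    using kern_phase3[OF r(1)] X XE W by linarith
  have e: "delay + (delay + (3/2)) = 2 * delay + (3/2)" "sin (delay + (3/2)) = - cos (3/2)" "cos (delay + (3/2)) = sin (3/2)"
    by (simp_all add: sin_add_delay cos_add_delay)
  have A3: "encl (149667/8000) (sin_coord (2 * delay + (3/2))) (4677099/250000)"
    using sin_coord_step[OF r(5,6), unfolded e] A2 B2 K3 s c by linarith
  show B3: "encl (623859/125000) (cos_coord (2 * delay + (3/2))) (1247721/250000)"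
    using cos_coord_step[OF r(5,6), unfolded e] A2 B2 K3 s c by linarith
qed

lemma point_300:
  "encl (101679/62500) (sin_coord 3) (813451/500000)"
  "encl (- (1096899/500000)) (cos_coord 3) (- (87749/40000))"
  "encl (4098229/250000) (sin_coord (delay + 3)) (1639307/100000)"
  "encl (- (440369/125000)) (cos_coord (delay + 3)) (- (3522859/1000000))"
proof -
  have X: "encl (261169647/100000000) (exp (8/25 * 3 :: real)) (16323103/6250000)"
    by (rule exp_enclosure8[where l = "(2254993703/2000000000)" and u = "(2818742129/2500000000)"], rule exp_enclosure) (simp_all add: power_divide)
  have s: "encl (2822393/20000000) (sin (3 :: real)) (14114161/100000000)"
    by (rule sin_enclosure) (simp_all add: power_divide)
  have c: "encl (- (1979989/2000000)) (cos (3 :: real)) (- (24747119/25000000))"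
    by (rule cos_enclosure) (simp_all add: power_divide)
  have r: "0 \<le> (3 :: real)" "3 \<le> delay" "- delay \<le> 3" "3 \<le> 2 * delay" "- delay \<le> delay + 3" "delay + 3 \<le> 2 * delay"
    using delay_enclosure by linarith+
  have K1: "encl (- (303107/125000)) (kern 3) (- (1212427/500000))"
    using kern_phase1[OF r(1,2)] X by linarith
  show A1: "encl (101679/62500) (sin_coord 3) (813451/500000)"
    using coord_phase1(1)[OF r(1,2)] K1 s c by linarith
  show B1: "encl (- (1096899/500000)) (cos_coord 3) (- (87749/40000))"
    using coord_phase1(2)[OF r(1,2)] K1 s c by linarith
  have XE: "encl (1179840553/100000000) (exp_delay * exp (8/25 * 3 :: real)) (589920339/50000000)"
    by (rule mult_enclosure[OF exp_delay_enclosure X]) (simp_all add: prod_simps)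
  have K2: "encl (- (7999861/500000)) (kern (delay + 3)) (- (7999859/500000))"
    using kern_phase2[OF r(1,2)] X XE by linarith
  show A2: "encl (4098229/250000) (sin_coord (delay + 3)) (1639307/100000)"
    using sin_coord_step[OF r(3,4)] A1 B1 K2 s c by linarith
  show B2: "encl (- (440369/125000)) (cos_coord (delay + 3)) (- (3522859/1000000))"
    using cos_coord_step[OF r(3,4)] A1 B1 K2 s c by linarith
qed

lemma point_324:
  "encl (2175337/1000000) (sin_coord (81/25)) (435089/200000)"
  "encl (- (2372837/1000000)) (cos_coord (81/25)) (- (2372623/1000000))"
  "encl (17224973/1000000) (sin_coord (delay + (81/25))) (2153177/125000)"
  "encl (- (425449/125000)) (cos_coord (delay + (81/25))) (- (3403323/1000000))"
proof -
  have X: "encl (141008899/50000000) (exp (8/25 * (81/25) :: real)) (1410089/500000)"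
    by (rule exp_enclosure8[where l = "(1138372943/1000000000)" and u = "(11383729431/10000000000)"], rule exp_enclosure) (simp_all add: power_divide)
  have s: "encl (- (982499/10000000)) (sin ((81/25) :: real)) (- (2454507/25000000))"
    by (rule sin_enclosure) (simp_all add: power_divide)
  have c: "encl (- (12439609/12500000)) (cos ((81/25) :: real)) (- (49742321/50000000))"
    by (rule cos_enclosure) (simp_all add: power_divide)
  have r: "0 \<le> ((81/25) :: real)" "(81/25) \<le> delay" "- delay \<le> (81/25)" "(81/25) \<le> 2 * delay" "- delay \<le> delay + (81/25)" "delay + (81/25) \<le> 2 * delay"
    using delay_enclosure by linarith+
  have K1: "encl (- (2867879/1000000)) (kern (81/25)) (- (1433939/500000))"
    using kern_phase1[OF r(1,2)] X by linarith
  show A1: "encl (2175337/1000000) (sin_coord (81/25)) (435089/200000)"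
    using coord_phase1(1)[OF r(1,2)] K1 s c by linarith
  show B1: "encl (- (2372837/1000000)) (cos_coord (81/25)) (- (2372623/1000000))"
    using coord_phase1(2)[OF r(1,2)] K1 s c by linarith
  have XE: "encl (79626413/6250000) (exp_delay * exp (8/25 * (81/25) :: real)) (1274022747/100000000)"
    by (rule mult_enclosure[OF exp_delay_enclosure X]) (simp_all add: prod_simps)
  have K2: "encl (- (8309089/500000)) (kern (delay + (81/25))) (- (8309087/500000))"
    using kern_phase2[OF r(1,2)] X XE by linarith
  show A2: "encl (17224973/1000000) (sin_coord (delay + (81/25))) (2153177/125000)"
    using sin_coord_step[OF r(3,4)] A1 B1 K2 s c by linarith
  show B2: "encl (- (425449/125000)) (cos_coord (delay + (81/25))) (- (3403323/1000000))"
    using cos_coord_step[OF r(3,4)] A1 B1 K2 s c by linarith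
qed

lemma point_319:
  "encl (- (693189/250000)) (kern (319/100)) (- (554551/200000))"
  "encl (2057579/1000000) (sin_coord (319/100)) (1028833/500000)"
  "encl (- (584411/250000)) (cos_coord (319/100)) (- (36523/15625))"
proof -
  have X: "encl (13877071/5000000) (exp (8/25 * (319/100) :: real)) (277541421/100000000)"
    by (rule exp_enclosure8[where l = "(2840246181/2500000000)" and u = "(454439389/400000000)"], rule exp_enclosure) (simp_all add: power_divide)
  have s: "encl (- (967789/20000000)) (sin ((319/100) :: real)) (- (4833431/100000000))"
    by (rule sin_enclosure) (simp_all add: power_divide)
  have c: "encl (- (780339/781250)) (cos ((319/100) :: real)) (- (99857467/100000000))"
    by (rule cos_enclosure) (simp_all add: power_divide)
  have r: "0 \<le> ((319/100) :: real)" "(319/100) \<le> delay" "- delay \<le> (319/100)" "(319/100) \<le> 2 * delay" "- delay \<le> delay + (319/100)" "delay + (319/100) \<le> 2 * delay"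
    using delay_enclosure by linarith+
  show K1: "encl (- (693189/250000)) (kern (319/100)) (- (554551/200000))"
    using kern_phase1[OF r(1,2)] X by linarith
  show A1: "encl (2057579/1000000) (sin_coord (319/100)) (1028833/500000)"
    using coord_phase1(1)[OF r(1,2)] K1 s c by linarith
  show B1: "encl (- (584411/250000)) (cos_coord (319/100)) (- (36523/15625))"
    using coord_phase1(2)[OF r(1,2)] K1 s c by linarith
qed

lemma point_248:
  "encl (- (2960399/1000000)) (kern (2 * delay + (62/25))) (- (2960373/1000000))"
proof -
  have X: "encl (110567147/50000000) (exp (8/25 * (62/25) :: real)) (27641787/12500000)"
    by (rule exp_enclosure8[where l = "(11042871349/10000000000)" and u = "(220857427/200000000)"], rule exp_enclosure) (simp_all add: power_divide)
  have r: "0 \<le> ((62/25) :: real)" "(62/25) \<le> delay" "- delay \<le> (62/25)" "(62/25) \<le> 2 * delay" "- delay \<le> delay + (62/25)" "delay + (62/25) \<le> 2 * delay"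
    using delay_enclosure by linarith+
  have XE: "encl (998979823/100000000) (exp_delay * exp (8/25 * (62/25) :: real)) (499489967/50000000)"
    by (rule mult_enclosure[OF exp_delay_enclosure X]) (simp_all add: prod_simps)
  have D: "encl (19486297/100000000) (delay - exp_delay) (194863431/1000000000)"
    using delay_enclosure exp_delay_enclosure by linarith
  have W: "encl (7786567/4000000) ((delay - exp_delay) * (exp_delay * exp (8/25 * (62/25) :: real))) (97332329/50000000)"
    by (rule mult_enclosure[OF D XE]) (simp_all add: prod_simps)
  show K3: "encl (- (2960399/1000000)) (kern (2 * delay + (62/25))) (- (2960373/1000000))"
    using kern_phase3[OF r(1)] X XE W by linarith
qed

section \<open>Enclosures at the reference starting times\<close>

lemma gain_zero_enclosure: "12 \<le> gain 0 (2 * delay + (3/2))"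
proof -
  have e: "2 * delay + (3/2) - delay = delay + (3/2)" by simp
  show ?thesis
    unfolding gain_def e using lsol_coord[of 0 "2 * delay + (3/2)"] lsol_coord[of 0 "delay + (3/2)"] point_150 by simp
qed

lemma kern_diff_enclosure: "0 \<le> kern (delay + (3/2)) - kern (2 * delay + (3/2))" "kern (delay + (3/2)) - kern (2 * delay + (3/2)) \<le> 2"
  using point_150 by linarith+

lemma slope_zero_neg: "slope 0 (delay + (3/2)) < 0"
  using slope_coord[of 0 "delay + (3/2)"] point_150 by simp

lemma kern_neg_point: "kern (2 * delay + (62/25)) < 0"
  using point_248 by linarith

text \<open>The offsets make the absolute times agree for the two reference starts: 12/100 + 97/100
  and 7/100 + 102/100 are both 109/100, and 12/100 + 319/100 and 7/100 + 324/100 are both 331/100.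
  The last inequality shows that the hit of the start 3/25 comes before offset
  \<open>delay + 3\<close>.\<close>

lemma start_012:
  shows "slope (3/25) ((3/25) + (97/100)) < - sin (109/100)" "lsol (3/25) ((3/25) + (delay + (97/100))) < lsol (3/25) ((3/25) + (319/100))"
    "slope (3/25) ((3/25) + (319/100)) < 0" "0 < gain (3/25) ((3/25) + (delay + 3))"
proof -
  have sq: "encl (598561/5000000) (sin ((3/25) :: real)) (11971221/100000000)"
    by (rule sin_enclosure) (simp_all add: power_divide)
  have cq: "encl (99280863/100000000) (cos ((3/25) :: real)) (3102527/3125000)"
    by (rule cos_enclosure) (simp_all add: power_divide)
  have k: "encl (- (914987/1000000)) (slope (3/25) ((3/25) + (97/100))) (- (457491/500000))"
    by (rule slope_enclosure[OF sq cq point_97(1) point_97(2) point_97(3)]) (simp_all add: prod_simps)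
  have s: "encl (88662691/100000000) (sin ((109/100) :: real)) (22165673/25000000)"
    by (rule sin_enclosure) (simp_all add: power_divide)
  show "slope (3/25) ((3/25) + (97/100)) < - sin (109/100)" using k s by linarith
  have xb: "encl (- (1703541/1000000)) (lsol (3/25) ((3/25) + (delay + (97/100)))) (- (1703533/1000000))"
    by (rule lsol_enclosure[OF sq cq point_97(4) point_97(5)]) (simp_all add: prod_simps)
  have xz: "encl (- (1580171/1000000)) (lsol (3/25) ((3/25) + (319/100))) (- (1579903/1000000))"
    by (rule lsol_enclosure[OF sq cq point_319(2) point_319(3)]) (simp_all add: prod_simps)
  show "lsol (3/25) ((3/25) + (delay + (97/100))) < lsol (3/25) ((3/25) + (319/100))" using xb xz by linarith
  have yz: "encl (- (316331/500000)) (slope (3/25) ((3/25) + (319/100))) (- (316251/500000))"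
    by (rule slope_enclosure[OF sq cq point_319(1) point_319(2) point_319(3)]) (simp_all add: prod_simps)
  show "slope (3/25) ((3/25) + (319/100)) < 0" using yz by linarith
  have g: "encl (- (787037/1000000)) (lsol (3/25) ((3/25) + (delay + 3))) (- (786873/1000000))"
    by (rule lsol_enclosure[OF sq cq point_300(3) point_300(4)]) (simp_all add: prod_simps)
  have h: "encl (- (72299/50000)) (lsol (3/25) ((3/25) + 3)) (- (722933/500000))"
    by (rule lsol_enclosure[OF sq cq point_300(1) point_300(2)]) (simp_all add: prod_simps)
  have "(3/25) + (delay + 3) - delay = (3/25) + (3::real)" by simp
  then show "0 < gain (3/25) ((3/25) + (delay + 3))" unfolding gain_def using g h by simp
qed

lemma start_007:
  shows "slope (7/100) ((7/100) + (delay + (51/50))) < 0" "0 < gain (7/100) ((7/100) + (delay + (81/25)))"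
proof -
  have sq: "encl (1748571/25000000) (sin ((7/100) :: real)) (1398857/20000000)"
    by (rule sin_enclosure) (simp_all add: power_divide)
  have cq: "encl (997551/1000000) (cos ((7/100) :: real)) (99755101/100000000)"
    by (rule cos_enclosure) (simp_all add: power_divide)
  have k: "encl (- (38879/250000)) (slope (7/100) ((7/100) + (delay + (51/50)))) (- (31101/200000))"
    by (rule slope_enclosure[OF sq cq point_102(1) point_102(2) point_102(3)]) (simp_all add: prod_simps)
  show "slope (7/100) ((7/100) + (delay + (51/50))) < 0" using k by linarith
  have g: "encl (- (875363/500000)) (lsol (7/100) ((7/100) + (delay + (81/25)))) (- (437571/250000))"
    by (rule lsol_enclosure[OF sq cq point_324(3) point_324(4)]) (simp_all add: prod_simps)
  have h: "encl (- (223323/125000)) (lsol (7/100) ((7/100) + (81/25))) (- (893129/500000))"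
    by (rule lsol_enclosure[OF sq cq point_324(1) point_324(2)]) (simp_all add: prod_simps)
  have "(7/100) + (delay + (81/25)) - delay = (7/100) + (81/25)" by simp
  then show "0 < gain (7/100) ((7/100) + (delay + (81/25)))" unfolding gain_def using g h by simp
qed

lemma slope_delay_012: "126/1000 < slope (3/25) delay"
proof -
  have sq: "encl (598561/5000000) (sin ((3/25) :: real)) (11971221/100000000)"
    by (rule sin_enclosure) (simp_all add: power_divide)
  have cq: "encl (99280863/100000000) (cos ((3/25) :: real)) (3102527/3125000)"
    by (rule cos_enclosure) (simp_all add: power_divide)
  have X: "encl (96232793/100000000) (exp ((- (8/25) * (3/25)) :: real)) (48116397/50000000)"
    by (rule exp_enclosure) (simp_all add: power_divide)
  have e: "exp (8/25 * (delay - (3/25))) = exp_delay * exp (- (8/25) * (3/25))"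
    by (simp flip: exp_add)
  have XE: "encl (434734101/100000000) (exp_delay * exp (- (8/25) * (3/25) :: real)) (8694683/2000000)"
    by (rule mult_enclosure[OF exp_delay_enclosure X]) (simp_all add: prod_simps)
  have r: "0 \<le> delay - (3/25)" "delay - (3/25) \<le> delay" using delay_enclosure by linarith+
  have K: "encl (- (6113101/1000000)) (kern (delay - (3/25))) (- (6113099/1000000))"
    using kern_phase1[OF r] XE unfolding e by linarith
  have tr: "sin (delay - (3/25)) = - cos (3/25)" "cos (delay - (3/25)) = - sin (3/25)"
    using sin_add_delay[of "- (3/25)"] cos_add_delay[of "- (3/25)"] by simp_all
  have A: "encl (2921879/500000) (sin_coord (delay - (3/25))) (5843761/1000000)"
    using coord_phase1(1)[OF r] K sq cq unfolding tr by linarith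
  have B: "encl (- (184463/62500)) (cos_coord (delay - (3/25))) (- (2951407/1000000))"
    using coord_phase1(2)[OF r] K sq cq unfolding tr by linarith
  have "encl (126343/1000000) (slope (3/25) ((3/25) + (delay - (3/25)))) (126351/1000000)"
    by (rule slope_enclosure[OF sq cq K A B]) (simp_all add: prod_simps)
  then show ?thesis by simp
qed

lemma slope_delay_007: "slope (7/100) delay < 0"
proof -
  have sq: "encl (1748571/25000000) (sin ((7/100) :: real)) (1398857/20000000)"
    by (rule sin_enclosure) (simp_all add: power_divide)
  have cq: "encl (997551/1000000) (cos ((7/100) :: real)) (99755101/100000000)"
    by (rule cos_enclosure) (simp_all add: power_divide)
  have X: "encl (97784901/100000000) (exp ((- (8/25) * (7/100)) :: real)) (48892451/50000000)"
    by (rule exp_enclosure) (simp_all add: power_divide)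
  have e: "exp (8/25 * (delay - (7/100))) = exp_delay * exp (- (8/25) * (7/100))"
    by (simp flip: exp_add)
  have XE: "encl (110436447/25000000) (exp_delay * exp (- (8/25) * (7/100) :: real)) (441745839/100000000)"
    by (rule mult_enclosure[OF exp_delay_enclosure X]) (simp_all add: prod_simps)
  have r: "0 \<le> delay - (7/100)" "delay - (7/100) \<le> delay" using delay_enclosure by linarith+
  have K: "encl (- (62621/10000)) (kern (delay - (7/100))) (- (6262097/1000000))"
    using kern_phase1[OF r] XE unfolding e by linarith
  have tr: "sin (delay - (7/100)) = - cos (7/100)" "cos (delay - (7/100)) = - sin (7/100)"
    using sin_add_delay[of "- (7/100)"] cos_add_delay[of "- (7/100)"] by simp_all
  have A: "encl (1198333/200000) (sin_coord (delay - (7/100))) (5991669/1000000)"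
    using coord_phase1(1)[OF r] K sq cq unfolding tr by linarith
  have B: "encl (- (592979/200000)) (cos_coord (delay - (7/100))) (- (1482447/500000))"
    using coord_phase1(2)[OF r] K sq cq unfolding tr by linarith
  have "encl (- (18353/200000)) (slope (7/100) ((7/100) + (delay - (7/100)))) (- (91753/1000000))"
    by (rule slope_enclosure[OF sq cq K A B]) (simp_all add: prod_simps)
  then show ?thesis by simp
qed

text \<open>The time \<open>delay + pi\<close> is \<open>5 * pi / 2\<close>, where
  \<open>bump\<close> has its second crest and \<open>ftilde\<close> vanishes. A negative solution
  lies below the nullcline there, which puts \<open>level\<close> above the crest.
  \<open>lsol_half_neg\<close> plays the same part for the first crest, at
  \<open>pi/2\<close>.\<close>

lemma lsol_zero_neg: "lsol 0 (delay + pi) < 0"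
proof -
  have a: "encl (10931/4000) (exp ((15707963/15625000) :: real)) (68319/25000)"
    by (rule exp_enclosure8[where l = "(5669503889/5000000000)" and u = "(11339007779/10000000000)"], rule exp_enclosure) (simp_all add: power_divide)
  have b: "encl (10931/4000) (exp ((31415927/31250000) :: real)) (68319/25000)"
    by (rule exp_enclosure8[where l = "(11339007823/10000000000)" and u = "(708687989/625000000)"], rule exp_enclosure) (simp_all add: power_divide)
  have p: "encl (15707963/5000000) pi (31415927/10000000)" using pi_approx by simp
  then have "exp (15707963/15625000) \<le> exp (8/25 * pi)" "exp (8/25 * pi) \<le> exp (31415927/31250000)" by simp_all
  with a b have X: "encl (10931/4000) (exp (8/25 * pi)) (68319/25000)" by linarith
  have PX: "encl (858518717/100000000) (pi * exp (8/25 * pi)) (858521887/100000000)"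
    by (rule mult_enclosure[OF p X]) (simp_all add: prod_simps)
  have XE: "encl (617263397/50000000) (exp_delay * exp (8/25 * pi)) (617265719/50000000)"
    by (rule mult_enclosure[OF exp_delay_enclosure X]) (simp_all add: prod_simps)
  have r: "0 \<le> pi" "pi \<le> delay" "- delay \<le> pi" "pi \<le> 2 * delay" using delay_enclosure p by linarith+
  have K1: "encl (- (67053/25000)) (kern pi) (- (268209/100000))" using kern_phase1[OF r(1,2)] X by linarith
  have A1: "encl (194529/100000) (sin_coord pi) (48633/25000)" using coord_phase1(1)[OF r(1,2)] K1 unfolding sin_pi cos_pi by linarith
  have B1: "encl (- (230251/100000)) (cos_coord pi) (- (230249/100000))" using coord_phase1(2)[OF r(1,2)] K1 unfolding sin_pi cos_pi by linarith
  have K2: "encl (- (409297/25000)) (kern (delay + pi)) (- (409291/25000))" using kern_phase2[OF r(1,2)] X PX XE by linarith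
  have B2: "encl (- (172937/50000)) (cos_coord (delay + pi)) (- (345863/100000))" using cos_coord_step[OF r(3,4)] A1 B1 K2 unfolding sin_pi cos_pi by linarith
  show ?thesis using lsol_coord[of 0 "delay + pi"] B2 by simp
qed

lemma lsol_half_neg: "lsol (- (1/2)) (pi/2) < 0"
proof -
  have a: "encl (193993/100000) (exp ((20707963/31250000) :: real)) (96997/50000)"
    by (rule exp_enclosure8[where l = "(271589781/250000000)" and u = "(10863591241/10000000000)"], rule exp_enclosure) (simp_all add: power_divide)
  have b: "encl (193993/100000) (exp ((5176991/7812500) :: real)) (96997/50000)"
    by (rule exp_enclosure8[where l = "(2715897821/2500000000)" and u = "(2172718257/2000000000)"], rule exp_enclosure) (simp_all add: power_divide)
  have s: "encl (47942553/100000000) (sin ((1/2) :: real)) (23971277/50000000)"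
    by (rule sin_enclosure) (simp_all add: power_divide)
  have c: "encl (5484891/6250000) (cos ((1/2) :: real)) (87758257/100000000)"
    by (rule cos_enclosure) (simp_all add: power_divide)
  have p: "encl (20707963/10000000) ((pi/2 + 1/2)) (5176991/2500000)" using pi_approx by simp
  then have "exp (20707963/31250000) \<le> exp (8/25 * (pi/2 + 1/2))" "exp (8/25 * (pi/2 + 1/2)) \<le> exp (5176991/7812500)" by simp_all
  with a b have X: "encl (193993/100000) (exp (8/25 * (pi/2 + 1/2))) (96997/50000)" by linarith
  have tr: "sin (pi/2 + 1/2) = cos (1/2)" "cos (pi/2 + 1/2) = - sin (1/2)" by (simp_all add: sin_add cos_add)
  have r: "0 \<le> (pi/2 + 1/2)" "(pi/2 + 1/2) \<le> delay" using delay_enclosure p by linarith+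
  have K: "encl (- (49869/50000)) (kern (pi/2 + 1/2)) (- (19947/20000))" using kern_phase1[OF r] X by linarith
  have A: "encl (- (2153/100000)) (sin_coord (pi/2 + 1/2)) (- (2149/100000))" using coord_phase1(1)[OF r] K s c unfolding tr by linarith
  have B: "encl (- (65957/50000)) (cos_coord (pi/2 + 1/2)) (- (16489/12500))" using coord_phase1(2)[OF r] K s c unfolding tr by linarith
  have u: "encl (- (258051/25000000)) (sin (1/2) * sin_coord (pi/2 + 1/2)) (- (206057/20000000))"
    by (rule mult_enclosure[OF s A]) (simp_all add: prod_simps)
  have v: "encl (- (28941357/25000000)) (cos (1/2) * cos_coord (pi/2 + 1/2)) (- (11576367/10000000))"
    by (rule mult_enclosure[OF c B]) (simp_all add: prod_simps)
  have "17 * lsol (- (1/2)) (pi/2) = 25 - 25 * (sin (1/2) * sin_coord (pi/2 + 1/2)) + 25 * (cos (1/2) * cos_coord (pi/2 + 1/2))"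
    using lsol_coord[of "- (1/2)" "(pi/2 + 1/2)"] by simp
  then show ?thesis using u v by linarith
qed

subsection \<open>Signs of the fundamental solution\<close>

text \<open>Minus the derivative of \<open>kern\<close>. On each delay interval it is an exponential
  times a polynomial, which makes its sign accessible.\<close>

definition deficit :: "real \<Rightarrow> real" where
  "deficit s = kern (s - delay) - 8/25 * kern s"

lemma deficit_phase1: "0 \<le> s \<Longrightarrow> s \<le> delay \<Longrightarrow> deficit s = 17/25 * exp (8/25 * s)"
proof -
  assume s: "0 \<le> s" "s \<le> delay"
  then have "kern (s - delay) = 1" by (simp add: kern_nonpos)
  then show ?thesis using kern_phase1[OF s] unfolding deficit_def by linarith
qed

lemma deficit_phase2:
  assumes "0 \<le> r" "r \<le> delay"
  shows "deficit (delay + r) = 17/25 * exp (8/25 * r) * (exp_delay - r)"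
  using assms by (simp add: deficit_def kern_phase1 kern_phase2 field_simps)

lemma deficit_phase3:
  assumes "0 \<le> r" "r \<le> delay"
  shows "deficit (2 * delay + r) = 17/25 * exp (8/25 * r) * (exp_delay * exp_delay - (delay + r) * exp_delay + r * r / 2)"
proof -
  have e: "2 * delay + r - delay = delay + r" by simp
  show ?thesis
    unfolding deficit_def e kern_phase2[OF assms] kern_phase3[OF assms(1)] by (simp add: field_simps)
qed

text \<open>On the second delay interval the polynomial factor is \<open>exp_delay - r\<close>, and
  \<open>exp_delay\<close> is a little smaller than \<open>delay\<close>. So \<open>kern\<close>
  stops falling inside that interval, at \<open>delay + exp_delay\<close>.\<close>

lemma deficit_pos:
  assumes "0 < s" "s < delay + exp_delay"
  shows "0 < deficit s"
proof (cases "s \<le> delay")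
  case False
  then have "deficit s = 17/25 * exp (8/25 * (s - delay)) * (exp_delay - (s - delay))"
    using deficit_phase2[of "s - delay"] assms delay_enclosure exp_delay_enclosure by simp
  moreover have "0 < 17/25 * exp (8/25 * (s - delay)) * (exp_delay - (s - delay))"
    using assms by (intro mult_pos_pos) auto
  ultimately show ?thesis by linarith
qed (use assms in \<open>simp add: deficit_phase1\<close>)

lemma deficit_neg:
  assumes "delay + exp_delay < s" "s \<le> 4 * pi"
  shows "deficit s < 0"
proof (cases "s \<le> 2 * delay")
  case True
  have "deficit s = 17/25 * exp (8/25 * (s - delay)) * (exp_delay - (s - delay))"
    using deficit_phase2[of "s - delay"] True assms exp_delay_enclosure by simp
  moreover have "17/25 * exp (8/25 * (s - delay)) * (exp_delay - (s - delay)) < 0"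
    using assms by (intro mult_pos_neg) auto
  ultimately show ?thesis by linarith
next
  case False
  define r where "r = s - 2 * delay"
  have r: "0 \<le> r" "r \<le> 32/10"
    using False assms pi_approx by (simp_all add: r_def delay_def)
  \<comment> \<open>The quadratic factor is split into a term that is nonpositive for r up to
    \<open>2 * exp_delay\<close> and a constant that is negative because
    \<open>exp_delay < delay\<close>.\<close>
  have "r * (r / 2 - exp_delay) \<le> 0"
    using r exp_delay_enclosure by (intro mult_nonneg_nonpos) auto
  moreover have "(exp_delay - delay) * exp_delay < 0"
    using exp_delay_enclosure delay_enclosure by (intro mult_neg_pos) auto
  moreover have "exp_delay * exp_delay - (delay + r) * exp_delay + r * r / 2
      = r * (r / 2 - exp_delay) + (exp_delay - delay) * exp_delay"
    by (simp add: field_simps)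
  ultimately have "exp_delay * exp_delay - (delay + r) * exp_delay + r * r / 2 < 0"
    by linarith
  then have "17/25 * exp (8/25 * r) * (exp_delay * exp_delay - (delay + r) * exp_delay + r * r / 2) < 0"
    by (intro mult_pos_neg) auto
  moreover have "2 * delay + r = s" "r \<le> delay" using r delay_enclosure by (simp_all add: r_def)
  ultimately show ?thesis using deficit_phase3[of r] r by simp
qed

lemma four_pi_less: "4 * pi < 3 * delay"
  using pi_gt_zero by (simp add: delay_def)

lemma DERIV_kern': "0 < s \<Longrightarrow> s \<le> 3 * delay \<Longrightarrow> (kern has_real_derivative - deficit s) (at s)"
  using DERIV_kern[of s] by (simp add: deficit_def)

lemma kern_strict_antimono:
  assumes "0 \<le> s" "s < s'" "s' \<le> delay + exp_delay"
  shows "kern s' < kern s"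
proof -
  have "- kern s < - kern s'"
    using assms(2)
  proof (rule strict_mono_of_deriv)
    fix x assume x: "s < x" "x < s'"
    then have "x \<le> 3 * delay" "0 < deficit x"
      using assms delay_enclosure exp_delay_enclosure by (linarith, intro deficit_pos) auto
    then show "\<exists>D. ((\<lambda>x. - kern x) has_real_derivative D) (at x) \<and> 0 < D"
      using DERIV_minus[OF DERIV_kern'[of x]] x assms by (intro exI[of _ "deficit x"]) auto
  qed (intro continuous_intros)
  then show ?thesis by simp
qed

lemma kern_strict_mono:
  assumes "delay + exp_delay \<le> s" "s < s'" "s' \<le> 4 * pi"
  shows "kern s < kern s'"
  using assms(2)
proof (rule strict_mono_of_deriv)
  fix x assume x: "s < x" "x < s'"
  then have "x \<le> 3 * delay" "deficit x < 0" "0 < x"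
    using assms four_pi_less delay_enclosure exp_delay_enclosure by (linarith, intro deficit_neg, auto)
  then show "\<exists>D. (kern has_real_derivative D) (at x) \<and> 0 < D"
    using DERIV_kern'[of x] by (intro exI[of _ "- deficit x"]) auto
qed (intro continuous_intros)

lemma kern_antimono:
  assumes "s \<le> s'" "s' \<le> delay + exp_delay"
  shows "kern s' \<le> kern s"
proof -
  consider "s' \<le> 0" | "s \<le> 0" "0 < s'" | "0 \<le> s" "s < s'" | "s = s'" using assms by linarith
  then show ?thesis
    using kern_strict_antimono[of 0 s'] kern_strict_antimono[of s s'] assms
    by cases (auto simp: kern_nonpos)
qed

text \<open>The zero of the first branch \<open>25/8 - 17/8 * exp (8/25 * s)\<close> of
  \<open>kern\<close>.\<close>

definition kern_root :: real where
  "kern_root = 25/8 * ln (25/17)"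

lemma kern_root: "0 < kern_root" "kern_root < 3/2" "kern kern_root = 0"
proof -
  show 0: "0 < kern_root" by (simp add: kern_root_def)
  have "ln (25/17 :: real) \<le> 25/17 - 1" by (rule ln_le_minus_one) simp
  then show 1: "kern_root < 3/2" by (simp add: kern_root_def)
  have "exp (8/25 * kern_root) = 25/17" by (simp add: kern_root_def)
  then show "kern kern_root = 0"
    using kern_phase1[of kern_root] 0 1 delay_enclosure by simp
qed

lemma kern_pos: "s < kern_root \<Longrightarrow> 0 < kern s"
  using kern_strict_antimono[of s kern_root] kern_root delay_enclosure exp_delay_enclosure
  by (cases "0 \<le> s") (auto simp: kern_nonpos)

text \<open>\<open>kern\<close> falls up to \<open>delay + exp_delay\<close> and rises afterwards,
  so past the turning point the value at the right end decides. The offset 62/25 is 3/2 + 49/50: the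
  hit comes before \<open>horizon\<close>, and the starting times to which this is applied in the
  search for critical points are at least - 49/50.\<close>

lemma kern_neg:
  assumes "kern_root < s" "s \<le> 2 * delay + 62/25"
  shows "kern s < 0"
proof (cases "s \<le> delay + exp_delay")
  case True
  then show ?thesis using kern_strict_antimono[of kern_root s] assms kern_root by simp
next
  case False
  have "2 * delay + 62/25 \<le> 4 * pi" using pi_approx by (simp add: delay_def)
  then have "kern s \<le> kern (2 * delay + 62/25)"
    using kern_strict_mono[of s "2 * delay + 62/25"] False assms by (cases "s = 2 * delay + 62/25") auto
  then show ?thesis using kern_neg_point by simp
qed

section \<open>Monotone dependence on the starting time\<close>

lemma kern_diff_antimono:
  assumes "delay + exp_delay \<le> s" "s \<le> s'" "s' \<le> 4 * pi"
  shows "kern (s' - delay) - kern s' \<le> kern (s - delay) - kern s"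
proof -
  have "4 * pi - delay \<le> delay + exp_delay"
    using pi_approx exp_delay_enclosure by (simp add: delay_def)
  then have "kern (s' - delay) \<le> kern (s - delay)"
    using assms by (intro kern_antimono) auto
  moreover have "kern s \<le> kern s'"
    using kern_strict_mono[of s s'] assms by (cases "s = s'") auto
  ultimately show ?thesis by simp
qed

lemma horizon_bounds: "delay + exp_delay \<le> 2 * delay + 3/2" "2 * delay + 3/2 \<le> 4 * pi" "2 * delay + 3/2 < 7 * pi / 2"
  using pi_approx delay_enclosure exp_delay_enclosure by (simp_all add: delay_def)

lemma kern_diff_nonneg:
  assumes "s \<le> 2 * delay + 3/2"
  shows "0 \<le> kern (s - delay) - kern s"
proof (cases "s \<le> delay + exp_delay")
  case True
  then show ?thesis using kern_antimono[of "s - delay" s] by simp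
next
  case False
  have "2 * delay + 3/2 - delay = delay + 3/2" by simp
  then show ?thesis
    using kern_diff_antimono[of s "2 * delay + 3/2"] False assms horizon_bounds kern_diff_enclosure by simp
qed

lemma kern_diff_le:
  assumes "2 * delay + 3/2 \<le> s" "s \<le> 4 * pi"
  shows "kern (s - delay) - kern s \<le> 2"
proof -
  have "2 * delay + 3/2 - delay = delay + 3/2" by simp
  then show ?thesis
    using kern_diff_antimono[of "2 * delay + 3/2" s] assms horizon_bounds kern_diff_enclosure by simp
qed

lemma cos_start_nonneg: "- (pi/2) \<le> q \<Longrightarrow> q \<le> pi/2 \<Longrightarrow> 0 \<le> cos q"
  by (intro cos_ge_zero) auto

lemma gain_mono_start:
  assumes "- (pi/2) \<le> q" "q \<le> q'" "q' \<le> pi/2" "t - q \<le> 2 * delay + 3/2"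
  shows "gain q t \<le> gain q' t"
  using assms(2)
proof (rule mono_on_of_deriv)
  fix x assume x: "q < x" "x < q'"
  have "0 \<le> 25/17 * (kern (t - x - delay) - kern (t - x)) * cos x"
    using x assms kern_diff_nonneg[of "t - x"] by (intro mult_nonneg_nonneg cos_start_nonneg) auto
  then show "\<exists>D. ((\<lambda>q. gain q t) has_real_derivative D) (at x) \<and> 0 \<le> D"
    using DERIV_gain_start by blast
qed (intro continuous_intros)

lemma slope_mono_start:
  assumes "- (pi/2) \<le> q" "q \<le> q'" "q' \<le> pi/2" "q' < t" "t - q \<le> delay + 4"
  shows "slope q t \<le> slope q' t"
  using assms(2)
proof (rule mono_on_of_deriv)
  fix x assume x: "q < x" "x < q'"
  have t: "x < t" "t < x + 3 * delay" using x assms delay_enclosure by linarith+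
  have "0 \<le> 25/17 * deficit (t - x) * cos x"
    using x t assms deficit_pos[of "t - x"] exp_delay_enclosure
    by (intro mult_nonneg_nonneg cos_start_nonneg) auto
  then have "0 \<le> 25/17 * (kern (t - x - delay) - 8/25 * kern (t - x)) * cos x" by (simp add: deficit_def)
  then show "\<exists>D. ((\<lambda>q. slope q t) has_real_derivative D) (at x) \<and> 0 \<le> D"
    using DERIV_slope_start[OF t] by blast
qed (intro continuous_intros)

abbreviation horizon :: real where "horizon \<equiv> 2 * delay + 3/2"

text \<open>From 0 on, monotonicity in q suffices. For negative q the horizon lies so late that
  monotonicity is no longer available, but there the kernel difference is at most 2: going back from
  0 to q costs at most 50/17 times the modulus of \<open>sin q\<close>, well below the 12 available
  at 0.\<close>

lemma gain_horizon_pos: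
  assumes "- (pi/2) \<le> q" "q \<le> pi/2"
  shows "0 < gain q horizon"
proof (cases "0 \<le> q")
  case True
  then show ?thesis using gain_mono_start[of 0 q horizon] assms gain_zero_enclosure by simp
next
  case False
  have "gain 0 horizon + 50/17 * sin q \<le> gain q horizon"
  proof -
    have "- gain q horizon + 50/17 * sin q \<le> - gain 0 horizon + 50/17 * sin 0"
    proof (rule mono_on_of_deriv[of q 0 "\<lambda>q. - gain q horizon + 50/17 * sin q"])
      show "q \<le> 0" using False by simp
    next
      fix x assume x: "q < x" "x < 0"
      have "horizon - x \<le> 4 * pi" using x assms pi_approx by (simp add: delay_def)
      then have "kern (horizon - x - delay) - kern (horizon - x) \<le> 2"
        using x by (intro kern_diff_le) auto
      moreover define k where "k = kern (horizon - x - delay) - kern (horizon - x)"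
      ultimately have "25/17 * k * cos x \<le> 50/17 * cos x"
        using x assms by (intro mult_right_mono cos_start_nonneg) auto
      moreover have "((\<lambda>q. - gain q horizon + 50/17 * sin q) has_real_derivative
        - (25/17 * k * cos x) + 50/17 * cos x) (at x)"
        unfolding k_def by (rule derivative_eq_intros DERIV_gain_start refl | simp)+
      ultimately show "\<exists>D. ((\<lambda>q. - gain q horizon + 50/17 * sin q) has_real_derivative D) (at x) \<and> 0 \<le> D"
        by (intro exI[of _ "- (25/17 * k * cos x) + 50/17 * cos x"] conjI) (assumption, linarith)
    qed (intro continuous_intros)
    then show ?thesis by simp
  qed
  then show ?thesis using gain_zero_enclosure sin_ge_minus_one[of q] by linarith
qed

section \<open>Propagation of the sign of the slope\<close>

lemma DERIV_exp_slope:
  assumes "q < t" "t < q + 3 * delay"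
  shows "((\<lambda>t. exp (- 8/25 * t) * slope q t) has_real_derivative - exp (- 8/25 * t) * (slope q (t - delay) + cos t)) (at t)"
proof -
  have "((\<lambda>t. exp (- 8/25 * t)) has_real_derivative exp (- 8/25 * t) * (- 8/25)) (at t)"
    by (auto intro!: derivative_eq_intros)
  from DERIV_mult[OF this DERIV_slope[OF assms]] show ?thesis
    by (rule DERIV_cong) (simp add: algebra_simps)
qed

text \<open>With the integrating factor \<open>exp (- 8/25 * t)\<close> only the sum
  \<open>slope q (r - delay) + cos r\<close> drives the slope. Since
  \<open>cos r = sin (r - delay)\<close>, that sum is \<open>slope q + sin\<close> one delay
  earlier; hence the attention given to \<open>slope q + sin\<close> below.\<close>

lemma slope_persists:
  assumes "q \<le> t" "t \<le> t'" "t' \<le> q + 3 * delay" "0 \<le> slope q t"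
    and "\<And>r. t < r \<Longrightarrow> r < t' \<Longrightarrow> slope q (r - delay) + cos r \<le> 0"
  shows "0 \<le> slope q t'"
proof -
  have "exp (- 8/25 * t) * slope q t \<le> exp (- 8/25 * t') * slope q t'"
    using assms(2)
  proof (rule mono_on_of_deriv)
    fix r assume r: "t < r" "r < t'"
    have "((\<lambda>t. exp (- 8/25 * t) * slope q t) has_real_derivative - exp (- 8/25 * r) * (slope q (r - delay) + cos r)) (at r)"
      using DERIV_exp_slope r assms by simp
    moreover have "0 \<le> - exp (- 8/25 * r) * (slope q (r - delay) + cos r)"
      using assms(5)[OF r] by (simp add: mult_nonneg_nonpos)
    ultimately show "\<exists>D. ((\<lambda>t. exp (- 8/25 * t) * slope q t) has_real_derivative D) (at r) \<and> 0 \<le> D" by blast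
  qed (intro continuous_intros)
  moreover have "0 \<le> exp (- 8/25 * t) * slope q t" using assms(4) by simp
  ultimately have "0 \<le> exp (- 8/25 * t') * slope q t'" by linarith
  then show ?thesis by (simp add: zero_le_mult_iff)
qed

lemma slope_persists_strict:
  assumes "q \<le> t" "t < t'" "t' \<le> q + 3 * delay" "0 \<le> slope q t"
    and "\<And>r. t < r \<Longrightarrow> r < t' \<Longrightarrow> slope q (r - delay) + cos r < 0"
  shows "0 < slope q t'"
proof -
  have "exp (- 8/25 * t) * slope q t < exp (- 8/25 * t') * slope q t'"
    using assms(2)
  proof (rule strict_mono_of_deriv)
    fix r assume r: "t < r" "r < t'"
    have "((\<lambda>t. exp (- 8/25 * t) * slope q t) has_real_derivative - exp (- 8/25 * r) * (slope q (r - delay) + cos r)) (at r)"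
      using DERIV_exp_slope r assms by simp
    moreover have "0 < - exp (- 8/25 * r) * (slope q (r - delay) + cos r)"
      using assms(5)[OF r] by (simp add: mult_pos_neg)
    ultimately show "\<exists>D. ((\<lambda>t. exp (- 8/25 * t) * slope q t) has_real_derivative D) (at r) \<and> 0 < D" by blast
  qed (intro continuous_intros)
  moreover have "0 \<le> exp (- 8/25 * t) * slope q t" using assms(4) by simp
  ultimately have "0 < exp (- 8/25 * t') * slope q t'" by linarith
  then show ?thesis by (simp add: zero_less_mult_iff)
qed

lemma slope_negative_persists:
  assumes "q \<le> t" "t < t'" "t' \<le> q + 3 * delay" "slope q t \<le> 0"
    and "\<And>r. t < r \<Longrightarrow> r < t' \<Longrightarrow> 0 < slope q (r - delay) + cos r"
  shows "slope q t' < 0"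
proof -
  have "- (exp (- 8/25 * t) * slope q t) < - (exp (- 8/25 * t') * slope q t')"
    using assms(2)
  proof (rule strict_mono_of_deriv)
    fix r assume r: "t < r" "r < t'"
    have "((\<lambda>t. - (exp (- 8/25 * t) * slope q t)) has_real_derivative exp (- 8/25 * r) * (slope q (r - delay) + cos r)) (at r)"
      using DERIV_minus[OF DERIV_exp_slope[of q r]] r assms by simp
    moreover have "0 < exp (- 8/25 * r) * (slope q (r - delay) + cos r)"
      using assms(5)[OF r] by simp
    ultimately show "\<exists>D. ((\<lambda>t. - (exp (- 8/25 * t) * slope q t)) has_real_derivative D) (at r) \<and> 0 < D" by blast
  qed (intro continuous_intros)
  moreover have "0 \<le> - (exp (- 8/25 * t) * slope q t)" using assms(4) by (simp add: mult_nonneg_nonpos)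
  ultimately have "exp (- 8/25 * t') * slope q t' < 0" by linarith
  then show ?thesis by (simp add: mult_less_0_iff)
qed

lemma slope_neg_start:
  assumes "- (pi/2) \<le> q" "q < t" "t \<le> pi/2"
  shows "slope q t < 0"
proof (rule slope_negative_persists[of q q])
  fix r assume r: "q < r" "r < t"
  have "slope q (r - delay) = 0" using r assms pi_gt_zero by (intro slope_init) (simp add: delay_def)
  moreover have "0 < cos r" using r assms by (intro cos_gt_zero_pi) auto
  ultimately show "0 < slope q (r - delay) + cos r" by simp
qed (use assms pi_gt_zero slope_init[of q q] in \<open>auto simp: delay_def\<close>)

lemma cos_le_delay: "pi/2 \<le> t \<Longrightarrow> t \<le> delay \<Longrightarrow> cos t \<le> 0" for t :: real
  using cos_ge_zero[of "t - pi"] by (simp add: delay_def cos_diff)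

lemma slope_persists_early:
  assumes "- (pi/2) \<le> q" "q \<le> pi/2" "pi/2 \<le> t" "t \<le> t'" "t' \<le> delay" "t' \<le> q + delay" "0 \<le> slope q t"
  shows "0 \<le> slope q t'"
proof (rule slope_persists[OF _ assms(4) _ assms(7)])
  fix r assume r: "t < r" "r < t'"
  then show "slope q (r - delay) + cos r \<le> 0"
    using assms slope_init[of "r - delay" q] cos_le_delay[of r] by simp
qed (use assms delay_pos in auto)

text \<open>During the first delay the left end of the window is still in the constant history, and
  adding the sine cancels the forcing by the cosine. While the slope is nonpositive the sum can
  therefore only fall.\<close>

lemma DERIV_slope_sin:
  assumes "q < t" "t \<le> q + delay"
  shows "((\<lambda>t. slope q t + sin t) has_real_derivative 8/25 * slope q t) (at t)"
proof -
  have "slope q (t - delay) = 0" using assms by (intro slope_init) auto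
  moreover have "t < q + 3 * delay" using assms delay_pos by linarith
  ultimately show ?thesis
    using DERIV_add[OF DERIV_slope[of q t] DERIV_sin[of t]] assms by simp
qed

lemma slope_sin_antimono:
  assumes "q \<le> t" "t \<le> t'" "t' \<le> q + delay" "\<And>r. t < r \<Longrightarrow> r < t' \<Longrightarrow> slope q r \<le> 0"
  shows "slope q t' + sin t' \<le> slope q t + sin t"
proof -
  have "- (slope q t + sin t) \<le> - (slope q t' + sin t')"
    using assms(2)
  proof (rule mono_on_of_deriv)
    fix r assume r: "t < r" "r < t'"
    show "\<exists>D. ((\<lambda>t. - (slope q t + sin t)) has_real_derivative D) (at r) \<and> 0 \<le> D"
      using DERIV_minus[OF DERIV_slope_sin[of q r]] r assms by (intro exI conjI) auto
  qed (intro continuous_intros)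
  then show ?thesis by simp
qed

lemma first_zero:
  fixes f :: "real \<Rightarrow> real"
  assumes "a < b" "continuous_on {a..b} f" "f a < 0" "0 \<le> f b"
  obtains c where "a < c" "c \<le> b" "f c = 0" "\<And>t. a \<le> t \<Longrightarrow> t < c \<Longrightarrow> f t < 0"
proof -
  define A where "A = {t \<in> {a..b}. 0 \<le> f t}"
  have "closed A" unfolding A_def
    by (rule continuous_closed_preimage[OF assms(2) closed_atLeastAtMost, of "{0..}", unfolded vimage_def Int_def, simplified, THEN back_subst[of closed]]) auto
  have ne: "b \<in> A" "bdd_below A" using assms by (auto simp: A_def intro: bdd_belowI[of _ a])
  define c where "c = Inf A"
  have cA: "c \<in> A" unfolding c_def using \<open>closed A\<close> ne by (intro closed_contains_Inf) auto
  have lt: "f t < 0" if "a \<le> t" "t < c" for t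
    using cInf_lower[OF _ ne(2), of t] that cA by (force simp: A_def c_def)
  have "f c = 0"
  proof (rule ccontr)
    assume "f c \<noteq> 0"
    then have "0 < f c" using cA by (simp add: A_def)
    have "\<exists>x. a \<le> x \<and> x \<le> c \<and> f x = 0"
      using cA assms \<open>0 < f c\<close> by (intro IVT') (auto simp: A_def intro: continuous_on_subset)
    then show False using lt \<open>0 < f c\<close> by (metis less_irrefl order_le_less)
  qed
  moreover have "a < c" using cA assms by (auto simp: A_def order_le_less)
  ultimately show thesis using that cA lt by (auto simp: A_def)
qed

subsection \<open>Shape of the linear solution\<close>

definition unimodal :: "real \<Rightarrow> real \<Rightarrow> real \<Rightarrow> bool" where
  "unimodal q m T \<longleftrightarrow> q < m \<and> m < T \<and> (\<forall>t. q < t \<and> t < m \<longrightarrow> slope q t < 0) \<and>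
     (\<forall>t. m < t \<and> t \<le> T \<longrightarrow> 0 < slope q t)"

lemma lsol_antimono:
  assumes "t \<le> t'" "\<And>r. t < r \<Longrightarrow> r < t' \<Longrightarrow> slope q r \<le> 0"
  shows "lsol q t' \<le> lsol q t"
proof -
  have "- lsol q t \<le> - lsol q t'"
    using assms(1)
  proof (rule mono_on_of_deriv)
    fix r assume r: "t < r" "r < t'"
    show "\<exists>D. ((\<lambda>t. - lsol q t) has_real_derivative D) (at r) \<and> 0 \<le> D"
      using DERIV_minus[OF DERIV_lsol[of q r]] assms(2)[OF r] by (intro exI conjI) auto
  qed (intro continuous_intros)
  then show ?thesis by simp
qed

lemma lsol_strict_antimono:
  assumes "t < t'" "\<And>r. t < r \<Longrightarrow> r < t' \<Longrightarrow> slope q r < 0"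
  shows "lsol q t' < lsol q t"
proof -
  have "- lsol q t < - lsol q t'"
    using assms(1)
  proof (rule strict_mono_of_deriv)
    fix r assume r: "t < r" "r < t'"
    show "\<exists>D. ((\<lambda>t. - lsol q t) has_real_derivative D) (at r) \<and> 0 < D"
      using DERIV_minus[OF DERIV_lsol[of q r]] assms(2)[OF r] by (intro exI conjI) auto
  qed (intro continuous_intros)
  then show ?thesis by simp
qed

lemma lsol_strict_mono:
  assumes "t < t'" "\<And>r. t < r \<Longrightarrow> r < t' \<Longrightarrow> 0 < slope q r"
  shows "lsol q t < lsol q t'"
  using assms(1)
proof (rule strict_mono_of_deriv)
  fix r assume r: "t < r" "r < t'"
  show "\<exists>D. (lsol q has_real_derivative D) (at r) \<and> 0 < D"
    using DERIV_lsol[of q r] assms(2)[OF r] by (intro exI conjI) auto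
qed (intro continuous_intros)

lemma lsol_antimono':
  assumes "t \<le> t'" "\<And>r. q < r \<Longrightarrow> r < t' \<Longrightarrow> slope q r < 0"
  shows "lsol q t' \<le> lsol q t"
  by (rule lsol_antimono[OF assms(1)]) (use assms(2) slope_init in \<open>force simp: not_less[symmetric] intro: less_imp_le\<close>)

lemma lsol_strict_antimono':
  assumes "t < t'" "q < t'" "\<And>r. q < r \<Longrightarrow> r < t' \<Longrightarrow> slope q r < 0"
  shows "lsol q t' < lsol q t"
proof (cases "q \<le> t")
  case True
  then show ?thesis using assms by (intro lsol_strict_antimono) auto
next
  case False
  then have "lsol q t = lsol q q" by (simp add: lsol_init)
  then show ?thesis using assms lsol_strict_antimono[of q t' q] by simp
qed

lemma gain_neg_start:
  assumes "q < t" "\<And>r. q < r \<Longrightarrow> r < t \<Longrightarrow> slope q r < 0"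
  shows "gain q t < 0"
  using lsol_strict_antimono'[of "t - delay" t q] assms by (simp add: gain_def)

text \<open>The gain is negative on the descending branch, so its zero lies past m. From there until
  \<open>m + delay\<close> the right end of the window climbs while the left end does not, and the
  gain keeps growing.\<close>

lemma unimodal_gain_pos:
  assumes "unimodal q m T" "gain q t = 0" "q < t" "t < t'" "t' \<le> T" "t' \<le> m + delay"
  shows "0 < gain q t'"
proof -
  have mt: "m < t"
  proof (rule ccontr)
    assume "\<not> m < t"
    then have "gain q t < 0" using assms by (intro gain_neg_start) (auto simp: unimodal_def)
    then show False using assms by simp
  qed
  have "gain q t < gain q t'"
    using assms(4)
  proof (rule strict_mono_of_deriv)
    fix r assume r: "t < r" "r < t'"
    have "slope q (r - delay) \<le> 0"
    proof (cases "r - delay \<le> q")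
      case False
      then have "slope q (r - delay) < 0" using assms(1,6) r unfolding unimodal_def by force
      then show ?thesis by simp
    qed (simp add: slope_init)
    moreover have "0 < slope q r" using assms r mt by (auto simp: unimodal_def)
    ultimately have "0 < slope q r - slope q (r - delay)" by linarith
    then show "\<exists>D. (gain q has_real_derivative D) (at r) \<and> 0 < D"
      using DERIV_gain[of q r] by blast
  qed (intro continuous_intros)
  then show ?thesis using assms by simp
qed

text \<open>The clause on windows is what makes \<open>lsol q\<close> the true solution up to s. The
  two slope clauses make the zero of the gain transversal, and positive slope at zero gain also
  places the solution strictly below the nullcline.\<close>

definition returns_at :: "real \<Rightarrow> real \<Rightarrow> bool" where
  "returns_at q s \<longleftrightarrow> pi/2 < s \<and> s < horizon \<and> gain q s = 0 \<and> (\<forall>t. q < t \<and> t < s \<longrightarrow> gain q t < 0) \<and>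
     (\<forall>t r. q \<le> t \<and> t \<le> s \<and> t - delay \<le> r \<and> r \<le> t \<longrightarrow> lsol q r \<le> lsol q (t - delay)) \<and>
     0 < slope q s \<and> slope q (s - delay) \<le> 0"

lemma first_return:
  assumes q: "- (pi/2) \<le> q" "q < pi/2" and T: "pi/2 < T" "0 < gain q T"
  obtains s where "pi/2 < s" "s < T" "gain q s = 0" "\<And>t. q < t \<Longrightarrow> t < s \<Longrightarrow> gain q t < 0"
proof -
  have early: "gain q t < 0" if "q < t" "t \<le> pi/2" for t
    using that q by (intro gain_neg_start slope_neg_start) auto
  obtain s where s: "pi/2 < s" "s \<le> T" "gain q s = 0" "\<And>t. pi/2 \<le> t \<Longrightarrow> t < s \<Longrightarrow> gain q t < 0"
  proof (rule first_zero[of "pi/2" T "gain q"])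
    show "continuous_on {pi/2..T} (gain q)" by (intro continuous_intros)
  qed (use T early[of "pi/2"] q in auto)
  moreover have "s \<noteq> T" using s T by auto
  moreover have "gain q t < 0" if "q < t" "t < s" for t
    using early[of t] s(4)[of t] that by (cases "t \<le> pi/2") auto
  ultimately show thesis using that by force
qed

lemma unimodal_returns:
  assumes q: "- (pi/2) \<le> q" "q < pi/2" and um: "unimodal q m T" and T: "pi/2 < T" "T \<le> horizon" "0 < gain q T"
  obtains s where "returns_at q s" "s < T"
proof -
  obtain s where s: "pi/2 < s" "s < T" "gain q s = 0" "\<And>t. q < t \<Longrightarrow> t < s \<Longrightarrow> gain q t < 0"
    using first_return[OF q T(1,3)] by metis
  have neg: "slope q r < 0" if "q < r" "r < m" for r using um that by (auto simp: unimodal_def)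
  have pos: "0 < slope q r" if "m < r" "r \<le> T" for r using um that by (auto simp: unimodal_def)
  have qm: "q < m" using um by (simp add: unimodal_def)
  have ms: "m < s"
  proof (rule ccontr)
    assume "\<not> m < s"
    then have "gain q s < 0" using neg s q by (intro gain_neg_start) auto
    then show False using s by simp
  qed
  have "s - delay \<le> m"
  proof (rule ccontr)
    assume "\<not> s - delay \<le> m"
    then have "lsol q (s - delay) < lsol q s" using pos s by (intro lsol_strict_mono) auto
    then show False using s(3) by (simp add: gain_def)
  qed
  then have "slope q (s - delay) \<le> 0"
  proof (cases "s - delay < m")
    case True
    then show ?thesis using neg[of "s - delay"] slope_init[of "s - delay" q] by (cases "q < s - delay") auto
  next
    case False
    then have e: "s - delay = m" using \<open>s - delay \<le> m\<close> by simp
    have "lsol q m < lsol q s" using pos s ms by (intro lsol_strict_mono) auto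
    then show ?thesis using s(3) e by (simp add: gain_def)
  qed
  moreover have "lsol q r \<le> lsol q (t - delay)" if t: "q \<le> t" "t \<le> s" "t - delay \<le> r" "r \<le> t" for t r
  proof (cases "r \<le> m")
    case True
    then show ?thesis using t neg by (intro lsol_antimono') auto
  next
    case False
    have "lsol q r \<le> lsol q t"
    proof (cases "r = t")
      case False
      then have "lsol q r < lsol q t" using \<open>\<not> r \<le> m\<close> t s pos by (intro lsol_strict_mono) auto
      then show ?thesis by simp
    qed simp
    also have "\<dots> \<le> lsol q (t - delay)"
    proof -
      have "gain q t \<le> 0"
        using s(3) s(4)[of t] t lsol_init[of t q] lsol_init[of "t - delay" q]
        by (cases "t = s"; cases "t = q") (auto simp: gain_def)
      then show ?thesis by (simp add: gain_def)
    qed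
    finally show ?thesis .
  qed
  ultimately have "returns_at q s"
    unfolding returns_at_def using s pos[of s] ms T by auto
  then show thesis using that s by blast
qed

text \<open>Positivity of the slope at a time needs negativity up to one delay earlier, so from the
  first zero m it propagates only to \<open>m + delay\<close>, or to \<open>horizon\<close> if that
  comes first. If T is \<open>m + delay\<close>, the gain at T compares a point of the ascending
  branch with the minimum; otherwise \<open>gain_horizon_pos\<close> applies.\<close>

lemma unimodal_of_persistence:
  assumes q: "- (pi/2) \<le> q" "q < pi/2" and b: "pi/2 \<le> b" "b < horizon"
    and early: "\<And>t. q < t \<Longrightarrow> t \<le> b \<Longrightarrow> slope q t < 0"
    and late: "\<And>t. b < t \<Longrightarrow> t < horizon \<Longrightarrow> (\<And>r. q < r \<Longrightarrow> r \<le> t - delay \<Longrightarrow> slope q r < 0) \<Longrightarrow>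
      slope q (t - delay) + cos t < 0"
  obtains m T where "unimodal q m T" "T \<le> horizon" "b < m" "0 < gain q T" "T = min horizon (m + delay)"
proof -
  have hq: "horizon \<le> q + 3 * delay" "q < horizon"
    using q delay_enclosure pi_approx by (simp_all add: delay_def)
  have "\<exists>t. b \<le> t \<and> t \<le> horizon \<and> 0 \<le> slope q t"
  proof (rule ccontr)
    assume "\<not> ?thesis"
    then have "slope q t < 0" if "q < t" "t \<le> horizon" for t
    proof (cases "t \<le> b")
      case False
      then show ?thesis using \<open>\<not> (\<exists>t. b \<le> t \<and> t \<le> horizon \<and> 0 \<le> slope q t)\<close> that
        by (meson less_imp_le not_le)
    qed (use early that in auto)
    then have "gain q horizon < 0" using hq by (intro gain_neg_start) auto
    then show False using gain_horizon_pos[of q] q by simp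
  qed
  then obtain t where t: "b \<le> t" "t \<le> horizon" "0 \<le> slope q t" by blast
  have "b < t" using t early[of b] q b by (cases "b = t") auto
  then obtain m where m: "b < m" "m \<le> t" "slope q m = 0" "\<And>r. b \<le> r \<Longrightarrow> r < m \<Longrightarrow> slope q r < 0"
  proof (rule first_zero[of b t "slope q"])
    show "continuous_on {b..t} (slope q)" by (intro continuous_intros)
  qed (use t early[of b] q b in auto)
  define T where "T = min horizon (m + delay)"
  have neg: "slope q r < 0" if "q < r" "r < m" for r
    using early[of r] m(4)[of r] that by (cases "r \<le> b") auto
  have pos: "0 < slope q r" if "m < r" "r \<le> T" for r
  proof (rule slope_persists_strict[of q m])
    fix u assume u: "m < u" "u < r"
    show "slope q (u - delay) + cos u < 0"
      using u that m neg by (intro late) (auto simp: T_def)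
  qed (use m b q that hq in \<open>auto simp: T_def\<close>)
  have mT: "m < T"
  proof -
    have "m \<noteq> horizon"
    proof
      assume "m = horizon"
      then have "gain q horizon < 0" using neg hq by (intro gain_neg_start) auto
      then show False using gain_horizon_pos[of q] q by simp
    qed
    then show ?thesis using m t by (auto simp: T_def)
  qed
  have "unimodal q m T" using neg pos mT m b q by (auto simp: unimodal_def)
  moreover have "0 < gain q T"
  proof (cases "T = horizon")
    case True
    then show ?thesis using gain_horizon_pos[of q] q by simp
  next
    case False
    then have "T = m + delay" by (auto simp: T_def min_def split: if_splits)
    moreover have "lsol q m < lsol q T" using pos mT by (intro lsol_strict_mono) auto
    ultimately show ?thesis by (simp add: gain_def)
  qed
  ultimately show thesis using that[of m T] m(1) by (simp add: T_def)
qed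

text \<open>Up to pi the sum falls strictly because the slope is negative; between pi and
  \<open>2 * pi\<close> the sine is nonpositive and the negative slope alone suffices.\<close>

lemma slope_sin_neg:
  assumes q: "- (pi/2) \<le> q" "q \<le> pi/2" and t: "q \<le> t0" "0 \<le> t0" "slope q t0 + sin t0 \<le> 0" "t0 < t" "t \<le> 2 * pi"
    and neg: "\<And>r. q < r \<Longrightarrow> r \<le> t \<Longrightarrow> slope q r < 0"
  shows "slope q t + sin t < 0"
proof (cases "t \<le> pi")
  case True
  have "- (slope q t0 + sin t0) < - (slope q t + sin t)"
    using t(4)
  proof (rule strict_mono_of_deriv)
    fix r assume r: "t0 < r" "r < t"
    have "r \<le> q + delay" using r True q by (simp add: delay_def)
    then show "\<exists>D. ((\<lambda>t. - (slope q t + sin t)) has_real_derivative D) (at r) \<and> 0 < D"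
      using DERIV_minus[OF DERIV_slope_sin[of q r]] r t neg[of r] by (intro exI conjI) auto
  qed (intro continuous_intros)
  then show ?thesis using t by simp
next
  case False
  then have "sin t \<le> 0" using sin_le_zero[of t] t by (cases "t = 2 * pi") auto
  then show ?thesis using neg[of t] t by simp
qed

text \<open>\<open>slope\<close> increases with q, so the start 0 is the worst case: a nonnegative
  slope before \<open>delay + 3/2\<close> would persist to that time, where an enclosure shows it
  negative. The minimum then comes so late that \<open>m + delay\<close> exceeds
  \<open>horizon\<close>, and the shape is known on the whole range.\<close>

lemma unimodal_nonpos:
  assumes q: "- (pi/2) \<le> q" "q \<le> 0"
  obtains m where "unimodal q m horizon" "delay + 3/2 < m"
proof -
  note pib = pi_approx
  have zero: "slope 0 t < 0" if t: "0 < t" "t \<le> delay + 3/2" for t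
  proof (rule ccontr)
    assume ns: "\<not> slope 0 t < 0"
    have tp: "pi/2 < t" using slope_neg_start[of 0 t] t ns by (cases "t \<le> pi/2") auto
    have "0 \<le> slope 0 (delay + 3/2)"
    proof (rule slope_persists[of 0 t])
      fix r assume r: "t < r" "r < delay + 3/2"
      show "slope 0 (r - delay) + cos r \<le> 0"
      proof (cases "r \<le> delay")
        case True
        then show ?thesis using r tp cos_le_delay[of r] slope_init[of "r - delay" 0] by simp
      next
        case False
        have "slope 0 (r - delay) + sin (r - delay) \<le> slope 0 0 + sin 0"
        proof (rule slope_sin_antimono)
          fix u assume "0 < u" "u < r - delay"
          then show "slope 0 u \<le> 0"
            using slope_neg_start[of 0 u] r pib by simp
        qed (use False r delay_enclosure in auto)
        then show ?thesis using slope_init[of 0 0] by simp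
      qed
    qed (use t ns delay_enclosure in auto)
    then show False using slope_zero_neg by simp
  qed
  have early: "slope q t < 0" if t: "q < t" "t \<le> delay + 3/2" for t
  proof (cases "t \<le> pi/2")
    case True
    then show ?thesis using t q by (intro slope_neg_start) auto
  next
    case False
    then have "slope q t \<le> slope 0 t"
      using t q pib by (intro slope_mono_start) (auto simp: delay_def)
    then show ?thesis using zero[of t] t False pi_gt_zero by simp
  qed
  have s0: "slope q 0 + sin 0 \<le> 0"
    using q early[of 0] slope_init[of 0 0] delay_enclosure by (cases "q = 0") auto
  obtain m T where mT: "unimodal q m T" "T \<le> horizon" "delay + 3/2 < m" "0 < gain q T" "T = min horizon (m + delay)"
  proof (rule unimodal_of_persistence[of q "delay + 3/2"])
    fix t assume t: "delay + 3/2 < t" "t < horizon" and neg: "\<And>r. q < r \<Longrightarrow> r \<le> t - delay \<Longrightarrow> slope q r < 0"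
    have "slope q (t - delay) + sin (t - delay) < 0"
      using t q s0 neg pib by (intro slope_sin_neg[of q 0]) (auto simp: delay_def)
    then show "slope q (t - delay) + cos t < 0" by simp
  qed (use q early pib in \<open>auto simp: delay_def\<close>)
  have "T = horizon" using mT by (auto simp: min_def)
  then show thesis using that mT by blast
qed

section \<open>Starting times from 0 to 7/100\<close>

lemma half_pi_bounds: "1570796/1000000 < pi/2" "pi/2 < 1570797/1000000"
  using pi_approx by simp_all

lemma cos_neg_delay: "pi/2 < t \<Longrightarrow> t < delay \<Longrightarrow> cos t < 0" for t :: real
  using cos_gt_zero_pi[of "t - pi"] by (simp add: delay_def cos_diff)

lemma slope_nonneg_late:
  assumes "- (pi/2) \<le> q" "q < t" "\<not> slope q t < 0"
  shows "pi/2 < t"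
  using slope_neg_start[OF assms(1,2)] assms(3) by (meson not_le)

lemma slope_012_neg: "slope (3/25) t < 0" if "3/25 < t" "t \<le> 331/100"
proof (rule ccontr)
  assume ns: "\<not> slope (3/25) t < 0"
  have "pi/2 < t" by (rule slope_nonneg_late[OF _ that(1) ns]) (use half_pi_bounds in linarith)
  then have "0 \<le> slope (3/25) (331/100)"
    by - (rule slope_persists_early[of "3/25" t], (use ns that delay_enclosure half_pi_bounds in linarith)+)
  then show False using start_012(3) by simp
qed

lemma slope_small_neg:
  assumes "0 \<le> q" "q \<le> 3/25" "q < t" "t \<le> 331/100"
  shows "slope q t < 0"
proof (cases "t \<le> pi/2")
  case True
  then show ?thesis using assms by (intro slope_neg_start) auto
next
  case False
  then have "slope q t \<le> slope (3/25) t"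
    by - (rule slope_mono_start, (use assms half_pi_bounds delay_enclosure in linarith)+)
  then show ?thesis using slope_012_neg[of t] False assms half_pi_bounds by simp
qed

lemma slope_sin_small:
  assumes "0 \<le> q" "q \<le> 3/25" "109/100 \<le> t" "t \<le> 2 * pi" "\<And>r. q < r \<Longrightarrow> r \<le> t \<Longrightarrow> slope q r < 0"
  shows "slope q t + sin t < 0"
proof -
  have "slope q (109/100) \<le> slope (3/25) (109/100)"
    by - (rule slope_mono_start, (use assms half_pi_bounds delay_enclosure in linarith)+)
  then have *: "slope q (109/100) + sin (109/100) < 0" using start_012(1) by simp
  show ?thesis
  proof (cases "t = 109/100")
    case False
    then show ?thesis using assms * half_pi_bounds by - (rule slope_sin_neg[of q "109/100"], auto)
  next
    case True
    show ?thesis unfolding True by (fact *)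
  qed
qed

text \<open>A nonnegative slope no later than \<open>delay\<close> would persist to
  \<open>delay\<close>, where it is known to be negative. After \<open>delay\<close> the driving
  term is a function f that increases as a sine until 7/100 and falls from there to 109/100. If f
  has become nonpositive by \<open>t - delay\<close>, a nonnegative slope persists to
  \<open>delay + 109/100\<close>, contradicting the enclosure; if it is still positive, it was
  positive all the way from \<open>delay\<close> and has kept the slope negative.\<close>

lemma slope_007_neg: "slope (7/100) t < 0" if t: "7/100 < t" "t \<le> delay + 109/100"
proof (rule ccontr)
  assume ns: "\<not> slope (7/100) t < 0"
  have tp: "pi/2 < t" by (rule slope_nonneg_late[OF _ t(1) ns]) (use half_pi_bounds in linarith)
  show False
  proof (cases "t \<le> delay")
    case True
    then have "0 \<le> slope (7/100) delay"
      by - (rule slope_persists_early[of "7/100" t], (use ns tp half_pi_bounds delay_enclosure in linarith)+)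
    then show False using slope_delay_007 by simp
  next
    case False
    define f where "f u = slope (7/100) u + sin u" for u
    have f: "f v \<le> f u" if "7/100 \<le> u" "u \<le> v" "v \<le> 109/100" for u v
      unfolding f_def
    proof (rule slope_sin_antimono)
      fix r assume "u < r" "r < v"
      then show "slope (7/100) r \<le> 0" using that half_pi_bounds slope_neg_start[of "7/100" r] by simp
    qed (use that delay_enclosure in auto)
    have cosf: "slope (7/100) (r - delay) + cos r = f (r - delay)" for r by (simp add: f_def)
    show False
    proof (cases "f (t - delay) \<le> 0")
      case True
      have "0 \<le> slope (7/100) (delay + 109/100)"
      proof (rule slope_persists[of _ t])
        fix r assume r: "t < r" "r < delay + 109/100"
        show "slope (7/100) (r - delay) + cos r \<le> 0"
        proof (cases "7/100 \<le> t - delay")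
          case False
          then have "0 < f (t - delay)"
            using slope_init[of "t - delay" "7/100"] sin_gt_zero[of "t - delay"] \<open>\<not> t \<le> delay\<close> half_pi_bounds
            by (simp add: f_def del: sin_diff_delay)
          then show ?thesis using True by simp
        next
          case 7: True
          then show ?thesis unfolding cosf using f[of "t - delay" "r - delay"] True r by simp
        qed
      qed (use t ns delay_enclosure in auto)
      moreover have "7/100 + (delay + 51/50) = delay + 109/100" by simp
      then have "slope (7/100) (delay + 109/100) < 0" using start_007(1) by (simp only:)
      ultimately show False by linarith
    next
      case False
      have "slope (7/100) t < 0"
      proof (rule slope_negative_persists[of _ delay])
        fix r assume r: "delay < r" "r < t"
        show "0 < slope (7/100) (r - delay) + cos r"
        proof (cases "7/100 \<le> r - delay")
          case True
          then show ?thesis unfolding cosf using f[of "r - delay" "t - delay"] False r t by simp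
        next
          case 7: False
          have "0 < sin (r - delay)" using 7 r half_pi_bounds by (intro sin_gt_zero) auto
          then show ?thesis using slope_init[of "r - delay" "7/100"] 7 by simp
        qed
      qed (use \<open>\<not> t \<le> delay\<close> t slope_delay_007 delay_enclosure in auto)
      then show False using ns by simp
    qed
  qed
qed

lemma unimodal_small:
  assumes q: "0 \<le> q" "q \<le> 7/100"
  obtains m T where "unimodal q m T" "pi/2 < T" "T \<le> horizon" "0 < gain q T"
proof -
  have early: "slope q t < 0" if t: "q < t" "t \<le> delay + 109/100" for t
  proof (cases "t \<le> pi/2")
    case True
    then show ?thesis using t q by (intro slope_neg_start) auto
  next
    case False
    then have "slope q t \<le> slope (7/100) t"
      by - (rule slope_mono_start, (use t q half_pi_bounds delay_enclosure in linarith)+)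
    then show ?thesis using slope_007_neg[of t] t False half_pi_bounds by simp
  qed
  obtain m T where mT: "unimodal q m T" "T \<le> horizon" "delay + 109/100 < m" "0 < gain q T" "T = min horizon (m + delay)"
  proof (rule unimodal_of_persistence[of q "delay + 109/100"])
    fix t assume t: "delay + 109/100 < t" "t < horizon" and neg: "\<And>r. q < r \<Longrightarrow> r \<le> t - delay \<Longrightarrow> slope q r < 0"
    have "slope q (t - delay) + sin (t - delay) < 0"
      by (rule slope_sin_small) (use t q neg half_pi_bounds delay_enclosure in \<open>linarith | blast\<close>)+
    then show "slope q (t - delay) + cos t < 0" by simp
  qed (use q early half_pi_bounds delay_enclosure in auto)
  moreover have "pi/2 < T" using mT half_pi_bounds delay_enclosure by (auto simp: min_def)
  ultimately show thesis using that by blast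
qed

section \<open>Starting times from 3/25 on, and the gap between 7/100 and 3/25\<close>

abbreviation late_horizon :: real where "late_horizon \<equiv> 3/25 + (delay + 3)"

text \<open>The first bound matters for the return map: for starts from 3/25 on the hit precedes the
  second crest \<open>5 * pi / 2\<close> of \<open>bump\<close>, so a threshold below that crest is
  met on the rising branch leading to it.\<close>

lemma late_horizon_less: "late_horizon < 5 * pi / 2" "late_horizon < horizon"
  using pi_approx by (simp_all add: delay_def)

lemma slope_012_pos:
  assumes t: "delay \<le> t" "t \<le> late_horizon"
  shows "0 < slope (3/25) t"
proof -
  have near: "0 < slope (3/25) t" if t: "delay \<le> t" "t \<le> delay + 109/100" for t
  proof -
    \<comment> \<open>3/8 is the equilibrium belonging to the driving value 3/25, as 8/25 * 3/8 =
      3/25. While \<open>slope (3/25) (r - delay) + cos r\<close> is at most 3/25, the excess of the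
      slope over 3/8, multiplied by the integrating factor, cannot fall.\<close>
    let ?h = "\<lambda>t. exp (- 8/25 * t) * slope (3/25) t - 3/8 * exp (- 8/25 * t)"
    have "?h delay \<le> ?h t"
      using t(1)
    proof (rule mono_on_of_deriv)
      fix r assume r: "delay < r" "r < t"
      have "((\<lambda>t. exp (- 8/25 * t) * slope (3/25) t - 3/8 * exp (- 8/25 * t)) has_real_derivative
          - exp (- 8/25 * r) * (slope (3/25) (r - delay) + cos r) - 3/8 * (exp (- 8/25 * r) * (- 8/25))) (at r)"
        by (rule DERIV_diff[OF DERIV_exp_slope]) (use r t delay_enclosure in \<open>auto intro!: derivative_eq_intros\<close>)
      moreover have "slope (3/25) (r - delay) + sin (r - delay) \<le> 3/25"
      proof (cases "3/25 \<le> r - delay")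
        case True
        have "slope (3/25) (r - delay) + sin (r - delay) \<le> slope (3/25) (3/25) + sin (3/25)"
        proof (rule slope_sin_antimono)
          fix u assume "3/25 < u" "u < r - delay"
          then show "slope (3/25) u \<le> 0" using slope_012_neg[of u] r t by simp
        qed (use True r t delay_enclosure in auto)
        then show ?thesis using slope_init[of "3/25" "3/25"] sin_x_le_x[of "3/25"] by simp
      next
        case False
        then show ?thesis using slope_init[of "r - delay" "3/25"] sin_x_le_x[of "r - delay"] r by simp
      qed
      then have "exp (- 8/25 * r) * (slope (3/25) (r - delay) + cos r) \<le> exp (- 8/25 * r) * (3/25)"
        by (intro mult_left_mono) auto
      ultimately show "\<exists>D. (?h has_real_derivative D) (at r) \<and> 0 \<le> D"
        by (intro exI conjI) auto
    qed (intro continuous_intros)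
    then have "exp (8/25 * t) * ?h delay \<le> exp (8/25 * t) * ?h t" by (intro mult_left_mono) auto
    moreover have "exp (8/25 * t) * ?h delay = (exp (8/25 * t) * exp (- 8/25 * delay)) * (slope (3/25) delay - 3/8)"
      "exp (8/25 * t) * ?h t = (exp (8/25 * t) * exp (- 8/25 * t)) * (slope (3/25) t - 3/8)"
      by (simp_all only: right_diff_distrib left_diff_distrib mult.assoc mult.commute[of "3/8"])
    moreover have "exp (8/25 * t) * exp (- 8/25 * delay) = exp (8/25 * (t - delay))" "exp (8/25 * t) * exp (- 8/25 * t) = 1"
      by (simp_all flip: exp_add add: right_diff_distrib)
    ultimately have 1: "exp (8/25 * (t - delay)) * (slope (3/25) delay - 3/8) \<le> slope (3/25) t - 3/8"
      by (simp only: mult_1)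
    \<comment> \<open>872/2500 is 8/25 * 109/100. At \<open>delay\<close> the slope is below 3/8 by
      less than 249/1000; this shortfall grows by a factor of at most 1.418 and stays below 3/8, so
      the slope remains positive.\<close>
    have "1417/1000 \<le> exp (872/2500 :: real) \<and> exp (872/2500 :: real) \<le> 1418/1000"
      by (rule exp_enclosure) (simp_all add: power_divide)
    moreover have "exp (8/25 * (t - delay)) \<le> exp (872/2500)" using t by simp
    ultimately have "exp (8/25 * (t - delay)) \<le> 1418/1000" by linarith
    then have "exp (8/25 * (t - delay)) * (3/8 - slope (3/25) delay) \<le> exp (8/25 * (t - delay)) * (249/1000)"
      and "exp (8/25 * (t - delay)) * (249/1000) \<le> 1418/1000 * (249/1000)"
      using slope_delay_012 by (intro mult_left_mono mult_right_mono, auto)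
    moreover have "exp (8/25 * (t - delay)) * (slope (3/25) delay - 3/8) = - (exp (8/25 * (t - delay)) * (3/8 - slope (3/25) delay))"
      by (simp only: mult_minus_right[symmetric] minus_diff_eq)
    ultimately show ?thesis using 1 by linarith
  qed
  show ?thesis
  proof (cases "t \<le> delay + 109/100")
    case False
    show ?thesis
    proof (rule slope_persists_strict[of _ "delay + 109/100"])
      fix r assume r: "delay + 109/100 < r" "r < t"
      have "slope (3/25) (r - delay) + sin (r - delay) < 0"
        by (rule slope_sin_small) (use r t half_pi_bounds in linarith, use r t half_pi_bounds in linarith,
          use r t half_pi_bounds in linarith, use r t half_pi_bounds in linarith, rule slope_012_neg, assumption, use r t in linarith)
      then show "slope (3/25) (r - delay) + cos r < 0" by simp
    qed (use False t near[of "delay + 109/100"] delay_enclosure in auto)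
  qed (use near t in auto)
qed

text \<open>Comparison with the start 3/25 gives a positive slope from \<open>delay\<close> on.
  Before that the left end of the window is in the constant history and the cosine is negative past
  \<open>pi/2\<close>, so the slope changes sign only once.\<close>

lemma unimodal_late:
  assumes q: "3/25 \<le> q" "q < pi/2"
  obtains m where "unimodal q m late_horizon" "pi/2 < m" "0 < gain q late_horizon"
proof -
  have pos: "0 < slope q t" if t: "delay \<le> t" "t \<le> late_horizon" for t
  proof -
    have "slope (3/25) t \<le> slope q t"
      by - (rule slope_mono_start, (use t q half_pi_bounds delay_enclosure in linarith)+)
    then show ?thesis using slope_012_pos[OF t] by simp
  qed
  have half: "slope q (pi/2) < 0" using q half_pi_bounds by (intro slope_neg_start) auto
  obtain m where m: "pi/2 < m" "m \<le> delay" "slope q m = 0" "\<And>t. pi/2 \<le> t \<Longrightarrow> t < m \<Longrightarrow> slope q t < 0"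
  proof (rule first_zero[of "pi/2" delay "slope q"])
    show "continuous_on {pi/2..delay} (slope q)" by (intro continuous_intros)
  qed (use half pos[of delay] delay_enclosure half_pi_bounds in auto)
  have "m \<noteq> delay" using m pos[of delay] by auto
  have "unimodal q m late_horizon"
    unfolding unimodal_def
  proof (intro conjI allI impI)
    fix t assume t: "q < t \<and> t < m"
    show "slope q t < 0"
      using t m(4)[of t] slope_neg_start[of q t] q half_pi_bounds by (cases "t \<le> pi/2") auto
  next
    fix t assume t: "m < t \<and> t \<le> late_horizon"
    show "0 < slope q t"
    proof (cases "t < delay")
      case True
      show ?thesis
      proof (rule slope_persists_strict[of q m])
        fix r assume r: "m < r" "r < t"
        then show "slope q (r - delay) + cos r < 0"
          using m True q half_pi_bounds slope_init[of "r - delay" q] cos_neg_delay[of r] by simp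
      qed (use t m q True delay_enclosure half_pi_bounds in auto)
    qed (use t pos in auto)
  qed (use m q delay_enclosure half_pi_bounds in auto)
  moreover have "gain (3/25) late_horizon \<le> gain q late_horizon"
    by - (rule gain_mono_start, (use q half_pi_bounds delay_enclosure in linarith)+)
  ultimately show thesis using that m start_012(4) by (meson less_le_trans)
qed

text \<open>In this range of starting times the slope may change its sign more than once. That does no harm as
  long as the solution stays below its value at \<open>331/100\<close> on the critical interval.\<close>

lemma returns_between:
  assumes q: "7/100 \<le> q" "q \<le> 3/25"
  obtains s where "returns_at q s"
proof -
  let ?z = "331/100 :: real" and ?b = "delay + 109/100"
  have qb: "- (pi/2) \<le> q" "q < pi/2" "q < ?z" using q half_pi_bounds by auto
  have "gain (7/100) (?z + delay) \<le> gain q (?z + delay)"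
    by - (rule gain_mono_start, (use q half_pi_bounds delay_enclosure in linarith)+)
  moreover have "7/100 + (delay + 81/25) = ?z + delay" by simp
  then have "0 < gain (7/100) (?z + delay)" using start_007(2) by (simp only:)
  ultimately have gz: "0 < gain q (?z + delay)" by linarith
  have "pi/2 < ?z + delay" using half_pi_bounds delay_enclosure by linarith
  then obtain s where s: "pi/2 < s" "s < ?z + delay" "gain q s = 0" "\<And>t. q < t \<Longrightarrow> t < s \<Longrightarrow> gain q t < 0"
    using first_return[OF qb(1,2) _ gz] by metis
  have neg: "slope q t < 0" if "q < t" "t \<le> ?z" for t
    using slope_small_neg[of q t] that q by simp
  \<comment> \<open>From \<open>delay + 109/100\<close> to s the driving term is negative, so a
    slope that has become nonnegative stays positive. Earlier sign changes are left open.\<close>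
  have late: "0 < slope q t'" if t: "?b \<le> t" "t < t'" "t' \<le> s" "0 \<le> slope q t" for t t'
  proof (rule slope_persists_strict[OF _ t(2) _ t(4)])
    fix r assume r: "t < r" "r < t'"
    have "slope q (r - delay) + sin (r - delay) < 0"
      by (rule slope_sin_small) (use r t s q half_pi_bounds in linarith, use r t s q half_pi_bounds in linarith,
        use r t s q half_pi_bounds in linarith, use r t s q half_pi_bounds in linarith, rule neg, assumption, use r t s in linarith)
    then show "slope q (r - delay) + cos r < 0" by simp
  qed (use t s q delay_enclosure in auto)
  obtain m where m: "unimodal (3/25) m late_horizon" "pi/2 < m" "0 < gain (3/25) late_horizon"
    using unimodal_late[of "3/25"] half_pi_bounds by auto
  have ref: "lsol (3/25) r \<le> lsol (3/25) ?z" if r: "?z \<le> r" "r \<le> ?b" for r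
  proof (cases "r \<le> m")
    case True
    then show ?thesis using r m by (intro lsol_antimono') (auto simp: unimodal_def)
  next
    case False
    have "lsol (3/25) r \<le> lsol (3/25) ?b"
      using lsol_strict_mono[of r ?b "3/25"] False r m by (cases "r = ?b") (auto simp: unimodal_def intro!: less_imp_le)
    moreover have "3/25 + (delay + 97/100) = ?b" "3/25 + 319/100 = ?z" by simp_all
    then have "lsol (3/25) ?b < lsol (3/25) ?z" using start_012(2) by (simp only:)
    ultimately show ?thesis by linarith
  qed
  \<comment> \<open>Since \<open>slope q\<close> is at most \<open>slope (3/25)\<close>, the
    solution started at q rises from 331/100 no more than the one started at 3/25, for which the
    comparison is numerical.\<close>
  have mid: "lsol q r \<le> lsol q ?z" if r: "?z \<le> r" "r \<le> ?b" for r
  proof -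
    have "lsol (3/25) ?z - lsol q ?z \<le> lsol (3/25) r - lsol q r"
      using r(1)
    proof (rule mono_on_of_deriv)
      fix u assume u: "?z < u" "u < r"
      have "slope q u \<le> slope (3/25) u"
        by - (rule slope_mono_start, (use u r q half_pi_bounds delay_enclosure in linarith)+)
      then show "\<exists>D. ((\<lambda>t. lsol (3/25) t - lsol q t) has_real_derivative D) (at u) \<and> 0 \<le> D"
        using DERIV_diff[OF DERIV_lsol DERIV_lsol] by (intro exI[of _ "slope (3/25) u - slope q u"]) auto
    qed (intro continuous_intros)
    then show ?thesis using ref[OF r] by simp
  qed
  have zdec: "lsol q ?z < lsol q t" if "t < ?z" for t
    using that neg qb by (intro lsol_strict_antimono') auto
  have sz: "s - delay < ?z" using s by simp
  have sb: "?b < s"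
  proof (rule ccontr)
    assume ns: "\<not> ?b < s"
    have "lsol q s < lsol q (s - delay)"
    proof (cases "s \<le> ?z")
      case True
      then show ?thesis using neg s half_pi_bounds qb by (intro lsol_strict_antimono') auto
    next
      case False
      then show ?thesis using mid[of s] zdec[OF sz] ns by simp
    qed
    then show False using s(3) by (simp add: gain_def)
  qed
  have sdec: "slope q (s - delay) \<le> 0"
    using neg[of "s - delay"] slope_init[of "s - delay" q] sz by (cases "q < s - delay") auto
  have spos: "0 < slope q s"
  proof (rule ccontr)
    assume ns: "\<not> 0 < slope q s"
    have "slope q t < 0" if "?b \<le> t" "t < s" for t
      using late[of t s] that ns by (cases "0 \<le> slope q t") auto
    then have "lsol q s < lsol q ?b" using sb by (intro lsol_strict_antimono) auto
    also have "\<dots> \<le> lsol q ?z" using delay_enclosure by (intro mid) auto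
    also have "\<dots> < lsol q (s - delay)" by (rule zdec[OF sz])
    finally show False using s(3) by (simp add: gain_def)
  qed
  have window: "lsol q r \<le> lsol q (t - delay)" if t: "q \<le> t" "t \<le> s" "t - delay \<le> r" "r \<le> t" for t r
  proof -
    have tz: "t - delay < ?z" using t sz by simp
    have tle: "lsol q t \<le> lsol q (t - delay)"
    proof -
      have "gain q t \<le> 0"
        using s(3) s(4)[of t] t lsol_init[of t q] lsol_init[of "t - delay" q]
        by (cases "t = s"; cases "t = q") (auto simp: gain_def)
      then show ?thesis by (simp add: gain_def)
    qed
    consider "r \<le> ?z" | "?z \<le> r" "r \<le> ?b" | "?b < r" by linarith
    then show ?thesis
    proof cases
      case 1
      then show ?thesis using t neg by (intro lsol_antimono') auto
    next
      case 2
      then show ?thesis using mid[of r] zdec[OF tz] by simp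
    next
      case 3
      show ?thesis
      proof (cases "0 \<le> slope q r")
        case True
        have "lsol q r \<le> lsol q t"
        proof (cases "r = t")
          case False
          have "lsol q r < lsol q t"
          proof (rule lsol_strict_mono)
            fix u assume "r < u" "u < t"
            then show "0 < slope q u" using late[of r u] True 3 t by simp
          qed (use False t in simp)
          then show ?thesis by simp
        qed simp
        then show ?thesis using tle by simp
      next
        case False
        have "slope q u \<le> 0" if "?b < u" "u < r" for u
          using late[of u r] that False t by (cases "0 \<le> slope q u") auto
        then have "lsol q r \<le> lsol q ?b" using 3 by (intro lsol_antimono) auto
        also have "\<dots> \<le> lsol q ?z" using delay_enclosure by (intro mid) auto
        finally show ?thesis using zdec[OF tz] by simp
      qed
    qed
  qed
  have "returns_at q s"
    unfolding returns_at_def using s window spos sdec delay_enclosure by auto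
  then show thesis by (rule that)
qed

theorem ex_returns_at:
  assumes q: "- (pi/2) \<le> q" "q < pi/2"
  obtains s where "returns_at q s" "3/25 \<le> q \<Longrightarrow> s < late_horizon"
proof -
  consider "q \<le> 0" | "0 \<le> q" "q \<le> 7/100" | "7/100 \<le> q" "q < 3/25" | "3/25 \<le> q" by linarith
  then show thesis
  proof cases
    case 1
    obtain m where m: "unimodal q m horizon" using unimodal_nonpos[of q] q 1 by blast
    have "pi/2 < horizon" using half_pi_bounds delay_enclosure by linarith
    then obtain s where "returns_at q s"
      using unimodal_returns[OF q m _ order_refl gain_horizon_pos[of q]] q by auto
    then show thesis using that 1 by simp
  next
    case 2
    then obtain m T where "unimodal q m T" "pi/2 < T" "T \<le> horizon" "0 < gain q T" using unimodal_small by blast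
    then obtain s where "returns_at q s" using unimodal_returns[OF q] by blast
    then show thesis using that 2 by simp
  next
    case 3
    then obtain s where "returns_at q s" using returns_between[of q] by auto
    then show thesis using that 3 by simp
  next
    case 4
    then obtain m where m: "unimodal q m late_horizon" "0 < gain q late_horizon" using unimodal_late q by blast
    have "pi/2 < late_horizon" using half_pi_bounds delay_enclosure by linarith
    then obtain s where "returns_at q s" "s < late_horizon"
      using unimodal_returns[OF q m(1) _ _ m(2)] late_horizon_less(2) by auto
    then show thesis using that by blast
  qed
qed

subsection \<open>The rising branch\<close>

text \<open>Once the solution is its own running maximum it satisfies \<open>u' = - 17/25 * u + 1 - sin t\<close>, so
  it is \<open>rise L\<close> for a constant \<open>L\<close>, and it meets the nullcline \<open>ftilde\<close> where
  \<open>bump = L\<close>. The constant determined by the value of \<open>lsol q\<close> at time \<open>t\<close> is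
  \<open>level q t\<close>.\<close>

definition bump :: "real \<Rightarrow> real" where
  "bump t = 15625/15538 * exp (17/25 * t) * (17/25 * cos t + sin t)"

definition level :: "real \<Rightarrow> real \<Rightarrow> real" where
  "level q t = bump t + exp (17/25 * t) * (ftilde t - lsol q t)"

definition rise :: "real \<Rightarrow> real \<Rightarrow> real" where
  "rise L t = ftilde t + exp (- (17/25) * t) * (bump t - L)"

lemma DERIV_exp_scaled: "((\<lambda>t. exp (c * t)) has_real_derivative exp (c * t) * c) (at t)" for c :: real
  by (auto intro!: derivative_eq_intros)

text \<open>The constant 15625/15538 is (25/17) / (1 + (17/25)^2), from the elementary
  antiderivative of an exponential times a cosine.\<close>

lemma DERIV_bump: "(bump has_real_derivative 25/17 * (exp (17/25 * t) * cos t)) (at t)"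
proof -
  have "((\<lambda>t. 17/25 * cos t + sin t) has_real_derivative - 17/25 * sin t + cos t) (at t)"
    by (auto intro!: derivative_eq_intros)
  from DERIV_cmult[OF DERIV_mult[OF DERIV_exp_scaled[of "17/25"] this], of "15625/15538"] show ?thesis
    unfolding bump_def [abs_def] mult.assoc by (rule DERIV_cong) (simp add: field_simps)
qed

lemma continuous_on_bump [continuous_intros]:
  fixes f :: "'a::t2_space \<Rightarrow> real"
  shows "continuous_on S f \<Longrightarrow> continuous_on S (\<lambda>x. bump (f x))"
  unfolding bump_def by (intro continuous_intros)

lemma continuous_on_level [continuous_intros]:
  fixes f g :: "'a::t2_space \<Rightarrow> real"
  shows "continuous_on S f \<Longrightarrow> continuous_on S g \<Longrightarrow> continuous_on S (\<lambda>x. level (f x) (g x))"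
  unfolding level_def by (intro continuous_intros)

text \<open>\<open>level q t\<close> labels the rising branch through the point of
  \<open>lsol q\<close> at time t. The linear delay equation and the equation of the rising branch
  differ by the gain alone, so the label moves against the sign of the gain and is largest where the
  gain crosses zero upwards.\<close>

lemma DERIV_level:
  assumes "q \<le> t" "t \<le> q + 3 * delay"
  shows "(level q has_real_derivative - (exp (17/25 * t) * gain q t)) (at t)"
proof -
  have 1: "((\<lambda>t. ftilde t - lsol q t) has_real_derivative - 25/17 * cos t - slope q t) (at t)"
    by (intro DERIV_diff DERIV_ftilde DERIV_lsol)
  have g: "gain q t = slope q t - 17/25 * (ftilde t - lsol q t)" using slope_gain[OF assms] by simp
  show ?thesis
    unfolding level_def [abs_def]
    by (intro DERIV_cong[OF DERIV_add[OF DERIV_bump DERIV_mult[OF DERIV_exp_scaled[of "17/25"] 1]]]) (simp add: g field_simps)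
qed

lemma DERIV_level_start:
  "((\<lambda>q. level q t) has_real_derivative 25/17 * exp (17/25 * t) * kern (t - q) * cos q) (at q)"
  unfolding level_def
  by (intro DERIV_cong[OF DERIV_add[OF DERIV_const DERIV_cmult[OF DERIV_diff[OF DERIV_const DERIV_lsol_start[of t q]]]]])
    (simp add: field_simps)

lemma DERIV_rise: "(rise L has_real_derivative 17/25 * (exp (- (17/25) * t) * (L - bump t))) (at t)"
proof -
  have e: "exp (- (17/25) * t) * exp (17/25 * t) = 1" by (simp flip: exp_add)
  have "(rise L has_real_derivative - 25/17 * cos t + (exp (- (17/25) * t) * (- (17/25)) * (bump t - L)
      + (25/17 * (exp (17/25 * t) * cos t) - 0) * exp (- (17/25) * t))) (at t)"
    unfolding rise_def [abs_def]
    by (intro DERIV_add DERIV_ftilde DERIV_mult DERIV_exp_scaled DERIV_diff DERIV_bump DERIV_const)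
  moreover have "(25/17 * (exp (17/25 * t) * cos t) - 0) * exp (- (17/25) * t) = 25/17 * cos t * (exp (- (17/25) * t) * exp (17/25 * t))"
    by (simp only: ac_simps diff_zero)
  then have "(25/17 * (exp (17/25 * t) * cos t) - 0) * exp (- (17/25) * t) = 25/17 * cos t"
    by (simp only: e mult_1_right)
  ultimately show ?thesis
    by (elim DERIV_cong) (simp only:, simp add: field_simps)
qed

lemma continuous_on_rise [continuous_intros]: "continuous_on S (rise L)"
  using DERIV_rise by (blast intro: DERIV_isCont continuous_at_imp_continuous_on)

lemma rise_level: "rise (level q t) t = lsol q t"
proof -
  have e: "exp (- (17/25) * t) * exp (17/25 * t) = 1" by (simp flip: exp_add)
  have "exp (- (17/25) * t) * (bump t - level q t) = - (exp (- (17/25) * t) * exp (17/25 * t) * (ftilde t - lsol q t))"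
    by (simp add: level_def algebra_simps)
  then show ?thesis unfolding rise_def e by simp
qed

lemma level_minus_bump: "level q t - bump t = exp (17/25 * t) * (ftilde t - lsol q t)"
  by (simp add: level_def)

lemma deriv_within_union:
  fixes f :: "real \<Rightarrow> real"
  assumes "(f has_real_derivative D) (at x within S)" "(f has_real_derivative D) (at x within T)"
  shows "(f has_real_derivative D) (at x within S \<union> T)"
  using assms unfolding has_field_derivative_iff by (intro Lim_within_Un[THEN iffD2]) auto

text \<open>The time at which the solution started at \<open>q\<close> becomes its own running maximum; for
  \<open>q = pi/2\<close> this happens at once.\<close>

definition hit :: "real \<Rightarrow> real" where
  "hit q = (if q < pi/2 then SOME s. returns_at q s else pi/2)"

lemma returns_at_unique: "returns_at q s \<Longrightarrow> returns_at q s' \<Longrightarrow> q < pi/2 \<Longrightarrow> s = s'"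
  unfolding returns_at_def by (metis less_irrefl less_linear less_trans)

lemma returns_at_hit:
  assumes "- (pi/2) \<le> q" "q < pi/2"
  shows "returns_at q (hit q)"
  using ex_returns_at[OF assms] someI_ex[of "returns_at q"] assms unfolding hit_def by auto

lemma hit_eqI: "returns_at q s \<Longrightarrow> - (pi/2) \<le> q \<Longrightarrow> q < pi/2 \<Longrightarrow> hit q = s"
  using returns_at_unique returns_at_hit by blast

lemma hit_half_pi [simp]: "hit (pi/2) = pi/2"
  by (simp add: hit_def)

lemma hit_less_late:
  assumes "3/25 \<le> q" "q \<le> pi/2"
  shows "hit q < late_horizon"
proof (cases "q < pi/2")
  case True
  then obtain s where "returns_at q s" "s < late_horizon" using ex_returns_at[of q] assms half_pi_bounds by auto
  then show ?thesis using hit_eqI[of q s] True assms half_pi_bounds by auto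
next
  case False
  then show ?thesis using assms half_pi_bounds delay_enclosure by (simp add: hit_def)
qed

lemma hit_bounds:
  assumes "- (pi/2) \<le> q" "q \<le> pi/2"
  shows "pi/2 \<le> hit q" "q \<le> hit q" "hit q < horizon"
  using returns_at_hit[of q] assms half_pi_bounds delay_enclosure
  by (cases "q < pi/2"; force simp: returns_at_def hit_def)+

lemma gain_hit:
  assumes "- (pi/2) \<le> q" "q \<le> pi/2"
  shows "gain q (hit q) = 0"
proof (cases "q < pi/2")
  case True
  then show ?thesis using returns_at_hit[of q] assms by (auto simp: returns_at_def)
next
  case False
  then have "q = pi/2" using assms by simp
  then show ?thesis by (simp only: hit_half_pi) (simp add: gain_def lsol_init)
qed

lemma gain_before_hit:
  assumes "- (pi/2) \<le> q" "q \<le> pi/2" "q < t" "t < hit q"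
  shows "gain q t < 0"
  using returns_at_hit[of q] assms by (cases "q < pi/2") (auto simp: returns_at_def hit_def)

lemma lsol_window:
  assumes "- (pi/2) \<le> q" "q \<le> pi/2" "q \<le> t" "t \<le> hit q" "t - delay \<le> r" "r \<le> t"
  shows "lsol q r \<le> lsol q (t - delay)"
proof (cases "q < pi/2")
  case True
  then show ?thesis using returns_at_hit[of q] assms by (auto simp: returns_at_def)
next
  case False
  then show ?thesis using assms by (simp add: hit_def lsol_init)
qed

definition threshold :: "real \<Rightarrow> real" where
  "threshold q = level q (hit q)"

text \<open>With zero gain, \<open>slope_gain\<close> reads slope = 17/25 * (nullcline - solution),
  so the positive slope at the hit gives the strict inequality.\<close>

lemma bump_hit_less:
  assumes "- (pi/2) \<le> q" "q < pi/2"
  shows "bump (hit q) < threshold q"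
proof -
  note h = hit_bounds[of q] returns_at_hit[OF assms, unfolded returns_at_def]
  have "hit q \<le> q + 3 * delay" using h assms half_pi_bounds delay_enclosure by linarith
  then have "0 < 17/25 * (ftilde (hit q) - lsol q (hit q))"
    using slope_gain[of q "hit q"] gain_hit[of q] h assms by simp
  then have "0 < exp (17/25 * hit q) * (ftilde (hit q) - lsol q (hit q))" by simp
  then show ?thesis unfolding threshold_def using level_minus_bump[of q "hit q"] by linarith
qed

lemma threshold_half_pi: "threshold (pi/2) = bump (pi/2)"
  by (simp add: threshold_def level_def lsol_init)

text \<open>One exceptional time is allowed because a threshold can equal a crest of
  \<open>bump\<close>: the solution then touches the nullcline with zero slope and nevertheless goes
  on rising.\<close>

lemma rise_strict_mono:
  assumes b: "\<And>t. a < t \<Longrightarrow> t < b \<Longrightarrow> t \<noteq> t0 \<Longrightarrow> bump t < L" and ab: "a < b"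
  shows "rise L a < rise L b"
proof -
  have *: "rise L c < rise L d" if "a \<le> c" "c < d" "d \<le> b" "t0 \<notin> {c<..<d}" for c d
    using that(2)
  proof (rule strict_mono_of_deriv)
    fix t assume "c < t" "t < d"
    then have "0 < 17/25 * (exp (- (17/25) * t) * (L - bump t))" using b[of t] that by auto
    then show "\<exists>D. (rise L has_real_derivative D) (at t) \<and> 0 < D" using DERIV_rise by blast
  qed (intro continuous_intros)
  show ?thesis
  proof (cases "a < t0 \<and> t0 < b")
    case True
    then show ?thesis using *[of a t0] *[of t0 b] by simp
  next
    case False
    then show ?thesis using *[of a b] ab by auto
  qed
qed

text \<open>After the hitting time the running maximum is attained at the right end of the window, so
  the solution follows \<^term>\<open>rise\<close> until it meets the nullcline \<^term>\<open>ftilde\<close>.\<close>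

locale return_path =
  fixes q n t0 :: real
  assumes q: "- (pi/2) \<le> q" "q \<le> pi/2"
    and n: "hit q < n" "bump n = threshold q"
    and below: "\<And>t. hit q < t \<Longrightarrow> t < n \<Longrightarrow> t \<noteq> t0 \<Longrightarrow> bump t < threshold q"
    and cos_pos: "\<exists>e>0. \<forall>t. n < t \<and> t \<le> n + e \<longrightarrow> 0 < cos t"
begin

definition path :: "real \<Rightarrow> real" where
  "path t = (if t \<le> hit q then lsol q t else rise (threshold q) t)"

lemma rise_hit: "rise (threshold q) (hit q) = lsol q (hit q)"
  unfolding threshold_def by (rule rise_level)

lemma path_late: "hit q \<le> t \<Longrightarrow> path t = rise (threshold q) t"
  using rise_hit by (auto simp: path_def)

lemma path_strict_mono: "hit q \<le> a \<Longrightarrow> a < b \<Longrightarrow> b \<le> n \<Longrightarrow> path a < path b"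
  using rise_strict_mono[of a b t0 "threshold q"] below by (simp add: path_late)

lemma path_mono: "hit q \<le> a \<Longrightarrow> a \<le> b \<Longrightarrow> b \<le> n \<Longrightarrow> path a \<le> path b"
  using path_strict_mono[of a b] by (cases "a = b") auto

text \<open>Values before the hit that are still in the window are bounded by the value at
  \<open>hit q - delay\<close>, which equals the value at the hit because the gain vanishes
  there.\<close>

lemma path_window_late:
  assumes t: "hit q \<le> t" "t \<le> n" and r: "t - delay \<le> r" "r \<le> t"
  shows "path r \<le> path t"
proof (cases "hit q \<le> r")
  case False
  have "lsol q r \<le> lsol q (hit q - delay)"
    using False t r hit_bounds[OF q] q by (intro lsol_window) auto
  also have "\<dots> = path (hit q)" using gain_hit[OF q] by (simp add: gain_def path_def)
  also have "\<dots> \<le> path t" using t by (intro path_mono) auto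
  finally show ?thesis using False by (simp add: path_def)
qed (use t r in \<open>auto intro: path_mono\<close>)

lemma continuous_path: "continuous_on S path"
proof -
  have "continuous_on ({..hit q} \<union> {hit q..}) path"
    unfolding path_def
    by (rule continuous_on_If) (auto intro!: continuous_intros simp: rise_hit)
  moreover have "{..hit q} \<union> {hit q..} = UNIV" by auto
  ultimately show ?thesis by (metis continuous_on_subset subset_UNIV)
qed

lemma path_early_deriv:
  assumes t: "q \<le> t" "t \<le> hit q"
  shows "(path has_real_derivative rhs path t) (at t within {q..hit q})"
proof -
  have "window_max path t = path (t - delay)"
  proof (rule window_max_eqI)
    fix r assume "r \<in> {t - delay..t}"
    then show "path r \<le> path (t - delay)"
      using lsol_window[OF q t, of r] t by (simp add: path_def)
  qed auto
  moreover have "t \<le> q + 3 * delay" using t hit_bounds[OF q] q half_pi_bounds delay_enclosure by linarith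
  ultimately have "rhs path t = slope q t"
    using slope_eq[of q t] t by (simp add: rhs_def path_def)
  then have "(lsol q has_real_derivative rhs path t) (at t within {q..hit q})"
    using DERIV_lsol by (simp add: has_field_derivative_at_within)
  then show ?thesis
    by (rule has_field_derivative_transform_within[of _ _ _ _ 1]) (use t in \<open>auto simp: path_def\<close>)
qed

lemma path_late_deriv:
  assumes t: "hit q \<le> t" "t \<le> n"
  shows "(path has_real_derivative rhs path t) (at t within {hit q..n})"
proof -
  have "window_max path t = path t"
    by (rule window_max_eqI) (use path_window_late t in auto)
  then have r: "rhs path t = 17/25 * (exp (- (17/25) * t) * (threshold q - bump t))"
    using t by (simp add: rhs_def path_late rise_def ftilde_alt field_simps)
  have "(rise (threshold q) has_real_derivative rhs path t) (at t within {hit q..n})"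
    unfolding r by (rule has_field_derivative_at_within[OF DERIV_rise])
  then show ?thesis
    by (rule has_field_derivative_transform_within[of _ _ _ _ 1]) (use t in \<open>auto simp: path_late\<close>)
qed

lemma path_deriv:
  assumes "t \<in> {q..n}"
  shows "(path has_real_derivative rhs path t) (at t within {q..n})"
proof -
  have u: "{q..n} = {q..hit q} \<union> {hit q..n}" using hit_bounds[OF q] n by auto
  \<comment> \<open>The within-filter of a closed set is trivial at points outside it, so each half
    of the union is differentiable there vacuously.\<close>
  have out: "(path has_real_derivative D) (at t within S)" if "closed S" "t \<notin> S" for D S
  proof -
    have "at t within S = bot" using that by (simp add: at_within_eq_bot_iff)
    then show ?thesis by (simp add: has_field_derivative_iff)
  qed
  show ?thesis unfolding u
  proof (rule deriv_within_union)
    show "(path has_real_derivative rhs path t) (at t within {q..hit q})"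
      using path_early_deriv[of t] out[of "{q..hit q}"] assms by (cases "t \<le> hit q") auto
    show "(path has_real_derivative rhs path t) (at t within {hit q..n})"
      using path_late_deriv[of t] out[of "{hit q..n}"] assms by (cases "hit q \<le> t") auto
  qed
qed

lemma start_time: "start_time (ftilde q) = q"
  by (rule start_time_ftilde) (use q in auto)

lemma sol_path: "t \<in> {q - delay..n} \<Longrightarrow> sol (ftilde q) t = path t"
  by (rule sol_eq[OF start_time continuous_path path_deriv])
    (use hit_bounds[OF q] in \<open>auto simp: path_def lsol_init\<close>)

lemma path_n: "path n = ftilde n"
  using n by (simp add: path_late rise_def)

abbreviation u where "u \<equiv> sol (ftilde q)"

lemma continuous_u: "S \<subseteq> {q - delay..} \<Longrightarrow> continuous_on S u"
  using is_solution_continuous_on[OF is_solution_sol, of "ftilde q"] start_time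
  by (auto intro: continuous_on_subset)

text \<open>Just after n the nullcline falls. A later maximum above \<open>u n\<close> would lie
  above the nullcline, where the derivative is negative because the window maximum is at least the
  current value; then the solution was higher shortly before.\<close>

lemma u_after:
  obtains e where "e > 0" "\<And>t. n \<le> t \<Longrightarrow> t \<le> n + e \<Longrightarrow> u t \<le> u n"
proof -
  obtain e where e: "e > 0" "\<And>t. n < t \<Longrightarrow> t \<le> n + e \<Longrightarrow> 0 < cos t" using cos_pos by auto
  have qn: "q < n" using hit_bounds[OF q] n by simp
  have un: "u n = ftilde n" using sol_path[of n] path_n qn delay_pos by simp
  have "q - delay \<le> n" using qn delay_pos by linarith
  then have "continuous_on {n..n + e} u" by (intro continuous_u) auto
  then obtain m where m: "n \<le> m" "m \<le> n + e" "\<And>t. n \<le> t \<Longrightarrow> t \<le> n + e \<Longrightarrow> u t \<le> u m"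
    using continuous_attains_sup[of "{n..n+e}" u] e(1) by auto
  have "u m \<le> u n"
  proof (rule ccontr)
    assume gt: "\<not> u m \<le> u n"
    then have nm: "n < m" using m by (cases "n = m") auto
    have "- ftilde n < - ftilde m"
      using nm
    proof (rule strict_mono_of_deriv)
      fix t assume "n < t" "t < m"
      then have "0 < cos t" using e(2)[of t] m by simp
      then show "\<exists>D. ((\<lambda>t. - ftilde t) has_real_derivative D) (at t) \<and> 0 < D"
        using DERIV_minus[OF DERIV_ftilde[of t]] by (intro exI[of _ "- (- 25/17 * cos t)"] conjI) auto
    qed (intro continuous_intros)
    then have "ftilde m < u m" using un gt by simp
    moreover have "u m \<le> window_max u m"
      using nm qn delay_pos by (intro window_max_upper continuous_u) auto
    ultimately have neg: "rhs u m < 0" unfolding rhs_def ftilde_alt by simp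
    have "(u has_real_derivative rhs u m) (at m within {q..})"
      using is_solution_sol[of "ftilde q"] nm qn unfolding is_solution_iff start_time by auto
    from has_real_derivative_neg_dec_left[OF this neg] obtain d where
      d: "d > 0" "\<And>h. h > 0 \<Longrightarrow> m - h \<in> {q..} \<Longrightarrow> h < d \<Longrightarrow> u m < u (m - h)" by blast
    define h where "h = min (d/2) (m - n)"
    have h: "0 < h" "h < d" "h \<le> m - n" using d(1) nm by (auto simp: h_def min_def)
    then have "u m < u (m - h)" using qn by (intro d(2)) auto
    moreover have "u (m - h) \<le> u m" using h m by (intro m(3)) auto
    ultimately show False by simp
  qed
  then show thesis using that[OF e(1)] m(3) by (meson order_trans)
qed

lemma Sup_window_le:
  assumes "\<And>r. r \<in> {a..b} \<Longrightarrow> u r \<le> M" "a \<le> b"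
  shows "(SUP r\<in>{a..b}. u r) \<le> M"
  using assms by (intro cSUP_least) auto

lemma Sup_window_ge:
  assumes "q - delay \<le> a" "r \<in> {a..b}"
  shows "u r \<le> (SUP r\<in>{a..b}. u r)"
proof (rule cSUP_upper[OF assms(2)])
  have "continuous_on {a..b} u" using assms by (intro continuous_u) auto
  then show "bdd_above (u ` {a..b})"
    by (intro bounded_imp_bdd_above compact_imp_bounded compact_continuous_image compact_Icc)
qed

text \<open>No earlier time qualifies: before the hit the left end of the window is strictly higher,
  and between the hit and n the path is still strictly larger a little to the right.\<close>

lemma return_time_eq: "return_time (ftilde q) = n"
  unfolding return_time_def start_time
proof (rule Least_equality)
  have qn: "q < n" using hit_bounds[OF q] n by simp
  obtain e where e: "e > 0" "\<And>t. n \<le> t \<Longrightarrow> t \<le> n + e \<Longrightarrow> u t \<le> u n"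
    using u_after by metis
  have "(SUP r\<in>{n - delay..n + e}. u r) \<le> u n"
  proof (rule Sup_window_le)
    fix r assume r: "r \<in> {n - delay..n + e}"
    show "u r \<le> u n"
    proof (cases "n \<le> r")
      case False
      then have "path r \<le> path n" using r n by (intro path_window_late) auto
      then show ?thesis using sol_path[of r] sol_path[of n] r False qn delay_pos by simp
    qed (use e r in auto)
  qed (use e delay_nonneg in linarith)
  moreover have "u n \<le> (SUP r\<in>{n - delay..n + e}. u r)"
    using qn e by (intro Sup_window_ge) auto
  ultimately show "q < n \<and> (\<exists>\<epsilon>>0. u n = (SUP r\<in>{n - 3 * pi / 2..n + \<epsilon>}. u r))"
    using qn e(1) unfolding delay_def by (intro conjI exI[of _ e]) auto
next
  fix y assume y: "q < y \<and> (\<exists>\<epsilon>>0. u y = (SUP r\<in>{y - 3 * pi / 2..y + \<epsilon>}. u r))"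
  then obtain e where e: "e > 0" "u y = (SUP r\<in>{y - delay..y + e}. u r)" unfolding delay_def by auto
  show "n \<le> y"
  proof (rule ccontr)
    assume "\<not> n \<le> y"
    then have yn: "y < n" by simp
    have sup: "u r \<le> u y" if "r \<in> {y - delay..y + e}" for r
      unfolding e(2) using that y by (intro Sup_window_ge) auto
    show False
    proof (cases "y < hit q")
      case True
      have "u (y - delay) \<le> u y" using e(1) delay_nonneg by (intro sup) (simp only: atLeastAtMost_iff, linarith)
      moreover have "lsol q y < lsol q (y - delay)"
        using gain_before_hit[OF q _ True] y by (simp add: gain_def)
      moreover have "y - delay \<le> hit q" using True delay_pos by linarith
      ultimately show False
        using sol_path[of y] sol_path[of "y - delay"] True y yn delay_pos by (simp add: path_def)
    next
      case False
      define z where "z = min (y + e) n"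
      have z: "y < z" "z \<le> n" "z \<le> y + e" using e yn by (auto simp: z_def)
      have "path y < path z" using False z by (intro path_strict_mono) auto
      moreover have "u z \<le> u y" using z delay_pos by (intro sup) (auto intro: order_trans[of _ y])
      ultimately show False using sol_path[of y] sol_path[of z] z y yn delay_pos by auto
    qed
  qed
qed

lemma return_map_eq: "return_map (ftilde q) = ftilde n"
  unfolding return_map_def return_time_eq
  using sol_path[of n] path_n hit_bounds[OF q] n delay_pos by simp

end

subsection \<open>The return map as a function of the threshold\<close>

definition growth :: real where
  "growth = exp (34/25 * pi)"

definition crest :: "nat \<Rightarrow> real" where
  "crest k = bump (pi/2 + 2 * pi * real k)"

lemma growth_gt_1: "1 < growth"
  by (simp add: growth_def)

lemma sin_cos_period: "cos (t + 2 * pi * real k) = cos t" "sin (t + 2 * pi * real k) = sin t"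
proof -
  have "2 * pi * real k = 2 * real k * pi" by simp
  then show "cos (t + 2 * pi * real k) = cos t" "sin (t + 2 * pi * real k) = sin t"
    unfolding cos_add sin_add by (simp_all only: cos_2npi sin_2npi mult_1_right mult_zero_right diff_zero add_0_right)
qed

lemma bump_shift: "bump (t + 2 * pi * real k) = growth ^ k * bump t"
proof -
  have "exp (17/25 * (t + 2 * pi * real k)) = growth ^ k * exp (17/25 * t)"
    by (simp add: growth_def algebra_simps flip: exp_of_nat_mult exp_add)
  then show ?thesis by (simp add: bump_def sin_cos_period)
qed

lemma crest_eq: "crest k = growth ^ k * crest 0"
  unfolding crest_def by (simp add: bump_shift)

lemma crest_pos: "0 < crest k"
  using growth_gt_1 by (subst crest_eq) (simp add: crest_def bump_def)

lemma crest_Suc: "crest (Suc k) = growth * crest k"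
  by (subst (1 2) crest_eq) simp

lemma crest_less_Suc: "crest k < crest (Suc k)"
  using crest_pos[of k] growth_gt_1 by (simp add: crest_Suc)

lemma bump_strict_mono:
  assumes "- (pi/2) \<le> a" "a < b" "b \<le> pi/2"
  shows "bump a < bump b"
  using assms(2)
proof (rule strict_mono_of_deriv)
  fix t assume "a < t" "t < b"
  then have "0 < 25/17 * (exp (17/25 * t) * cos t)" using assms cos_gt_zero_pi[of t] by simp
  then show "\<exists>D. (bump has_real_derivative D) (at t) \<and> 0 < D" using DERIV_bump by blast
qed (intro continuous_intros)

lemma bump_strict_antimono:
  assumes "pi/2 \<le> a" "a < b" "b \<le> 3 * pi / 2"
  shows "bump b < bump a"
proof -
  have "- bump a < - bump b"
    using assms(2)
  proof (rule strict_mono_of_deriv)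
    fix t assume "a < t" "t < b"
    then have "cos t < 0" using assms by (intro cos_neg_delay) (auto simp: delay_def)
    then have "0 < - (25/17 * (exp (17/25 * t) * cos t))" by (simp add: mult_pos_neg)
    then show "\<exists>D. ((\<lambda>t. - bump t) has_real_derivative D) (at t) \<and> 0 < D" using DERIV_minus[OF DERIV_bump[of t]] by blast
  qed (intro continuous_intros)
  then show ?thesis by simp
qed

lemma bump_strict_mono':
  assumes "3 * pi / 2 + 2 * pi * real k \<le> a" "a < b" "b \<le> 5 * pi / 2 + 2 * pi * real k"
  shows "bump a < bump b"
proof -
  have "bump (a - 2 * pi * real (Suc k)) < bump (b - 2 * pi * real (Suc k))"
    using assms by (intro bump_strict_mono) (auto simp: algebra_simps)
  then show ?thesis
    using bump_shift[of "a - 2 * pi * real (Suc k)" "Suc k"] bump_shift[of "b - 2 * pi * real (Suc k)" "Suc k"] growth_gt_1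
    by simp
qed

text \<open>Successive crests grow by the factor \<open>growth\<close>, so crest k dominates
  everything up to the valley that follows it, earlier crests included.\<close>

lemma bump_less_crest:
  assumes "- (pi/2) < t" "t \<le> 3 * pi / 2 + 2 * pi * real k" "t \<noteq> pi/2 + 2 * pi * real k"
  shows "bump t < crest k"
  using assms
proof (induction k arbitrary: t)
  have base: "bump t < crest 0" if t: "- (pi/2) \<le> t" "t \<le> 3 * pi / 2" "t \<noteq> pi/2" for t
    using t bump_strict_mono[of t "pi/2"] bump_strict_antimono[of "pi/2" t]
    by (cases "t < pi/2") (auto simp: crest_def)
  case 0
  then show ?case using base[of t] by simp
next
  have base: "bump t < crest 0" if t: "- (pi/2) \<le> t" "t \<le> 3 * pi / 2" "t \<noteq> pi/2" for t
    using t bump_strict_mono[of t "pi/2"] bump_strict_antimono[of "pi/2" t]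
    by (cases "t < pi/2") (auto simp: crest_def)
  case (Suc k)
  show ?case
  proof (cases "t \<le> 3 * pi / 2 + 2 * pi * real k")
    case True
    then have "bump t \<le> crest k"
      using Suc.IH[of t] Suc.prems by (cases "t = pi/2 + 2 * pi * real k") (auto simp: crest_def)
    then show ?thesis using crest_less_Suc[of k] by simp
  next
    case False
    have "bump (t - 2 * pi * real (Suc k)) < crest 0"
      using False Suc.prems by (intro base) (auto simp: algebra_simps)
    then have "growth ^ Suc k * bump (t - 2 * pi * real (Suc k)) < growth ^ Suc k * crest 0"
      using growth_gt_1 by (intro mult_strict_left_mono zero_less_power) auto
    then show ?thesis
      using bump_shift[of "t - 2 * pi * real (Suc k)" "Suc k"] crest_eq[of "Suc k"] by simp
  qed
qed

lemma crest_1: "crest 1 = bump (5 * pi / 2)"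
  by (simp add: crest_def)

section \<open>Inverting the bump on its rising branch before crest 1\<close>

definition landing :: "real \<Rightarrow> real" where
  "landing z = (THE n. n \<in> {3 * pi / 2..5 * pi / 2} \<and> bump n = z)"

lemma landing_eqI: "3 * pi / 2 \<le> n \<Longrightarrow> n \<le> 5 * pi / 2 \<Longrightarrow> landing (bump n) = n"
  unfolding landing_def
  using bump_strict_mono'[of 0] by (intro the_equality) (auto, metis less_irrefl less_linear)

lemma landing:
  assumes "bump (3 * pi / 2) \<le> z" "z \<le> crest 1"
  shows "3 * pi / 2 \<le> landing z" "landing z \<le> 5 * pi / 2" "bump (landing z) = z"
proof -
  obtain n where n: "3 * pi / 2 \<le> n" "n \<le> 5 * pi / 2" "bump n = z"
  proof -
    have "continuous_on {3 * pi / 2..5 * pi / 2} bump" by (intro continuous_intros)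
    then show thesis
      using IVT'[of bump "3 * pi / 2" z "5 * pi / 2"] assms crest_1 pi_gt_zero that by fastforce
  qed
  then show "3 * pi / 2 \<le> landing z" "landing z \<le> 5 * pi / 2" "bump (landing z) = z"
    using landing_eqI[of n] by auto
qed

lemma landing_interior:
  assumes "bump (3 * pi / 2) < z" "z < crest 1"
  shows "3 * pi / 2 < landing z" "landing z < 5 * pi / 2"
proof -
  have "landing z \<noteq> 3 * pi / 2" "landing z \<noteq> 5 * pi / 2"
    using landing(3)[of z] assms crest_1 by (metis less_imp_le less_irrefl)+
  then show "3 * pi / 2 < landing z" "landing z < 5 * pi / 2" using landing(1,2)[of z] assms by linarith+
qed

lemma continuous_on_landing: "continuous_on {bump (3 * pi / 2)..crest 1} landing"
proof -
  have "bump ` {3 * pi / 2..5 * pi / 2} = {bump (3 * pi / 2)..crest 1}"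
  proof (intro equalityI subsetI)
    fix z assume "z \<in> bump ` {3 * pi / 2..5 * pi / 2}"
    then obtain n where n: "3 * pi / 2 \<le> n" "n \<le> 5 * pi / 2" "z = bump n" by auto
    have "bump (3 * pi / 2) \<le> bump n"
      using bump_strict_mono'[of 0 "3 * pi / 2" n] n by (cases "3 * pi / 2 < n") (simp, metis order_antisym not_less order_refl)
    moreover have "bump n \<le> bump (5 * pi / 2)"
      using bump_strict_mono'[of 0 n "5 * pi / 2"] n by (cases "n < 5 * pi / 2") (simp, metis order_antisym not_less order_refl)
    ultimately show "z \<in> {bump (3 * pi / 2)..crest 1}" unfolding crest_1 using n by simp
  next
    fix z assume "z \<in> {bump (3 * pi / 2)..crest 1}"
    then show "z \<in> bump ` {3 * pi / 2..5 * pi / 2}"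
      using landing[of z] by (auto simp: image_iff intro!: bexI[of _ "landing z"])
  qed
  moreover have "continuous_on (bump ` {3 * pi / 2..5 * pi / 2}) landing"
    by (rule continuous_on_inv) (auto intro!: continuous_intros landing_eqI)
  ultimately show ?thesis by simp
qed

lemma DERIV_landing:
  assumes "bump (3 * pi / 2) < z" "z < crest 1"
  shows "(landing has_real_derivative inverse (25/17 * (exp (17/25 * landing z) * cos (landing z)))) (at z)"
proof (rule DERIV_inverse_function[OF DERIV_bump _ assms])
  have "0 < cos (landing z - 2 * pi)"
    using landing_interior[OF assms] by (intro cos_gt_zero_pi) auto
  then show "25/17 * (exp (17/25 * landing z) * cos (landing z)) \<noteq> 0" by (simp add: cos_diff)
  show "bump (landing y) = y" if "bump (3 * pi / 2) < y" "y < crest 1" for y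
    using landing[of y] that by simp
  show "isCont landing z"
    using continuous_on_interior[OF continuous_on_landing, of z] assms by simp
qed

definition ret_val :: "real \<Rightarrow> real" where
  "ret_val z = ftilde (landing z)"

text \<open>The cosines from \<open>ftilde\<close> and from the inverse of \<open>bump\<close>
  cancel. Hence the formula has a finite limit at \<open>crest 1\<close>, although
  \<open>landing\<close> becomes vertical there; this supplies the one-sided derivatives at the
  first jump.\<close>

lemma DERIV_ret_val:
  assumes "bump (3 * pi / 2) < z" "z < crest 1"
  shows "(ret_val has_real_derivative - exp (- (17/25) * landing z)) (at z)"
proof -
  have c: "0 < cos (landing z)"
    using cos_gt_zero_pi[of "landing z - 2 * pi"] landing_interior[OF assms] by (simp add: cos_diff)
  have e: "exp (- (17/25) * landing z) = inverse (exp (17/25 * landing z))" by (simp add: exp_minus)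
  show ?thesis
    unfolding ret_val_def [abs_def]
    by (rule DERIV_cong[OF DERIV_chain2[OF DERIV_ftilde DERIV_landing[OF assms]]])
      (use c in \<open>simp only: e, simp add: divide_simps\<close>)
qed

lemma continuous_on_ret_val: "continuous_on {bump (3 * pi / 2)..crest 1} ret_val"
  unfolding ret_val_def by (intro continuous_intros continuous_on_landing)

lemma ret_val_crest_1: "ret_val (crest 1) = 0"
proof -
  have "landing (crest 1) = 5 * pi / 2" unfolding crest_1 by (rule landing_eqI) auto
  moreover have "sin (5 * pi / 2) = 1" using sin_add[of "pi/2" "2 * pi"] by simp
  ultimately show ?thesis unfolding ret_val_def ftilde_def by (simp only:) simp
qed

lemma ret_val_strict_antimono:
  assumes "bump (3 * pi / 2) \<le> z" "z < z'" "z' \<le> crest 1"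
  shows "ret_val z' < ret_val z"
proof -
  have "- ret_val z < - ret_val z'"
    using assms(2)
  proof (rule strict_mono_of_deriv)
    fix x assume "z < x" "x < z'"
    then show "\<exists>D. ((\<lambda>z. - ret_val z) has_real_derivative D) (at x) \<and> 0 < D"
      using DERIV_minus[OF DERIV_ret_val[of x]] assms by (intro exI[of _ "exp (- (17/25) * landing x)"]) auto
  qed (intro continuous_intros continuous_on_subset[OF continuous_on_ret_val], use assms in auto)
  then show ?thesis by simp
qed

lemma bump_three_half_neg: "bump (3 * pi / 2) < 0"
  using sin_3over2_pi cos_3over2_pi by (simp add: bump_def mult.commute)

lemma ret_val_eqI:
  assumes "- (pi/2) \<le> r" "r \<le> pi/2"
  shows "ret_val (bump (r + 2 * pi)) = ftilde r"
proof -
  have "landing (bump (r + 2 * pi)) = r + 2 * pi" using assms by (intro landing_eqI) auto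
  then show ?thesis by (simp add: ret_val_def ftilde_def)
qed

lemma cos_pos_right:
  assumes "3 * pi / 2 \<le> n" "n < 5 * pi / 2"
  shows "\<exists>e>0. \<forall>t. n + 2 * pi * real k < t \<and> t \<le> n + 2 * pi * real k + e \<longrightarrow> 0 < cos t"
proof (intro exI conjI allI impI)
  show "0 < (5 * pi / 2 - n) / 2" using assms by simp
  fix t assume t: "n + 2 * pi * real k < t \<and> t \<le> n + 2 * pi * real k + (5 * pi / 2 - n) / 2"
  have "0 < cos (t - 2 * pi * real (Suc k))"
  proof (rule cos_gt_zero_pi)
    show "- (pi/2) < t - 2 * pi * real (Suc k)" using t assms by (simp add: algebra_simps)
    have "(5 * pi / 2 - n) / 2 < 5 * pi / 2 - n" using assms by simp
    then have "t < 5 * pi / 2 + 2 * pi * real k" using t by linarith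
    then show "t - 2 * pi * real (Suc k) < pi/2" by (simp add: algebra_simps)
  qed
  moreover have "cos (t - 2 * pi * real (Suc k)) = cos t"
    using sin_cos_period(1)[of "t - 2 * pi * real (Suc k)" "Suc k"] by simp
  ultimately show "0 < cos t" by simp
qed

lemma bump_hit_le:
  assumes "- (pi/2) \<le> q" "q \<le> pi/2"
  shows "bump (hit q) \<le> threshold q"
proof (cases "q < pi/2")
  case False
  then have "q = pi/2" using assms by simp
  then show ?thesis by (simp only: hit_half_pi threshold_half_pi)
qed (use bump_hit_less[of q] assms in simp)

section \<open>The return map for thresholds between consecutive crests\<close>

lemma return_map_first:
  assumes q: "- (pi/2) \<le> q" "q \<le> pi/2" and h: "hit q < 5 * pi / 2" and L: "threshold q < crest 1"
  shows "return_map (ftilde q) = ret_val (threshold q)" "bump (3 * pi / 2) < threshold q"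
proof -
  let ?L = "threshold q" and ?n = "landing (threshold q)"
  note hb = hit_bounds[OF q]
  show lo: "bump (3 * pi / 2) < ?L"
  proof (cases "hit q < 3 * pi / 2")
    case True
    then have "bump (3 * pi / 2) < bump (hit q)" using hb by (intro bump_strict_antimono) auto
    then show ?thesis using bump_hit_le[OF q] by simp
  next
    case False
    have "q \<noteq> pi/2"
    proof
      assume "q = pi/2"
      then have "hit q = pi/2" by (simp only: hit_half_pi)
      then show False using False pi_gt_zero by linarith
    qed
    then have "bump (hit q) < ?L" using q by (intro bump_hit_less) auto
    moreover have "bump (3 * pi / 2) \<le> bump (hit q)"
    proof (cases "hit q = 3 * pi / 2")
      case True
      show ?thesis unfolding True by simp
    qed (use False h bump_strict_mono'[of 0 "3 * pi / 2" "hit q"] in simp)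
    ultimately show ?thesis by simp
  qed
  note n = landing_interior[OF lo L] landing[of ?L]
  have bn: "bump ?n = ?L" using n lo L by simp
  have mono: "bump t < ?L" if "3 * pi / 2 \<le> t" "t < ?n" for t
    using bump_strict_mono'[of 0 t ?n] that n bn by simp
  have hn: "hit q < ?n"
  proof (cases "hit q < 3 * pi / 2")
    case False
    have "q \<noteq> pi/2"
    proof
      assume "q = pi/2"
      then have "hit q = pi/2" by (simp only: hit_half_pi)
      then show False using False pi_gt_zero by linarith
    qed
    then have "bump (hit q) < ?L" using q by (intro bump_hit_less) auto
    moreover have "?L \<le> bump (hit q)" if "?n \<le> hit q"
      using that bump_strict_mono'[of 0 ?n "hit q"] n h bn by (cases "?n = hit q") auto
    ultimately show ?thesis by force
  qed (use n in simp)
  have below: "bump t < ?L" if t: "hit q < t" "t < ?n" for t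
  proof (cases "t < 3 * pi / 2")
    case True
    then have "bump t < bump (hit q)" using t hb by (intro bump_strict_antimono) auto
    then show ?thesis using bump_hit_le[OF q] by simp
  qed (use t mono in auto)
  \<comment> \<open>\<open>bump\<close> is strictly below the threshold on the whole stretch, so any
    exceptional time will do; 0 precedes the hit.\<close>
  interpret return_path q ?n 0
    using q hn bn below cos_pos_right[of ?n 0] n by unfold_locales auto
  show "return_map (ftilde q) = ret_val (threshold q)"
    using return_map_eq by (simp add: ret_val_def)
qed

text \<open>When the threshold equals \<open>crest k\<close>, the crest is the exceptional time of
  the path and the solution runs on to the next rising branch; this is why at a jump the value
  agrees with the limit from the right. The hit comes before the valley after crest k because
  \<open>horizon < 7 * pi / 2\<close>, and dividing by \<open>growth ^ k\<close> moves the landing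
  back by k periods.\<close>

lemma return_map_later:
  assumes q: "- (pi/2) \<le> q" "q \<le> pi/2" and k: "1 \<le> k" and L: "crest k \<le> threshold q" "threshold q < crest (Suc k)"
  shows "return_map (ftilde q) = ret_val (threshold q / growth ^ k)"
proof -
  let ?L = "threshold q" and ?z = "threshold q / growth ^ k"
  let ?n = "landing ?z + 2 * pi * real k"
  have gk: "0 < growth ^ k" using growth_gt_1 by simp
  have "crest 0 * growth ^ k \<le> ?L" "?L < crest 1 * growth ^ k"
    using L crest_eq[of k] crest_eq[of "Suc k"] crest_eq[of 1] by (simp_all add: mult_ac)
  then have z: "crest 0 \<le> ?z" "?z < crest 1" using gk by (simp_all add: pos_le_divide_eq pos_divide_less_eq)
  have z': "bump (3 * pi / 2) < ?z" using z crest_pos[of 0] bump_three_half_neg by linarith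
  note n = landing_interior[OF z' z(2)] landing[of ?z]
  have bn: "bump ?n = ?L" using bump_shift[of "landing ?z" k] n(5) z z' growth_gt_1 by simp
  have "2 * pi * 1 \<le> 2 * pi * real k" using k by (intro mult_left_mono) auto
  then have hn: "hit q < 3 * pi / 2 + 2 * pi * real k"
    using hit_bounds[OF q] horizon_bounds by linarith
  have below: "bump t < ?L" if t: "hit q < t" "t < ?n" "t \<noteq> pi/2 + 2 * pi * real k" for t
  proof (cases "t \<le> 3 * pi / 2 + 2 * pi * real k")
    case True
    have "- (pi/2) < t" using t hit_bounds(1)[OF q] pi_gt_zero by linarith
    then have "bump t < crest k" using True t by (intro bump_less_crest) auto
    then show ?thesis using L by simp
  next
    case False
    then have "bump t < bump ?n" using t n z z' by (intro bump_strict_mono'[of k]) auto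
    then show ?thesis using bn by simp
  qed
  interpret return_path q ?n "pi/2 + 2 * pi * real k"
  proof unfold_locales
    show "hit q < ?n" using hn n by simp
    show "\<exists>e>0. \<forall>t. ?n < t \<and> t \<le> ?n + e \<longrightarrow> 0 < cos t"
      using cos_pos_right[of "landing ?z" k] n by auto
  qed (use q bn below in auto)
  have "sin ?n = sin (landing ?z)" by (rule sin_cos_period)
  then show ?thesis using return_map_eq by (simp add: ret_val_def ftilde_def)
qed

subsection \<open>Dependence on the initial value\<close>

text \<open>Cauchy's mean value theorem with \<open>ftilde\<close> as second function: the factor
  \<open>cos q\<close> common to both derivatives drops out, so the estimate in terms of the initial
  values also holds at the ends of the range of q.\<close>

lemma level_mvt:
  assumes "q \<in> {- (pi/2)..pi/2}" "q0 \<in> {- (pi/2)..pi/2}" "q \<noteq> q0"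
  obtains r where "\<bar>r - q0\<bar> \<le> \<bar>q - q0\<bar>"
    "level q t - level q0 t = - (exp (17/25 * t) * kern (t - r)) * (ftilde q - ftilde q0)"
proof -
  have *: "\<exists>r. a < r \<and> r < b \<and> level b t - level a t = - (exp (17/25 * t) * kern (t - r)) * (ftilde b - ftilde a)"
    if ab: "a < b" "- (pi/2) \<le> a" "b \<le> pi/2" for a b
  proof -
    have "\<exists>c. a < c \<and> c < b \<and> (level b t - level a t) * (- 25/17 * cos c)
        = (ftilde b - ftilde a) * (25/17 * exp (17/25 * t) * kern (t - c) * cos c)"
      by (rule GMVT'[of a b "\<lambda>q. level q t" ftilde "\<lambda>c. - 25/17 * cos c" "\<lambda>c. 25/17 * exp (17/25 * t) * kern (t - c) * cos c"])
        (use ab DERIV_level_start DERIV_ftilde in \<open>auto intro: DERIV_isCont\<close>)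
    then obtain c where c: "a < c" "c < b" "(level b t - level a t) * (- 25/17 * cos c)
        = (ftilde b - ftilde a) * (25/17 * exp (17/25 * t) * kern (t - c) * cos c)" by blast
    have "0 < cos c" using c ab by (intro cos_gt_zero_pi) auto
    have cancel: "X = - (E * k) * Y" if "X * (- 25/17 * z) = Y * (25/17 * E * k * z)" "0 < z" for X Y E k z :: real
    proof -
      have "z * (X + E * k * Y) = 0" using that(1) by (simp add: field_simps)
      then show ?thesis using that(2) by simp
    qed
    have "level b t - level a t = - (exp (17/25 * t) * kern (t - c)) * (ftilde b - ftilde a)"
      by (rule cancel[OF c(3) \<open>0 < cos c\<close>])
    then show ?thesis using c by blast
  qed
  show thesis
  proof (cases "q0 < q")
    case True
    then obtain r where "q0 < r" "r < q" "level q t - level q0 t = - (exp (17/25 * t) * kern (t - r)) * (ftilde q - ftilde q0)"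
      using *[of q0 q] assms by auto
    then show thesis using that[of r] by simp
  next
    case False
    then obtain r where r: "q < r" "r < q0" "level q0 t - level q t = - (exp (17/25 * t) * kern (t - r)) * (ftilde q0 - ftilde q)"
      using *[of q q0] assms by auto
    have "level q t - level q0 t = - (exp (17/25 * t) * kern (t - r)) * (ftilde q - ftilde q0)"
      using r(3) by (simp add: algebra_simps)
    then show thesis using that[of r] r by simp
  qed
qed

lemma uniformly_near:
  fixes F :: "real \<Rightarrow> real \<Rightarrow> real"
  assumes F: "continuous_on UNIV (\<lambda>z. F (fst z) (snd z))" and e: "0 < e"
  obtains d where "d > 0" "\<And>q t s. \<bar>q - q0\<bar> < d \<Longrightarrow> \<bar>t - s\<bar> < d \<Longrightarrow> s \<in> {a..b} \<Longrightarrow> \<bar>F q t - F q0 s\<bar> < e"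
proof -
  let ?C = "{q0 - 1..q0 + 1} \<times> {a - 1..b + 1}"
  have "uniformly_continuous_on ?C (\<lambda>z. F (fst z) (snd z))"
    by (intro compact_uniformly_continuous continuous_on_subset[OF F] compact_Times) auto
  then obtain d where d: "d > 0" "\<And>z z'. z \<in> ?C \<Longrightarrow> z' \<in> ?C \<Longrightarrow> dist z' z < d \<Longrightarrow> dist (F (fst z') (snd z')) (F (fst z) (snd z)) < e"
    unfolding uniformly_continuous_on_def using e by metis
  show thesis
  proof (rule that[of "min 1 (d/2)"])
    fix q t s assume *: "\<bar>q - q0\<bar> < min 1 (d/2)" "\<bar>t - s\<bar> < min 1 (d/2)" "s \<in> {a..b}"
    have "dist (q, t) (q0, s) \<le> dist q q0 + dist t s"
      unfolding dist_prod_def by (auto intro: sqrt_sum_squares_le_sum)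
    then have "dist (q, t) (q0, s) < d" using * by (simp add: dist_real_def)
    moreover have "(q0, s) \<in> ?C" "(q, t) \<in> ?C" using * by auto
    ultimately show "\<bar>F q t - F q0 s\<bar> < e" using d(2)[of "(q0, s)" "(q, t)"] by (simp add: dist_real_def)
  qed (use d in auto)
qed

section \<open>Continuity of the hitting time\<close>

lemma continuous_gain_pair: "continuous_on UNIV (\<lambda>z. gain (fst z) (snd z))"
  by (intro continuous_intros)

lemma continuous_gain_deriv_pair: "continuous_on UNIV (\<lambda>z. slope (fst z) (snd z) - slope (fst z) (snd z - delay))"
  by (intro continuous_intros)

lemma slope_half_pi_pos:
  assumes "pi/2 < t" "t \<le> delay"
  shows "0 < slope (pi/2) t"
proof (rule slope_persists_strict[of _ "pi/2"])
  fix r assume r: "pi/2 < r" "r < t"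
  have "r - delay \<le> pi/2" using r assms half_pi_bounds by linarith
  then show "slope (pi/2) (r - delay) + cos r < 0"
    using cos_neg_delay[of r] r assms by (simp add: slope_init)
qed (use assms slope_init[of "pi/2" "pi/2"] half_pi_bounds delay_enclosure in auto)

lemma gain_half_pi_pos:
  assumes "pi/2 < t" "t \<le> delay"
  shows "0 < gain (pi/2) t"
proof -
  have "lsol (pi/2) (pi/2) < lsol (pi/2) t"
    using assms slope_half_pi_pos by (intro lsol_strict_mono) auto
  moreover have "t - delay \<le> pi/2" using assms half_pi_bounds by linarith
  ultimately show ?thesis by (simp add: gain_def lsol_init)
qed

lemma gain_deriv_hit:
  assumes "- (pi/2) \<le> q" "q < pi/2"
  shows "0 < slope q (hit q) - slope q (hit q - delay)"
  using returns_at_hit[OF assms] by (simp add: returns_at_def)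

lemma gain_pos_after_hit:
  assumes q: "- (pi/2) \<le> q" "q \<le> pi/2"
  obtains d where "d > 0" "\<And>t. hit q < t \<Longrightarrow> t < hit q + d \<Longrightarrow> 0 < gain q t"
proof (cases "q < pi/2")
  case True
  have "\<exists>d>0. \<forall>h>0. h < d \<longrightarrow> gain q (hit q) < gain q (hit q + h)"
    using DERIV_pos_inc_right[OF DERIV_gain gain_deriv_hit[OF q(1) True]] .
  then obtain d where d: "d > 0" "\<And>h. 0 < h \<Longrightarrow> h < d \<Longrightarrow> gain q (hit q) < gain q (hit q + h)" by blast
  show thesis
  proof (rule that[OF d(1)])
    fix t assume "hit q < t" "t < hit q + d"
    then show "0 < gain q t" using d(2)[of "t - hit q"] gain_hit[OF q] by simp
  qed
next
  case False
  then have e: "q = pi/2" using q by simp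
  show thesis
    by (rule that[of "delay - pi/2"]) (use half_pi_bounds delay_enclosure gain_half_pi_pos in \<open>auto simp: e\<close>)
qed

lemma hit_near:
  assumes q0: "- (pi/2) \<le> q0" "q0 \<le> pi/2" and e: "0 < e"
  obtains d where "d > 0" "\<And>q. - (pi/2) \<le> q \<Longrightarrow> q \<le> pi/2 \<Longrightarrow> \<bar>q - q0\<bar> < d \<Longrightarrow> \<bar>hit q - hit q0\<bar> < e"
proof -
  note h0 = hit_bounds[OF q0]
  obtain g where g: "g > 0" "\<And>t. hit q0 < t \<Longrightarrow> t < hit q0 + g \<Longrightarrow> 0 < gain q0 t" using gain_pos_after_hit[OF q0] by blast
  define t1 where "t1 = hit q0 + min g e / 2"
  have t1: "hit q0 < t1" "t1 < hit q0 + g" "t1 < hit q0 + e" using g e by (auto simp: t1_def)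
  obtain d1 where d1: "d1 > 0" "\<And>q t s. \<bar>q - q0\<bar> < d1 \<Longrightarrow> \<bar>t - s\<bar> < d1 \<Longrightarrow> s \<in> {t1..t1} \<Longrightarrow> \<bar>gain q t - gain q0 s\<bar> < gain q0 t1"
    using uniformly_near[OF continuous_gain_pair g(2)[OF t1(1,2)], of q0 t1 t1] by metis
  have up: "hit q < hit q0 + e" if q: "- (pi/2) \<le> q" "q \<le> pi/2" "\<bar>q - q0\<bar> < d1" for q
  proof (rule ccontr)
    assume "\<not> hit q < hit q0 + e"
    then have t: "q < t1" "t1 < hit q" using t1 h0 q by linarith+
    have "gain q t1 < 0" by (rule gain_before_hit) (use q t in auto)
    then show False using d1(2)[of q t1 t1] d1(1) q by simp
  qed
  obtain d2 where d2: "d2 > 0" "\<And>q. - (pi/2) \<le> q \<Longrightarrow> q \<le> pi/2 \<Longrightarrow> \<bar>q - q0\<bar> < d2 \<Longrightarrow> hit q0 - e < hit q"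
  proof (cases "pi/2 \<le> hit q0 - e")
    case False
    have "hit q0 - e < hit q" if "- (pi/2) \<le> q" "q \<le> pi/2" for q
      using hit_bounds[OF that] False by linarith
    then show thesis using that[of 1] by auto
  next
    case True
    have "q0 \<noteq> pi/2"
    proof
      assume "q0 = pi/2"
      then have "hit q0 = pi/2" by (simp only: hit_half_pi)
      then show False using True e by linarith
    qed
    then have q0': "q0 < pi/2" using q0 by simp
    have "continuous_on {pi/2..hit q0 - e} (gain q0)" by (intro continuous_intros)
    then obtain m where m: "pi/2 \<le> m" "m \<le> hit q0 - e" "\<And>t. pi/2 \<le> t \<Longrightarrow> t \<le> hit q0 - e \<Longrightarrow> gain q0 t \<le> gain q0 m"
      using continuous_attains_sup[of "{pi/2..hit q0 - e}" "gain q0"] True by auto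
    have gm: "0 < - gain q0 m" using gain_before_hit[OF q0, of m] m q0' e by simp
    obtain d where d: "d > 0" "\<And>q t s. \<bar>q - q0\<bar> < d \<Longrightarrow> \<bar>t - s\<bar> < d \<Longrightarrow> s \<in> {pi/2..hit q0 - e} \<Longrightarrow> \<bar>gain q t - gain q0 s\<bar> < - gain q0 m"
      using uniformly_near[OF continuous_gain_pair gm, of q0 "pi/2" "hit q0 - e"] by metis
    show thesis
    proof (rule that[OF d(1)], rule ccontr)
      fix q assume q: "- (pi/2) \<le> q" "q \<le> pi/2" "\<bar>q - q0\<bar> < d" and "\<not> hit q0 - e < hit q"
      then have h: "hit q \<in> {pi/2..hit q0 - e}" using hit_bounds[OF q(1,2)] by simp
      have "\<bar>gain q (hit q) - gain q0 (hit q)\<bar> < - gain q0 m" using d(2)[OF q(3) _ h] d(1) by simp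
      then show False using gain_hit[OF q(1,2)] m(3)[of "hit q"] h by simp
    qed
  qed
  show thesis
  proof (rule that[of "min d1 d2"])
    fix q assume "- (pi/2) \<le> q" "q \<le> pi/2" "\<bar>q - q0\<bar> < min d1 d2"
    then have "hit q < hit q0 + e" "hit q0 - e < hit q" using up[of q] d2(2)[of q] by simp_all
    then show "\<bar>hit q - hit q0\<bar> < e" by linarith
  qed (use d1 d2 in simp)
qed

lemma level_mono:
  assumes "- (pi/2) \<le> q" "q \<le> t" "t \<le> t'" "t' \<le> horizon + 1" "\<And>r. t < r \<Longrightarrow> r < t' \<Longrightarrow> gain q r \<le> 0"
  shows "level q t \<le> level q t'"
  using assms(3)
proof (rule mono_on_of_deriv)
  fix r assume r: "t < r" "r < t'"
  have "r \<le> q + 3 * delay" using r assms half_pi_bounds delay_enclosure by linarith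
  then show "\<exists>D. (level q has_real_derivative D) (at r) \<and> 0 \<le> D"
    using DERIV_level[of q r] assms r by (intro exI[of _ "- (exp (17/25 * r) * gain q r)"]) (auto simp: mult_nonneg_nonpos)
qed (intro continuous_intros)

lemma level_antimono:
  assumes "- (pi/2) \<le> q" "q \<le> t" "t \<le> t'" "t' \<le> horizon + 1" "\<And>r. t < r \<Longrightarrow> r < t' \<Longrightarrow> 0 \<le> gain q r"
  shows "level q t' \<le> level q t"
proof -
  have "- level q t \<le> - level q t'"
    using assms(3)
  proof (rule mono_on_of_deriv)
    fix r assume r: "t < r" "r < t'"
    have "r \<le> q + 3 * delay" using r assms half_pi_bounds delay_enclosure by linarith
    then show "\<exists>D. ((\<lambda>t. - level q t) has_real_derivative D) (at r) \<and> 0 \<le> D"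
      using DERIV_minus[OF DERIV_level[of q r]] assms r by (intro exI[of _ "exp (17/25 * r) * gain q r"]) auto
  qed (intro continuous_intros)
  then show ?thesis by simp
qed

lemma level_le_threshold_before:
  assumes q: "- (pi/2) \<le> q" "q \<le> pi/2" and t: "q \<le> t" "t \<le> hit q"
  shows "level q t \<le> threshold q"
  unfolding threshold_def
proof (rule level_mono[OF q(1) t])
  fix r assume "t < r" "r < hit q"
  then show "gain q r \<le> 0" using gain_before_hit[OF q, of r] t by simp
qed (use hit_bounds[OF q] in simp)

text \<open>Envelope argument: because of this, the derivative of the hitting time does not enter the
  derivative of the threshold.\<close>

lemma threshold_local_max:
  assumes q0: "- (pi/2) \<le> q0" "q0 \<le> pi/2"
  obtains d where "d > 0" "\<And>q. - (pi/2) \<le> q \<Longrightarrow> q \<le> pi/2 \<Longrightarrow> \<bar>q - q0\<bar> < d \<Longrightarrow>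
    level q (hit q0) \<le> threshold q \<and> level q0 (hit q) \<le> threshold q0"
proof -
  note h0 = hit_bounds[OF q0]
  obtain g where g: "g > 0" "\<And>t. hit q0 < t \<Longrightarrow> t < hit q0 + g \<Longrightarrow> 0 < gain q0 t" using gain_pos_after_hit[OF q0] by blast
  obtain d1 where d1: "d1 > 0" "\<And>q. - (pi/2) \<le> q \<Longrightarrow> q \<le> pi/2 \<Longrightarrow> \<bar>q - q0\<bar> < d1 \<Longrightarrow> \<bar>hit q - hit q0\<bar> < min g 1"
    using hit_near[OF q0, of "min g 1"] g by auto
  have B: "level q0 (hit q) \<le> threshold q0" if q: "- (pi/2) \<le> q" "q \<le> pi/2" "\<bar>q - q0\<bar> < d1" for q
  proof (cases "hit q \<le> hit q0")
    case True
    then show ?thesis using hit_bounds[OF q(1,2)] q0 by (intro level_le_threshold_before) auto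
  next
    case False
    show ?thesis
      unfolding threshold_def
    proof (rule level_antimono[OF q0(1)])
      fix r assume r: "hit q0 < r" "r < hit q"
      show "0 \<le> gain q0 r" using g(2)[of r] r d1(2)[OF q] by simp
    qed (use h0 False d1(2)[OF q] in auto)
  qed
  obtain d2 where d2: "d2 > 0" "\<And>q. - (pi/2) \<le> q \<Longrightarrow> q \<le> pi/2 \<Longrightarrow> \<bar>q - q0\<bar> < d2 \<Longrightarrow> level q (hit q0) \<le> threshold q"
  proof (cases "q0 < pi/2")
    case False
    then have e: "q0 = pi/2" using q0 by simp
    have "level q (hit q0) \<le> threshold q" if "- (pi/2) \<le> q" "q \<le> pi/2" for q
      using hit_bounds[OF that] that unfolding e hit_half_pi by (intro level_le_threshold_before) auto
    then show thesis using that[of 1] by auto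
  next
    case True
    obtain e where e: "e > 0" "\<And>q t s. \<bar>q - q0\<bar> < e \<Longrightarrow> \<bar>t - s\<bar> < e \<Longrightarrow> s \<in> {hit q0..hit q0} \<Longrightarrow>
        \<bar>(slope q t - slope q (t - delay)) - (slope q0 s - slope q0 (s - delay))\<bar> < slope q0 (hit q0) - slope q0 (hit q0 - delay)"
      using uniformly_near[OF continuous_gain_deriv_pair gain_deriv_hit[OF q0(1) True], of q0 "hit q0" "hit q0"] by metis
    obtain d where d: "d > 0" "\<And>q. - (pi/2) \<le> q \<Longrightarrow> q \<le> pi/2 \<Longrightarrow> \<bar>q - q0\<bar> < d \<Longrightarrow> \<bar>hit q - hit q0\<bar> < e"
      using hit_near[OF q0 e(1)] by metis
    show thesis
    proof (rule that[of "min d e"])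
      fix q assume q: "- (pi/2) \<le> q" "q \<le> pi/2" "\<bar>q - q0\<bar> < min d e"
      note hq = hit_bounds[OF q(1,2)]
      show "level q (hit q0) \<le> threshold q"
      proof (cases "hit q0 \<le> hit q")
        case le: True
        then show ?thesis using h0 q by (intro level_le_threshold_before) auto
      next
        case False
        have inc: "gain q (hit q) \<le> gain q r" if r: "hit q < r" "r < hit q0" for r
          using less_imp_le[OF r(1)]
        proof (rule mono_on_of_deriv)
          fix u assume u: "hit q < u" "u < r"
          have "\<bar>u - hit q0\<bar> < e" using u r d(2)[of q] q by linarith
          then have "0 < slope q u - slope q (u - delay)" using e(2)[of q u "hit q0"] q by simp
          then show "\<exists>D. (gain q has_real_derivative D) (at u) \<and> 0 \<le> D"
            using DERIV_gain[of q u] less_imp_le by blast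
        qed (intro continuous_intros)
        show ?thesis
          unfolding threshold_def
        proof (rule level_antimono[OF q(1)])
          fix r assume "hit q < r" "r < hit q0"
          then show "0 \<le> gain q r" using inc[of r] gain_hit[OF q(1,2)] by simp
        qed (use False hq h0 in auto)
      qed
    qed (use d e in auto)
  qed
  show thesis by (rule that[of "min d1 d2"]) (use d1(1) d2 B in auto)
qed

definition start :: "real \<Rightarrow> real" where
  "start p = arcsin (1 - 17/25 * p)"

lemma K_bounds: "p \<in> K \<longleftrightarrow> 0 \<le> p \<and> p \<le> 50/17"
  unfolding K_eq_interval by (auto simp: field_simps)

lemma start_bounds:
  assumes "p \<in> K"
  shows "- (pi/2) \<le> start p" "start p \<le> pi/2" "sin (start p) = 1 - 17/25 * p" "ftilde (start p) = p"
proof -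
  have "- 1 \<le> 1 - 17/25 * p" "1 - 17/25 * p \<le> 1" using assms by (simp_all add: K_bounds)
  then show "- (pi/2) \<le> start p" "start p \<le> pi/2" "sin (start p) = 1 - 17/25 * p"
    unfolding start_def using arcsin_bounded by auto
  then show "ftilde (start p) = p" by (simp add: ftilde_alt)
qed

lemma start_zero: "start 0 = pi/2"
  by (simp add: start_def)

lemma start_antimono: "p \<in> K \<Longrightarrow> p' \<in> K \<Longrightarrow> p < p' \<Longrightarrow> start p' < start p"
  unfolding start_def by (intro arcsin_less_arcsin) (auto simp: K_bounds)

lemma continuous_on_start: "continuous_on K start"
  unfolding start_def by (intro continuous_intros) (auto simp: K_bounds)

definition peak :: "real \<Rightarrow> real" where
  "peak p = threshold (start p)"

theorem DERIV_peak:
  assumes p0: "p0 \<in> K"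
  shows "(peak has_real_derivative - (exp (17/25 * hit (start p0)) * kern (hit (start p0) - start p0))) (at p0 within K)"
  unfolding has_field_derivative_iff Lim_within
proof (intro allI impI)
  fix e :: real assume e: "0 < e"
  define q0 where "q0 = start p0"
  note q0 = start_bounds[OF p0, folded q0_def]
  define F where "F q t = exp (17/25 * t) * kern (t - q)" for q t
  have contF: "continuous_on UNIV (\<lambda>z. F (fst z) (snd z))" unfolding F_def by (intro continuous_intros)
  obtain d where d: "d > 0" "\<And>q t s. \<bar>q - q0\<bar> < d \<Longrightarrow> \<bar>t - s\<bar> < d \<Longrightarrow> s \<in> {hit q0..hit q0} \<Longrightarrow> \<bar>F q t - F q0 s\<bar> < e"
    using uniformly_near[where F = F and ?q0.0 = q0 and a = "hit q0" and b = "hit q0", OF contF e] by blast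
  obtain d1 where d1: "d1 > 0" "\<And>q. - (pi/2) \<le> q \<Longrightarrow> q \<le> pi/2 \<Longrightarrow> \<bar>q - q0\<bar> < d1 \<Longrightarrow> \<bar>hit q - hit q0\<bar> < d"
    using hit_near[OF q0(1,2) d(1)] by metis
  obtain d2 where d2: "d2 > 0" "\<And>q. - (pi/2) \<le> q \<Longrightarrow> q \<le> pi/2 \<Longrightarrow> \<bar>q - q0\<bar> < d2 \<Longrightarrow>
    level q (hit q0) \<le> threshold q \<and> level q0 (hit q) \<le> threshold q0"
    using threshold_local_max[OF q0(1,2)] by metis
  have "0 < min d (min d1 d2)" using d d1 d2 by simp
  then obtain c where c: "c > 0" "\<And>p. p \<in> K \<Longrightarrow> dist p p0 < c \<Longrightarrow> dist (start p) q0 < min d (min d1 d2)"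
    using continuous_on_start p0 unfolding continuous_on_iff q0_def by metis
  show "\<exists>d>0. \<forall>p\<in>K. 0 < dist p p0 \<and> dist p p0 < d \<longrightarrow>
      dist ((peak p - peak p0) / (p - p0)) (- (exp (17/25 * hit (start p0)) * kern (hit (start p0) - start p0))) < e"
  proof (intro exI[of _ c] conjI ballI impI c(1))
    fix p assume p: "p \<in> K" and dp: "0 < dist p p0 \<and> dist p p0 < c"
    define q where "q = start p"
    note q = start_bounds[OF p, folded q_def]
    have near: "\<bar>q - q0\<bar> < d" "\<bar>q - q0\<bar> < d1" "\<bar>q - q0\<bar> < d2"
      using c(2)[OF p] dp by (auto simp: q_def dist_real_def)
    have pne: "p - p0 \<noteq> 0" using dp by auto
    have qne: "q \<noteq> q0" using pne q q0 by auto
    have I: "q \<in> {- (pi/2)..pi/2}" "q0 \<in> {- (pi/2)..pi/2}" using q q0 by auto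
    obtain r where r: "\<bar>r - q0\<bar> \<le> \<bar>q - q0\<bar>" "level q (hit q0) - level q0 (hit q0) = - F r (hit q0) * (p - p0)"
      using level_mvt[OF I qne, of "hit q0"] unfolding F_def q(4) q0(4) by metis
    obtain r' where r': "\<bar>r' - q0\<bar> \<le> \<bar>q - q0\<bar>" "level q (hit q) - level q0 (hit q) = - F r' (hit q) * (p - p0)"
      using level_mvt[OF I qne, of "hit q"] unfolding F_def q(4) q0(4) by metis
    have m: "level q (hit q0) \<le> threshold q" "level q0 (hit q) \<le> threshold q0"
      using d2(2)[OF q(1,2) near(3)] by auto
    have lo: "- F r (hit q0) * (p - p0) \<le> peak p - peak p0"
      using m r(2) unfolding peak_def q_def[symmetric] q0_def[symmetric] threshold_def by linarith
    have hi: "peak p - peak p0 \<le> - F r' (hit q) * (p - p0)"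
      using m r'(2) unfolding peak_def q_def[symmetric] q0_def[symmetric] threshold_def by linarith
    have Fr: "\<bar>F r (hit q0) - F q0 (hit q0)\<bar> < e" using r near d(1) by (intro d(2)) auto
    have Fr': "\<bar>F r' (hit q) - F q0 (hit q0)\<bar> < e" using r' near d1(2)[OF q(1,2) near(2)] by (intro d(2)) auto
    define Q where "Q = (peak p - peak p0) / (p - p0)"
    have Q: "peak p - peak p0 = Q * (p - p0)" using pne by (simp add: Q_def)
    have "\<bar>Q - (- F q0 (hit q0))\<bar> < e"
    proof (cases "0 < p - p0")
      case True
      then have "- F r (hit q0) \<le> Q" "Q \<le> - F r' (hit q)" using lo hi unfolding Q by (simp_all only: mult_le_cancel_right_pos)
      then show ?thesis using Fr Fr' by linarith
    next
      case False
      then have "p - p0 < 0" using pne by simp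
      then have "Q \<le> - F r (hit q0)" "- F r' (hit q) \<le> Q" using lo hi unfolding Q by (simp_all only: mult_le_cancel_right_neg)
      then show ?thesis using Fr Fr' by linarith
    qed
    then show "dist ((peak p - peak p0) / (p - p0)) (- (exp (17/25 * hit (start p0)) * kern (hit (start p0) - start p0))) < e"
      by (simp add: dist_real_def Q_def F_def q0_def)
  qed
qed

lemma continuous_on_peak: "continuous_on K peak"
  using DERIV_peak by (auto simp: continuous_on_eq_continuous_within intro: DERIV_continuous)

lemma continuous_on_hit_start: "continuous_on K (\<lambda>p. hit (start p))"
  unfolding continuous_on_iff
proof (intro ballI allI impI)
  fix p0 e :: real assume p0: "p0 \<in> K" and e: "0 < e"
  obtain d where d: "d > 0" "\<And>q. - (pi/2) \<le> q \<Longrightarrow> q \<le> pi/2 \<Longrightarrow> \<bar>q - start p0\<bar> < d \<Longrightarrow> \<bar>hit q - hit (start p0)\<bar> < e"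
    using hit_near[OF start_bounds(1,2)[OF p0] e] by metis
  obtain c where c: "c > 0" "\<And>p. p \<in> K \<Longrightarrow> dist p p0 < c \<Longrightarrow> dist (start p) (start p0) < d"
    using continuous_on_start p0 d(1) unfolding continuous_on_iff by metis
  show "\<exists>c>0. \<forall>p\<in>K. dist p p0 < c \<longrightarrow> dist (hit (start p)) (hit (start p0)) < e"
    using c d(2) start_bounds by (intro exI[of _ c]) (auto simp: dist_real_def)
qed

section \<open>Two-sided bounds for the threshold\<close>

definition scaled :: "real \<Rightarrow> real \<Rightarrow> real" where
  "scaled q t = 15625/15538 * (17/25 * cos t + sin t) + ftilde t - lsol q t"

text \<open>Without the factor \<open>exp (17/25 * t)\<close> the quantities stay moderate, and
  comparisons with \<open>bump\<close> involve only exponentials of time differences.\<close>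

lemma level_scaled: "level q t = exp (17/25 * t) * scaled q t"
  by (simp add: level_def scaled_def bump_def algebra_simps)

lemma hit_unimodal:
  assumes q: "- (pi/2) \<le> q" "q < pi/2" and um: "unimodal q m T" "hit q \<le> T"
  shows "m < hit q" "hit q - delay \<le> m"
proof -
  note h = returns_at_hit[OF q, unfolded returns_at_def]
  show "m < hit q"
  proof (rule ccontr)
    assume "\<not> m < hit q"
    then have "gain q (hit q) < 0" using um h q by (intro gain_neg_start) (auto simp: unimodal_def)
    then show False using h by simp
  qed
  show "hit q - delay \<le> m"
  proof (rule ccontr)
    assume "\<not> hit q - delay \<le> m"
    moreover have "hit q - delay \<le> T" using um(2) delay_pos by linarith
    ultimately have "0 < slope q (hit q - delay)" using um(1) by (simp add: unimodal_def)
    then show False using h by simp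
  qed
qed

lemma level_le_threshold_after:
  assumes q: "- (pi/2) \<le> q" "q < pi/2" and um: "unimodal q m T" "T \<le> horizon"
    and t: "q \<le> t" "t \<le> T" "t \<le> m + delay"
  shows "level q t \<le> threshold q"
proof (cases "t \<le> hit q")
  case True
  then show ?thesis using q t by (intro level_le_threshold_before) auto
next
  case False
  have q': "q \<le> pi/2" using q by simp
  show ?thesis
    unfolding threshold_def
  proof (rule level_antimono[OF q(1)])
    fix r assume "hit q < r" "r < t"
    then show "0 \<le> gain q r"
      using unimodal_gain_pos[OF um(1) gain_hit[OF q(1) q'], of r] hit_bounds[OF q(1) q'] q t by simp
  qed (use False t um hit_bounds[OF q(1) q'] in auto)
qed

text \<open>The hit lies between t and t'. On the way there the gain rises from its value at t to 0,
  so its modulus never exceeds d, and integrating the derivative of \<open>level\<close> over a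
  stretch shorter than \<open>t' - t\<close> bounds what the threshold can add.\<close>

lemma threshold_le:
  assumes q: "- (pi/2) \<le> q" "q < pi/2" and um: "unimodal q m T" "T \<le> horizon"
    and t: "q < t" "t < t'" "t' \<le> T" "t \<le> m + delay" "0 < slope q t"
    and g: "gain q t < 0" "0 < gain q t'" "- gain q t \<le> d"
  shows "threshold q \<le> level q t + exp (17/25 * t') * d * (t' - t)"
proof -
  have q': "q \<le> pi/2" using q by simp
  note hb = hit_bounds[OF q(1) q']
  have ht': "hit q < t'"
  proof (rule ccontr)
    assume "\<not> hit q < t'"
    then consider "t' < hit q" | "t' = hit q" by linarith
    then show False
      using gain_before_hit[OF q(1) q', of t'] gain_hit[OF q(1) q'] g t by cases auto
  qed
  have hT: "hit q \<le> T" using ht' t by simp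
  note hu = hit_unimodal[OF q um(1) hT]
  have mt: "m \<le> t"
  proof (rule ccontr)
    assume "\<not> m \<le> t"
    then have "slope q t < 0" using um(1) t by (simp add: unimodal_def)
    then show False using t by simp
  qed
  have th: "t < hit q"
  proof (rule ccontr)
    assume "\<not> t < hit q"
    then have "0 \<le> gain q t"
      using unimodal_gain_pos[OF um(1) gain_hit[OF q(1) q'], of t] gain_hit[OF q(1) q'] hb q t
      by (cases "t = hit q") auto
    then show False using g by simp
  qed
  have inc: "gain q t \<le> gain q r" if r: "t \<le> r" "r \<le> hit q" for r
    using r(1)
  proof (rule mono_on_of_deriv)
    fix u assume u: "t < u" "u < r"
    have "0 < slope q u" using um(1) u r hT mt by (auto simp: unimodal_def)
    moreover have "slope q (u - delay) \<le> 0"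
    proof (cases "u - delay \<le> q")
      case False
      then have "slope q (u - delay) < 0" using um(1) u r hu by (auto simp: unimodal_def)
      then show ?thesis by simp
    qed (simp add: slope_init)
    ultimately show "\<exists>D. (gain q has_real_derivative D) (at u) \<and> 0 \<le> D"
      using DERIV_gain[of q u] by (intro exI[of _ "slope q u - slope q (u - delay)"]) auto
  qed (intro continuous_intros)
  let ?E = "exp (17/25 * t') * d"
  have "?E * t - level q t \<le> ?E * hit q - level q (hit q)"
    using less_imp_le[OF th]
  proof (rule mono_on_of_deriv)
    fix u assume u: "t < u" "u < hit q"
    have d0: "- gain q u \<le> d" "0 \<le> d" using inc[of u] u g by auto
    have "exp (17/25 * u) * (- gain q u) \<le> exp (17/25 * t') * d"
      using u ht' d0 gain_before_hit[OF q(1) q', of u] t by (intro mult_mono) auto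
    moreover have "u \<le> q + 3 * delay" using u hb q half_pi_bounds delay_enclosure by linarith
    then have "((\<lambda>t. ?E * t - level q t) has_real_derivative ?E * 1 - (- (exp (17/25 * u) * gain q u))) (at u)"
      using u t by (intro DERIV_diff DERIV_cmult DERIV_ident DERIV_level) auto
    ultimately show "\<exists>D. ((\<lambda>t. ?E * t - level q t) has_real_derivative D) (at u) \<and> 0 \<le> D"
      by (intro exI[of _ "?E * 1 - (- (exp (17/25 * u) * gain q u))"]) auto
  qed (intro continuous_intros)
  moreover have "?E * hit q \<le> ?E * t'" using ht' g by (intro mult_left_mono) auto
  ultimately show ?thesis unfolding threshold_def by (simp add: algebra_simps)
qed

text \<open>The condition on \<open>t - delay\<close> is a checkable substitute for
  \<open>t \<le> m + delay\<close>, with m the unknown time of the minimum: up to m the slope is not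
  positive, and m exceeds \<open>pi/2\<close>.\<close>

lemma level_le_threshold_late:
  assumes q: "3/25 \<le> q" "q < pi/2" and t: "q \<le> t" "t \<le> late_horizon" "slope q (t - delay) < 0 \<or> t - delay \<le> pi/2"
  shows "level q t \<le> threshold q"
proof -
  obtain m where m: "unimodal q m late_horizon" "pi/2 < m" using unimodal_late[OF q] by blast
  have "t - delay \<le> m"
  proof (rule ccontr)
    assume "\<not> t - delay \<le> m"
    moreover have "t - delay \<le> late_horizon" using t delay_enclosure by linarith
    ultimately have "0 < slope q (t - delay)" "pi/2 < t - delay" using m by (auto simp: unimodal_def)
    then show False using t by simp
  qed
  then show ?thesis
    using late_horizon_less q t half_pi_bounds by (intro level_le_threshold_after[OF _ _ m(1)]) auto
qed

lemma threshold_le_late: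
  assumes q: "3/25 \<le> q" "q < pi/2"
    and t: "q < t" "t < t'" "t' \<le> late_horizon" "t - delay \<le> pi/2" "0 < slope q t"
    and g: "gain q t < 0" "0 < gain q t'" "- gain q t \<le> d"
  shows "threshold q \<le> level q t + exp (17/25 * t') * d * (t' - t)"
proof -
  obtain m where m: "unimodal q m late_horizon" "pi/2 < m" using unimodal_late[OF q] by blast
  show ?thesis
    by (rule threshold_le[OF _ q(2) m(1)]) (use late_horizon_less half_pi_bounds q t g m in auto)
qed

lemma level_le_threshold_nonpos:
  assumes q: "- (pi/2) \<le> q" "q \<le> 0" and t: "q \<le> t" "t \<le> horizon"
  shows "level q t \<le> threshold q"
proof -
  obtain m where m: "unimodal q m horizon" "delay + 3/2 < m" using unimodal_nonpos[OF q] by blast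
  show ?thesis
    by (rule level_le_threshold_after[OF _ _ m(1)]) (use q t m half_pi_bounds in auto)
qed

lemma threshold_le_nonpos:
  assumes q: "- (pi/2) \<le> q" "q \<le> 0"
    and t: "q < t" "t < t'" "t' \<le> horizon" "0 < slope q t"
    and g: "gain q t < 0" "0 < gain q t'" "- gain q t \<le> d"
  shows "threshold q \<le> level q t + exp (17/25 * t') * d * (t' - t)"
proof -
  obtain m where m: "unimodal q m horizon" "delay + 3/2 < m" using unimodal_nonpos[OF q] by blast
  show ?thesis
    by (rule threshold_le[OF _ _ m(1)]) (use half_pi_bounds q t g m in auto)
qed

lemma less_half_pi:
  fixes q :: real
  assumes "sin q = c" "c < 1" "q \<le> pi/2"
  shows "q < pi/2"
proof (rule ccontr)
  assume "\<not> q < pi/2"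
  then have "q = pi/2" using assms by simp
  then have "sin q = 1" by (simp only: sin_pi_half)
  then show False using assms by simp
qed

lemma le_of_sin_le:
  fixes a q :: real
  assumes "sin a \<le> sin q" "- (pi/2) \<le> q" "q \<le> pi/2" "- (pi/2) \<le> a" "a \<le> pi/2"
  shows "a \<le> q"
  using assms sin_mono_le_eq[of a q] by simp

lemma cos_of_sin:
  fixes q :: real
  assumes "sin q = c" "0 \<le> cos q" "0 \<le> l" "l * l \<le> 1 - c * c" "0 \<le> u" "1 - c * c \<le> u * u"
  shows "encl l (cos q) u"
proof -
  have "(cos q)\<^sup>2 = 1 - c * c" using sin_cos_squared_add[of q] assms(1) by (simp add: power2_eq_square)
  then show ?thesis
    using assms power2_le_imp_le[of l "cos q"] power2_le_imp_le[of "cos q" u] by (simp add: power2_eq_square)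
qed

lemma ge_of_sin_ge:
  fixes a q :: real
  assumes "sin q \<le> sin a" "- (pi/2) \<le> q" "q \<le> pi/2" "- (pi/2) \<le> a" "a \<le> pi/2"
  shows "q \<le> a"
  using assms sin_mono_le_eq[of q a] by simp

text \<open>Whole delays only rotate sine and cosine, so the trigonometric part is evaluated at
  \<open>q + r\<close>. The factor 264146 = 17 * 15538 clears all denominators.\<close>

lemma scaled_delay:
  "264146 * scaled q (q + (delay + r)) =
     388450 + 180625 * sin (q + r) + 122825 * cos (q + r) - 264146 * lsol q (q + (delay + r))"
  "264146 * scaled q (q + (2 * delay + r)) =
     388450 - 180625 * cos (q + r) + 122825 * sin (q + r) - 264146 * lsol q (q + (2 * delay + r))"
proof -
  have 1: "cos (q + (delay + r)) = sin (q + r)" "sin (q + (delay + r)) = - cos (q + r)" for r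
    using cos_add_delay[of "q + r"] sin_add_delay[of "q + r"] by (simp_all add: algebra_simps)
  have e: "q + (2 * delay + r) = q + (delay + (delay + r))" by simp
  show "264146 * scaled q (q + (delay + r)) =
     388450 + 180625 * sin (q + r) + 122825 * cos (q + r) - 264146 * lsol q (q + (delay + r))"
    unfolding scaled_def ftilde_alt 1 by (simp add: field_simps)
  show "264146 * scaled q (q + (2 * delay + r)) =
     388450 - 180625 * cos (q + r) + 122825 * sin (q + r) - 264146 * lsol q (q + (2 * delay + r))"
    unfolding scaled_def ftilde_alt e 1 by (simp add: field_simps)
qed

lemma bump_factor: "bump u = exp (17/25 * t) * (15625/15538 * (exp (17/25 * (u - t)) * (17/25 * cos u + sin u)))"
proof -
  have "exp (17/25 * u) = exp (17/25 * t) * exp (17/25 * (u - t))"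
    unfolding exp_add[symmetric] exp_inj_iff by (simp add: field_simps)
  then show ?thesis unfolding bump_def by simp
qed

lemma bump_less_threshold:
  assumes "level q t \<le> threshold q" "17/25 * (u - t) \<le> X" "exp X \<le> x"
    and "0 \<le> 17/25 * cos u + sin u" "17/25 * cos u + sin u \<le> w" "15625/15538 * (x * w) < scaled q t"
  shows "bump u < threshold q"
proof -
  have "exp (17/25 * (u - t)) \<le> exp X" using assms(2) by simp
  then have "exp (17/25 * (u - t)) \<le> x" using assms(3) by linarith
  then have "exp (17/25 * (u - t)) * (17/25 * cos u + sin u) \<le> x * w"
    using assms(4,5) by (intro mult_mono) (auto intro: order_trans[OF exp_ge_zero])
  then have "15625/15538 * (exp (17/25 * (u - t)) * (17/25 * cos u + sin u)) < scaled q t"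
    using assms(6) by linarith
  then have "bump u < level q t"
    unfolding bump_factor[of u t] level_scaled by (intro mult_strict_left_mono exp_gt_zero)
  then show ?thesis using assms(1) by linarith
qed

text \<open>Here h is the length of a time interval known to contain the hit and d bounds the gain
  on it. After division by \<open>exp (17/25 * t)\<close> the correction to
  \<open>scaled q t\<close> is at most \<open>e * (d * h)\<close>.\<close>

lemma threshold_less_bump:
  assumes "threshold q \<le> level q t + exp (17/25 * (t + h)) * d * (t + h - t)" "exp (17/25 * h) \<le> e" "0 \<le> d * h"
    and "X \<le> 17/25 * (u - t)" "x \<le> exp X" "0 \<le> x" "w \<le> 17/25 * cos u + sin u" "0 \<le> w"
    and "scaled q t + e * (d * h) < 15625/15538 * (x * w)"
  shows "threshold q < bump u"
proof -
  have "exp X \<le> exp (17/25 * (u - t))" using assms(4) by simp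
  then have "x \<le> exp (17/25 * (u - t))" using assms(5) by linarith
  then have "x * w \<le> exp (17/25 * (u - t)) * (17/25 * cos u + sin u)"
    using assms(6-8) by (intro mult_mono) auto
  moreover have "exp (17/25 * h) * (d * h) \<le> e * (d * h)" using assms(2,3) by (rule mult_right_mono)
  ultimately have "scaled q t + exp (17/25 * h) * (d * h) < 15625/15538 * (exp (17/25 * (u - t)) * (17/25 * cos u + sin u))"
    using assms(9) by linarith
  then have "exp (17/25 * t) * (scaled q t + exp (17/25 * h) * (d * h)) < bump u"
    unfolding bump_factor[of u t] by (intro mult_strict_left_mono exp_gt_zero)
  moreover have "exp (17/25 * (t + h)) = exp (17/25 * t) * exp (17/25 * h)"
    unfolding exp_add[symmetric] exp_inj_iff by (simp add: field_simps)
  then have "level q t + exp (17/25 * (t + h)) * d * (t + h - t) = exp (17/25 * t) * (scaled q t + exp (17/25 * h) * (d * h))"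
    unfolding level_scaled by (simp add: algebra_simps)
  ultimately show ?thesis using assms(1) by linarith
qed

lemma crest_trig: "17/25 * cos (pi/2 + 2 * pi * real k) + sin (pi/2 + 2 * pi * real k) = 1"
  unfolding sin_cos_period by simp

lemma crest_less_threshold:
  assumes "level q t \<le> threshold q" "17/25 * (pi/2 + 2 * pi * real k - t) \<le> X" "exp X \<le> x" "15625/15538 * x < scaled q t"
  shows "crest k < threshold q"
  unfolding crest_def by (rule bump_less_threshold[OF assms(1-3), where w = 1]) (use assms(4) crest_trig[of k] in auto)

lemma threshold_less_crest:
  assumes "threshold q \<le> level q t + exp (17/25 * (t + h)) * d * (t + h - t)" "exp (17/25 * h) \<le> e" "0 \<le> d * h"
    and "X \<le> 17/25 * (pi/2 + 2 * pi * real k - t)" "x \<le> exp X" "0 \<le> x"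
    and "scaled q t + e * (d * h) < 15625/15538 * x"
  shows "threshold q < crest k"
  unfolding crest_def by (rule threshold_less_bump[OF assms(1-6), where w = 1]) (use assms(7) crest_trig[of k] in auto)

subsection \<open>Thresholds at sample points\<close>

lemma point_64:
  "encl (- (969329/1000000)) (sin_coord (16/25)) (- (969327/1000000))"
  "encl (- (144391/1000000)) (cos_coord (16/25)) (- (144389/1000000))"
  "encl (- (8496747/1000000)) (kern (delay + (16/25))) (- (1699349/200000))"
  "encl (8169741/1000000) (sin_coord (delay + (16/25))) (8169747/1000000)"
  "encl (- (635511/200000)) (cos_coord (delay + (16/25))) (- (3177551/1000000))"
proof -
  have X: "encl (61363979/50000000) (exp (8/25 * (16/25) :: real)) (122727959/100000000)"
    by (rule exp_enclosure8[where l = "(10259304941/10000000000)" and u = "(5129652471/5000000000)"], rule exp_enclosure) (simp_all add: power_divide)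
  have s: "encl (7464943/12500000) (sin ((16/25) :: real)) (11943909/20000000)"
    by (rule sin_enclosure) (simp_all add: power_divide)
  have c: "encl (3208383/4000000) (cos ((16/25) :: real)) (10026197/12500000)"
    by (rule cos_enclosure) (simp_all add: power_divide)
  have r: "0 \<le> ((16/25) :: real)" "(16/25) \<le> delay" "- delay \<le> (16/25)" "(16/25) \<le> 2 * delay" "- delay \<le> delay + (16/25)" "delay + (16/25) \<le> 2 * delay"
    using delay_enclosure by linarith+
  have K1: "encl (51703/100000) (kern (16/25)) (517031/1000000)"
    using kern_phase1[OF r(1,2)] X by linarith
  show A1: "encl (- (969329/1000000)) (sin_coord (16/25)) (- (969327/1000000))"
    using coord_phase1(1)[OF r(1,2)] K1 s c by linarith
  show B1: "encl (- (144391/1000000)) (cos_coord (16/25)) (- (144389/1000000))"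
    using coord_phase1(2)[OF r(1,2)] K1 s c by linarith
  have XE: "encl (110885337/20000000) (exp_delay * exp (8/25 * (16/25) :: real)) (554426747/100000000)"
    by (rule mult_enclosure[OF exp_delay_enclosure X]) (simp_all add: prod_simps)
  show K2: "encl (- (8496747/1000000)) (kern (delay + (16/25))) (- (1699349/200000))"
    using kern_phase2[OF r(1,2)] X XE by linarith
  show A2: "encl (8169741/1000000) (sin_coord (delay + (16/25))) (8169747/1000000)"
    using sin_coord_step[OF r(3,4)] A1 B1 K2 s c by linarith
  show B2: "encl (- (635511/200000)) (cos_coord (delay + (16/25))) (- (3177551/1000000))"
    using cos_coord_step[OF r(3,4)] A1 B1 K2 s c by linarith
qed

lemma point_67:
  "encl (- (964791/1000000)) (sin_coord (67/100)) (- (964789/1000000))"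
  "encl (- (158269/1000000)) (cos_coord (67/100)) (- (39567/250000))"
  "encl (129144/15625) (sin_coord (delay + (67/100))) (413261/50000)"
  "encl (- (3187391/1000000)) (cos_coord (delay + (67/100))) (- (3187387/1000000))"
proof -
  have X: "encl (6195591/5000000) (exp (8/25 * (67/100) :: real)) (123911821/100000000)"
    by (rule exp_enclosure8[where l = "(10271623497/10000000000)" and u = "(5135811749/5000000000)"], rule exp_enclosure) (simp_all add: power_divide)
  have s: "encl (31049299/50000000) (sin ((67/100) :: real)) (62098599/100000000)"
    by (rule sin_enclosure) (simp_all add: power_divide)
  have c: "encl (39191083/50000000) (cos ((67/100) :: real)) (78382167/100000000)"
    by (rule cos_enclosure) (simp_all add: power_divide)
  have r: "0 \<le> ((67/100) :: real)" "(67/100) \<le> delay" "- delay \<le> (67/100)" "(67/100) \<le> 2 * delay" "- delay \<le> delay + (67/100)" "delay + (67/100) \<le> 2 * delay"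
    using delay_enclosure by linarith+
  have K1: "encl (491873/1000000) (kern (67/100)) (245937/500000)"
    using kern_phase1[OF r(1,2)] X by linarith
  show A1: "encl (- (964791/1000000)) (sin_coord (67/100)) (- (964789/1000000))"
    using coord_phase1(1)[OF r(1,2)] K1 s c by linarith
  show B1: "encl (- (158269/1000000)) (cos_coord (67/100)) (- (39567/250000))"
    using coord_phase1(2)[OF r(1,2)] K1 s c by linarith
  have XE: "encl (139943703/25000000) (exp_delay * exp (8/25 * (67/100) :: real)) (4478199/800000)"
    by (rule mult_enclosure[OF exp_delay_enclosure X]) (simp_all add: prod_simps)
  have K2: "encl (- (2148479/250000)) (kern (delay + (67/100))) (- (4296957/500000))"
    using kern_phase2[OF r(1,2)] X XE by linarith
  show A2: "encl (129144/15625) (sin_coord (delay + (67/100))) (413261/50000)"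
    using sin_coord_step[OF r(3,4)] A1 B1 K2 s c by linarith
  show B2: "encl (- (3187391/1000000)) (cos_coord (delay + (67/100))) (- (3187387/1000000))"
    using cos_coord_step[OF r(3,4)] A1 B1 K2 s c by linarith
qed

lemma point_190:
  "encl (- (778103/1000000)) (kern (19/10)) (- (389051/500000))"
  "encl (- (28997/125000)) (sin_coord (19/10)) (- (115987/500000))"
  "encl (- (572803/500000)) (cos_coord (19/10)) (- (286401/250000))"
  "encl (12432411/1000000) (sin_coord (delay + (19/10))) (12432417/1000000)"
  "encl (- (1783433/500000)) (cos_coord (delay + (19/10))) (- (3566861/1000000))"
proof -
  have X: "encl (183675421/100000000) (exp (8/25 * (19/10) :: real)) (91837711/50000000)"
    by (rule exp_enclosure8[where l = "(10789625741/10000000000)" and u = "(5394812871/5000000000)"], rule exp_enclosure) (simp_all add: power_divide)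
  have s: "encl (11828751/12500000) (sin ((19/10) :: real)) (23657503/25000000)"
    by (rule sin_enclosure) (simp_all add: power_divide)
  have c: "encl (- (32328957/100000000)) (cos ((19/10) :: real)) (- (16164469/50000000))"
    by (rule cos_enclosure) (simp_all add: power_divide)
  have r: "0 \<le> ((19/10) :: real)" "(19/10) \<le> delay" "- delay \<le> (19/10)" "(19/10) \<le> 2 * delay" "- delay \<le> delay + (19/10)" "delay + (19/10) \<le> 2 * delay"
    using delay_enclosure by linarith+
  show K1: "encl (- (778103/1000000)) (kern (19/10)) (- (389051/500000))"
    using kern_phase1[OF r(1,2)] X by linarith
  show A1: "encl (- (28997/125000)) (sin_coord (19/10)) (- (115987/500000))"
    using coord_phase1(1)[OF r(1,2)] K1 s c by linarith
  show B1: "encl (- (572803/500000)) (cos_coord (19/10)) (- (286401/250000))"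
    using coord_phase1(2)[OF r(1,2)] K1 s c by linarith
  have XE: "encl (829758407/100000000) (exp_delay * exp (8/25 * (19/10) :: real)) (829758497/100000000)"
    by (rule mult_enclosure[OF exp_delay_enclosure X]) (simp_all add: prod_simps)
  have K2: "encl (- (3162011/250000)) (kern (delay + (19/10))) (- (12648041/1000000))"
    using kern_phase2[OF r(1,2)] X XE by linarith
  show A2: "encl (12432411/1000000) (sin_coord (delay + (19/10))) (12432417/1000000)"
    using sin_coord_step[OF r(3,4)] A1 B1 K2 s c by linarith
  show B2: "encl (- (1783433/500000)) (cos_coord (delay + (19/10))) (- (3566861/1000000))"
    using cos_coord_step[OF r(3,4)] A1 B1 K2 s c by linarith
qed

lemma point_152:
  "encl (11094941/1000000) (sin_coord (delay + (38/25))) (11094947/1000000)"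
  "encl (- (3467113/1000000)) (cos_coord (delay + (38/25))) (- (3467109/1000000))"
  "encl (- (6413629/500000)) (kern (2 * delay + (38/25))) (- (12827241/1000000))"
  "encl (18607407/1000000) (sin_coord (2 * delay + (38/25))) (4651857/250000)"
  "encl (2553019/500000) (cos_coord (2 * delay + (38/25))) (102121/20000)"
proof -
  have X: "encl (40661261/25000000) (exp (8/25 * (38/25) :: real)) (32529009/20000000)"
    by (rule exp_enclosure8[where l = "(2656715889/2500000000)" and u = "(10626863557/10000000000)"], rule exp_enclosure) (simp_all add: power_divide)
  have s: "encl (49935507/50000000) (sin ((38/25) :: real)) (19974203/20000000)"
    by (rule sin_enclosure) (simp_all add: power_divide)
  have c: "encl (634681/12500000) (cos ((38/25) :: real)) (101549/2000000)"
    by (rule cos_enclosure) (simp_all add: power_divide)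
  have r: "0 \<le> ((38/25) :: real)" "(38/25) \<le> delay" "- delay \<le> (38/25)" "(38/25) \<le> 2 * delay" "- delay \<le> delay + (38/25)" "delay + (38/25) \<le> 2 * delay"
    using delay_enclosure by linarith+
  have K1: "encl (- (41401/125000)) (kern (38/25)) (- (331207/1000000))"
    using kern_phase1[OF r(1,2)] X by linarith
  have A1: "encl (- (595853/1000000)) (sin_coord (38/25)) (- (595851/1000000))"
    using coord_phase1(1)[OF r(1,2)] K1 s c by linarith
  have B1: "encl (- (774801/1000000)) (cos_coord (38/25)) (- (1937/2500))"
    using coord_phase1(2)[OF r(1,2)] K1 s c by linarith
  have XE: "encl (734753141/100000000) (exp_delay * exp (8/25 * (38/25) :: real)) (367376611/50000000)"
    by (rule mult_enclosure[OF exp_delay_enclosure X]) (simp_all add: prod_simps)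
  have K2: "encl (- (5697547/500000)) (kern (delay + (38/25))) (- (11395091/1000000))"
    using kern_phase2[OF r(1,2)] X XE by linarith
  show A2: "encl (11094941/1000000) (sin_coord (delay + (38/25))) (11094947/1000000)"
    using sin_coord_step[OF r(3,4)] A1 B1 K2 s c by linarith
  show B2: "encl (- (3467113/1000000)) (cos_coord (delay + (38/25))) (- (3467109/1000000))"
    using cos_coord_step[OF r(3,4)] A1 B1 K2 s c by linarith
  have D: "encl (19486297/100000000) (delay - exp_delay) (194863431/1000000000)"
    using delay_enclosure exp_delay_enclosure by linarith
  have W: "encl (143176179/100000000) ((delay - exp_delay) * (exp_delay * exp (8/25 * (38/25) :: real))) (71588267/50000000)"
    by (rule mult_enclosure[OF D XE]) (simp_all add: prod_simps)
  show K3: "encl (- (6413629/500000)) (kern (2 * delay + (38/25))) (- (12827241/1000000))"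
    using kern_phase3[OF r(1)] X XE W by linarith
  have e: "delay + (delay + (38/25)) = 2 * delay + (38/25)" "sin (delay + (38/25)) = - cos (38/25)" "cos (delay + (38/25)) = sin (38/25)"
    by (simp_all add: sin_add_delay cos_add_delay)
  show A3: "encl (18607407/1000000) (sin_coord (2 * delay + (38/25))) (4651857/250000)"
    using sin_coord_step[OF r(5,6), unfolded e] A2 B2 K3 s c by linarith
  show B3: "encl (2553019/500000) (cos_coord (2 * delay + (38/25))) (102121/20000)"
    using cos_coord_step[OF r(5,6), unfolded e] A2 B2 K3 s c by linarith
qed

lemma point_156:
  "encl (1404233/125000) (sin_coord (delay + (39/25))) (11233871/1000000)"
  "encl (- (1739497/500000)) (cos_coord (delay + (39/25))) (- (3478989/1000000))"
  "encl (18398517/1000000) (sin_coord (2 * delay + (39/25))) (919927/50000)"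
  "encl (533899/100000) (cos_coord (2 * delay + (39/25))) (1334751/250000)"
proof -
  have X: "encl (164740281/100000000) (exp (8/25 * (39/25) :: real)) (164740283/100000000)"
    by (rule exp_enclosure8[where l = "(10643880147/10000000000)" and u = "(2660970037/2500000000)"], rule exp_enclosure) (simp_all add: power_divide)
  have s: "encl (24998543/25000000) (sin ((39/25) :: real)) (99994173/100000000)"
    by (rule sin_enclosure) (simp_all add: power_divide)
  have c: "encl (1079611/100000000) (cos ((39/25) :: real)) (1079613/100000000)"
    by (rule cos_enclosure) (simp_all add: power_divide)
  have r: "0 \<le> ((39/25) :: real)" "(39/25) \<le> delay" "- delay \<le> (39/25)" "(39/25) \<le> 2 * delay" "- delay \<le> delay + (39/25)" "delay + (39/25) \<le> 2 * delay"
    using delay_enclosure by linarith+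
  have K1: "encl (- (93933/250000)) (kern (39/25)) (- (37573/100000))"
    using kern_phase1[OF r(1,2)] X by linarith
  have A1: "encl (- (141029/250000)) (sin_coord (39/25)) (- (564113/1000000))"
    using coord_phase1(1)[OF r(1,2)] K1 s c by linarith
  have B1: "encl (- (812143/1000000)) (cos_coord (39/25)) (- (812141/1000000))"
    using coord_phase1(2)[OF r(1,2)] K1 s c by linarith
  have XE: "encl (186054607/25000000) (exp_delay * exp (8/25 * (39/25) :: real)) (372109257/50000000)"
    by (rule mult_enclosure[OF exp_delay_enclosure X]) (simp_all add: prod_simps)
  have K2: "encl (- (11527663/1000000)) (kern (delay + (39/25))) (- (576383/50000))"
    using kern_phase2[OF r(1,2)] X XE by linarith
  show A2: "encl (1404233/125000) (sin_coord (delay + (39/25))) (11233871/1000000)"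
    using sin_coord_step[OF r(3,4)] A1 B1 K2 s c by linarith
  show B2: "encl (- (1739497/500000)) (cos_coord (delay + (39/25))) (- (3478989/1000000))"
    using cos_coord_step[OF r(3,4)] A1 B1 K2 s c by linarith
  have D: "encl (19486297/100000000) (delay - exp_delay) (194863431/1000000000)"
    using delay_enclosure exp_delay_enclosure by linarith
  have W: "encl (145020613/100000000) ((delay - exp_delay) * (exp_delay * exp (8/25 * (39/25) :: real))) (72510487/50000000)"
    by (rule mult_enclosure[OF D XE]) (simp_all add: prod_simps)
  have K3: "encl (- (6265553/500000)) (kern (2 * delay + (39/25))) (- (12531089/1000000))"
    using kern_phase3[OF r(1)] X XE W by linarith
  have e: "delay + (delay + (39/25)) = 2 * delay + (39/25)" "sin (delay + (39/25)) = - cos (39/25)" "cos (delay + (39/25)) = sin (39/25)"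
    by (simp_all add: sin_add_delay cos_add_delay)
  show A3: "encl (18398517/1000000) (sin_coord (2 * delay + (39/25))) (919927/50000)"
    using sin_coord_step[OF r(5,6), unfolded e] A2 B2 K3 s c by linarith
  show B3: "encl (533899/100000) (cos_coord (2 * delay + (39/25))) (1334751/250000)"
    using cos_coord_step[OF r(5,6), unfolded e] A2 B2 K3 s c by linarith
qed

lemma point_148:
  "encl (18807049/1000000) (sin_coord (2 * delay + (37/25))) (1880707/100000)"
  "encl (243829/50000) (cos_coord (2 * delay + (37/25))) (4876591/1000000)"
proof -
  have X: "encl (32115291/20000000) (exp (8/25 * (37/25) :: real)) (20072057/12500000)"
    by (rule exp_enclosure8[where l = "(1060987417/1000000000)" and u = "(10609874171/10000000000)"], rule exp_enclosure) (simp_all add: power_divide)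
  have s: "encl (24897021/25000000) (sin ((37/25) :: real)) (19917617/20000000)"
    by (rule sin_enclosure) (simp_all add: power_divide)
  have c: "encl (4533581/50000000) (cos ((37/25) :: real)) (9067163/100000000)"
    by (rule cos_enclosure) (simp_all add: power_divide)
  have r: "0 \<le> ((37/25) :: real)" "(37/25) \<le> delay" "- delay \<le> (37/25)" "(37/25) \<le> 2 * delay" "- delay \<le> delay + (37/25)" "delay + (37/25) \<le> 2 * delay"
    using delay_enclosure by linarith+
  have K1: "encl (- (1149/4000)) (kern (37/25)) (- (287249/1000000))"
    using kern_phase1[OF r(1,2)] X by linarith
  have A1: "encl (- (626107/1000000)) (sin_coord (37/25)) (- (125221/200000))"
    using coord_phase1(1)[OF r(1,2)] K1 s c by linarith
  have B1: "encl (- (73799/100000)) (cos_coord (37/25)) (- (737989/1000000))"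
    using coord_phase1(2)[OF r(1,2)] K1 s c by linarith
  have XE: "encl (362704119/50000000) (exp_delay * exp (8/25 * (37/25) :: real)) (725408317/100000000)"
    by (rule mult_enclosure[OF exp_delay_enclosure X]) (simp_all add: prod_simps)
  have K2: "encl (- (11262453/1000000)) (kern (delay + (37/25))) (- (225249/20000))"
    using kern_phase2[OF r(1,2)] X XE by linarith
  have A2: "encl (10956499/1000000) (sin_coord (delay + (37/25))) (1369563/125000)"
    using sin_coord_step[OF r(3,4)] A1 B1 K2 s c by linarith
  have B2: "encl (- (345499/100000)) (cos_coord (delay + (37/25))) (- (1727493/500000))"
    using cos_coord_step[OF r(3,4)] A1 B1 K2 s c by linarith
  have D: "encl (19486297/100000000) (delay - exp_delay) (194863431/1000000000)"
    using delay_enclosure exp_delay_enclosure by linarith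
  have W: "encl (141355203/100000000) ((delay - exp_delay) * (exp_delay * exp (8/25 * (37/25) :: real))) (70677777/50000000)"
    by (rule mult_enclosure[OF D XE]) (simp_all add: prod_simps)
  have K3: "encl (- (13114373/1000000)) (kern (2 * delay + (37/25))) (- (13114357/1000000))"
    using kern_phase3[OF r(1)] X XE W by linarith
  have e: "delay + (delay + (37/25)) = 2 * delay + (37/25)" "sin (delay + (37/25)) = - cos (37/25)" "cos (delay + (37/25)) = sin (37/25)"
    by (simp_all add: sin_add_delay cos_add_delay)
  show A3: "encl (18807049/1000000) (sin_coord (2 * delay + (37/25))) (1880707/100000)"
    using sin_coord_step[OF r(5,6), unfolded e] A2 B2 K3 s c by linarith
  show B3: "encl (243829/50000) (cos_coord (2 * delay + (37/25))) (4876591/1000000)"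
    using cos_coord_step[OF r(5,6), unfolded e] A2 B2 K3 s c by linarith
qed

lemma point_60:
  "encl (2114367/100000) (sin_coord (2 * delay + (3/5))) (4228737/200000)"
  "encl (715693/1000000) (cos_coord (2 * delay + (3/5))) (357851/500000)"
proof -
  have X: "encl (121167051/100000000) (exp (8/25 * (3/5) :: real)) (30291763/25000000)"
    by (rule exp_enclosure8[where l = "(5121451589/5000000000)" and u = "(10242903179/10000000000)"], rule exp_enclosure) (simp_all add: power_divide)
  have s: "encl (56464247/100000000) (sin ((3/5) :: real)) (7058031/12500000)"
    by (rule sin_enclosure) (simp_all add: power_divide)
  have c: "encl (82533561/100000000) (cos ((3/5) :: real)) (41266781/50000000)"
    by (rule cos_enclosure) (simp_all add: power_divide)
  have r: "0 \<le> ((3/5) :: real)" "(3/5) \<le> delay" "- delay \<le> (3/5)" "(3/5) \<le> 2 * delay" "- delay \<le> delay + (3/5)" "delay + (3/5) \<le> 2 * delay"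
    using delay_enclosure by linarith+
  have K1: "encl (2751/5000) (kern (3/5)) (550201/1000000)"
    using kern_phase1[OF r(1,2)] X by linarith
  have A1: "encl (- (974751/1000000)) (sin_coord (3/5)) (- (974749/1000000))"
    using coord_phase1(1)[OF r(1,2)] K1 s c by linarith
  have B1: "encl (- (31713/250000)) (cos_coord (3/5)) (- (126851/1000000))"
    using coord_phase1(2)[OF r(1,2)] K1 s c by linarith
  have XE: "encl (34210953/6250000) (exp_delay * exp (8/25 * (3/5) :: real)) (547375309/100000000)"
    by (rule mult_enclosure[OF exp_delay_enclosure X]) (simp_all add: prod_simps)
  have K2: "encl (- (836747/100000)) (kern (delay + (3/5))) (- (2091867/250000))"
    using kern_phase2[OF r(1,2)] X XE by linarith
  have A2: "encl (80429/10000) (sin_coord (delay + (3/5))) (1005363/125000)"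
    using sin_coord_step[OF r(3,4)] A1 B1 K2 s c by linarith
  have B2: "encl (- (791131/250000)) (cos_coord (delay + (3/5))) (- (79113/25000))"
    using cos_coord_step[OF r(3,4)] A1 B1 K2 s c by linarith
  have D: "encl (19486297/100000000) (delay - exp_delay) (194863431/1000000000)"
    using delay_enclosure exp_delay_enclosure by linarith
  have W: "encl (53331583/50000000) ((delay - exp_delay) * (exp_delay * exp (8/25 * (3/5) :: real))) (106663431/100000000)"
    by (rule mult_enclosure[OF D XE]) (simp_all add: prod_simps)
  have K3: "encl (- (17366181/1000000)) (kern (2 * delay + (3/5))) (- (1736617/100000))"
    using kern_phase3[OF r(1)] X XE W by linarith
  have e: "delay + (delay + (3/5)) = 2 * delay + (3/5)" "sin (delay + (3/5)) = - cos (3/5)" "cos (delay + (3/5)) = sin (3/5)"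
    by (simp_all add: sin_add_delay cos_add_delay)
  show A3: "encl (2114367/100000) (sin_coord (2 * delay + (3/5))) (4228737/200000)"
    using sin_coord_step[OF r(5,6), unfolded e] A2 B2 K3 s c by linarith
  show B3: "encl (715693/1000000) (cos_coord (2 * delay + (3/5))) (357851/500000)"
    using cos_coord_step[OF r(5,6), unfolded e] A2 B2 K3 s c by linarith
qed

text \<open>The suffix is a hundred times the initial value \<open>p\<close>, and \<open>sin q = 1 - 17/25 * p\<close>; moreover
  \<open>ftilde r = 9/10\<close>.\<close>

lemma threshold_121:
  assumes q: "sin q = (443/2500)" "0 \<le> cos q" "- (pi/2) \<le> q" "q \<le> pi/2"
  shows "crest 1 < threshold q"
proof -
  have sq: "encl (443/2500) (sin q) (443/2500)" using q(1) by simp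
  have cq: "encl (2460437/2500000) (cos q) (9841749/10000000)"
    by (rule cos_of_sin[OF q(1,2)]) simp_all
  have l: "encl (- (90411/200000)) (lsol q (q + (delay + (19/10)))) (- (113011/250000))"
    by (rule lsol_enclosure[OF sq cq point_190(4) point_190(5)]) (simp_all add: prod_simps)
  have sr: "encl (11828751/12500000) (sin ((19/10) :: real)) (23657503/25000000)"
    by (rule sin_enclosure) (simp_all add: power_divide)
  have cr: "encl (- (32328957/100000000)) (cos ((19/10) :: real)) (- (16164469/50000000))"
    by (rule cos_enclosure) (simp_all add: power_divide)
  have st: "encl (8740377/10000000) (sin (q + (19/10))) (437019/500000)"
    by (rule sin_add_enclosure[OF sq cq sr cr]) (simp_all add: prod_simps)
  have ct: "encl (- (4858579/10000000)) (cos (q + (19/10))) (- (303661/625000))"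
    by (rule cos_add_enclosure[OF sq cq sr cr]) (simp_all add: prod_simps)
  have z: "encl (2294387/1000000) (scaled q (q + (delay + (19/10)))) (2294399/1000000)"
    using scaled_delay(1)[of q "(19/10)"] st ct l by linarith
  have ql: "(89/500) \<le> q"
  proof (rule le_of_sin_le[OF _ q(3,4)])
    have "encl (354123/2000000) (sin ((89/500) :: real)) (221327/1250000)" by (rule sin_enclosure) (simp_all add: power_divide)
    then show "sin (89/500) \<le> sin q" unfolding q(1) by linarith
  qed (use half_pi_bounds in linarith)+
  have qu: "q \<le> (9/50)"
  proof (rule ge_of_sin_ge[OF _ q(3,4)])
    have "encl (358059/2000000) (sin ((9/50) :: real)) (223787/1250000)" by (rule sin_enclosure) (simp_all add: power_divide)
    then show "sin q \<le> sin (9/50)" unfolding q(1) by linarith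
  qed (use half_pi_bounds in linarith)+
  have w: "encl (- (1163373/1000000)) (slope q (q + (19/10))) (- (1163367/1000000))"
    by (rule slope_enclosure[OF sq cq point_190(1) point_190(2) point_190(3)]) (simp_all add: prod_simps)
  have lv: "level q (q + (delay + (19/10))) \<le> threshold q"
  proof (rule level_le_threshold_late)
    have "q + (delay + (19/10)) - delay = q + (19/10)" by simp
    then show "slope q (q + (delay + (19/10)) - delay) < 0 \<or> q + (delay + (19/10)) - delay \<le> pi/2" using w by simp
    show "q < pi/2" by (rule less_half_pi[OF q(1) _ q(4)]) simp
  qed (use ql qu delay_enclosure in linarith)+
  have x: "encl (6441/3125) (exp ((2893/4000) :: real)) (206113/100000)"
    by (rule exp_enclosure8[where l = "(10946188823/10000000000)" and u = "(1368273603/1250000000)"], rule exp_enclosure) (simp_all add: power_divide)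
  show ?thesis
    by (rule crest_less_threshold[OF lv _ conjunct2[OF x]])
      (use z ql pi_approx in \<open>simp_all add: delay_def\<close>)
qed

lemma threshold_262:
  assumes q: "sin q = (- (977/1250))" "0 \<le> cos q" "- (pi/2) \<le> q" "q \<le> pi/2"
  shows "crest 2 < threshold q"
proof -
  have sq: "encl (- (977/1250)) (sin q) (- (977/1250))" using q(1) by simp
  have cq: "encl (6237799/10000000) (cos q) (31189/50000)"
    by (rule cos_of_sin[OF q(1,2)]) simp_all
  have l: "encl (- (15673079/1000000)) (lsol q (q + (2 * delay + (37/25)))) (- (15673043/1000000))"
    by (rule lsol_enclosure[OF sq cq point_148(1) point_148(2)]) (simp_all add: prod_simps)
  have sr: "encl (24897021/25000000) (sin ((37/25) :: real)) (19917617/20000000)"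
    by (rule sin_enclosure) (simp_all add: power_divide)
  have cr: "encl (4533581/50000000) (cos ((37/25) :: real)) (9067163/100000000)"
    by (rule cos_enclosure) (simp_all add: power_divide)
  have st: "encl (1100683/2000000) (sin (q + (37/25))) (5503417/10000000)"
    by (rule sin_add_enclosure[OF sq cq sr cr]) (simp_all add: prod_simps)
  have ct: "encl (1669879/2000000) (cos (q + (37/25))) (8349397/10000000)"
    by (rule cos_add_enclosure[OF sq cq sr cr]) (simp_all add: prod_simps)
  have z: "encl (4207149/250000) (scaled q (q + (2 * delay + (37/25)))) (16828633/1000000)"
    using scaled_delay(2)[of q "(37/25)"] st ct l by linarith
  have ql: "(- (8973/10000)) \<le> q"
  proof (rule le_of_sin_le[OF _ q(3,4)])
    have "encl (- (3908229/5000000)) (sin ((- (8973/10000)) :: real)) (- (7816457/10000000))" by (rule sin_enclosure) (simp_all add: power_divide)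
    then show "sin (- (8973/10000)) \<le> sin q" unfolding q(1) by linarith
  qed (use half_pi_bounds in linarith)+
  have qu: "q \<le> 0"
  proof (rule ge_of_sin_ge[OF _ q(3,4)])
    have "encl 0 (sin (0 :: real)) 0" by (rule sin_enclosure) (simp_all add: power_divide)
    then show "sin q \<le> sin 0" unfolding q(1) by linarith
  qed (use half_pi_bounds in linarith)+
  have lv: "level q (q + (2 * delay + (37/25))) \<le> threshold q"
    by (rule level_le_threshold_nonpos[OF q(3)]) (use ql qu delay_enclosure in linarith)+
  have x: "encl (414497/25000) (exp ((280819/100000) :: real)) (1657989/100000)"
    by (rule exp_enclosure8[where l = "(3551302657/2500000000)" and u = "(14205210629/10000000000)"], rule exp_enclosure) (simp_all add: power_divide)
  show ?thesis
    by (rule crest_less_threshold[OF lv _ conjunct2[OF x]])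
      (use z ql pi_approx in \<open>simp_all add: delay_def\<close>)
qed

text \<open>\<open>ret_val\<close> sends \<open>bump (r + 2 * pi)\<close> to
  \<open>ftilde r = 9/10\<close>. Dividing by \<open>growth\<close> shows that the return value at
  111/50 is below 9/10; this is the input for the second iterate of 0.\<close>

lemma threshold_222:
  assumes q: "sin q = (- (637/1250))" "0 \<le> cos q" "- (pi/2) \<le> q" "q \<le> pi/2"
    and r: "sin r = (97/250)" "0 \<le> cos r" "- (pi/2) \<le> r" "r \<le> pi/2"
  shows "growth * bump (r + 2 * pi) < threshold q"
proof -
  have sq: "encl (- (637/1250)) (sin q) (- (637/1250))" using q(1) by simp
  have cq: "encl (4302057/5000000) (cos q) (1720823/2000000)"
    by (rule cos_of_sin[OF q(1,2)]) simp_all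
  have l: "encl (- (3367291/250000)) (lsol q (q + (2 * delay + (3/5)))) (- (13469141/1000000))"
    by (rule lsol_enclosure[OF sq cq point_60(1) point_60(2)]) (simp_all add: prod_simps)
  have sr: "encl (56464247/100000000) (sin ((3/5) :: real)) (7058031/12500000)"
    by (rule sin_enclosure) (simp_all add: power_divide)
  have cr: "encl (82533561/100000000) (cos ((3/5) :: real)) (41266781/50000000)"
    by (rule cos_enclosure) (simp_all add: power_divide)
  have st: "encl (652337/10000000) (sin (q + (3/5))) (652339/10000000)"
    by (rule sin_add_enclosure[OF sq cq sr cr]) (simp_all add: prod_simps)
  have ct: "encl (9978699/10000000) (cos (q + (3/5))) (9978701/10000000)"
    by (rule cos_add_enclosure[OF sq cq sr cr]) (simp_all add: prod_simps)
  have z: "encl (14287711/1000000) (scaled q (q + (2 * delay + (3/5)))) (2857547/200000)"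
    using scaled_delay(2)[of q "(3/5)"] st ct l by linarith
  have ql: "(- (1337/2500)) \<le> q"
  proof (rule le_of_sin_le[OF _ q(3,4)])
    have "encl (- (509669/1000000)) (sin ((- (1337/2500)) :: real)) (- (5096689/10000000))" by (rule sin_enclosure) (simp_all add: power_divide)
    then show "sin (- (1337/2500)) \<le> sin q" unfolding q(1) by linarith
  qed (use half_pi_bounds in linarith)+
  have qu: "q \<le> 0"
  proof (rule ge_of_sin_ge[OF _ q(3,4)])
    have "encl 0 (sin (0 :: real)) 0" by (rule sin_enclosure) (simp_all add: power_divide)
    then show "sin q \<le> sin 0" unfolding q(1) by linarith
  qed (use half_pi_bounds in linarith)+
  have lv: "level q (q + (2 * delay + (3/5))) \<le> threshold q"
    by (rule level_le_threshold_nonpos[OF q(3)]) (use ql qu delay_enclosure in linarith)+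
  have c9: "encl (9216593/10000000) (cos r) (4608297/5000000)"
    by (rule cos_of_sin[OF r(1,2)]) simp_all
  have ru: "r \<le> (399/1000)"
  proof (rule ge_of_sin_ge[OF _ r(3,4)])
    have "encl (388497/1000000) (sin ((399/1000) :: real)) (3884971/10000000)" by (rule sin_enclosure) (simp_all add: power_divide)
    then show "sin r \<le> sin (399/1000)" unfolding r(1) by linarith
  qed (use half_pi_bounds in linarith)+
  have x: "encl (265641/25000) (exp ((236327/100000) :: real)) (212513/20000)"
    by (rule exp_enclosure8[where l = "(13436754737/10000000000)" and u = "(13436754739/10000000000)"], rule exp_enclosure) (simp_all add: power_divide)
  have tr: "cos (r + 2 * pi + 2 * pi * real 1) = cos r" "sin (r + 2 * pi + 2 * pi * real 1) = (97/250)"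
    unfolding sin_cos_period cos_periodic sin_periodic by (simp_all only: r(1))
  have "bump (r + 2 * pi + 2 * pi * real 1) < threshold q"
    by (rule bump_less_threshold[OF lv _ conjunct2[OF x], where w = "(126841049/125000000)"])
      (unfold tr, use z c9 ql ru pi_approx in \<open>simp_all add: delay_def\<close>)
  then show ?thesis unfolding bump_shift by simp
qed

text \<open>Serves two purposes: up to 101/100 the return value exceeds 9/10, and since
  \<open>bump (r + 2 * pi)\<close> is at most \<open>crest 1\<close>, the first jump lies beyond
  101/100.\<close>

lemma threshold_101:
  assumes q: "sin q = (783/2500)" "0 \<le> cos q" "- (pi/2) \<le> q" "q \<le> pi/2"
    and r: "sin r = (97/250)" "0 \<le> cos r" "- (pi/2) \<le> r" "r \<le> pi/2"
  shows "threshold q < bump (r + 2 * pi)"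
proof -
  have sq: "encl (783/2500) (sin q) (783/2500)" using q(1) by simp
  have cq: "encl (9496871/10000000) (cos q) (1187109/1250000)"
    by (rule cos_of_sin[OF q(1,2)]) simp_all
  have l: "encl (159141/200000) (lsol q (q + (delay + (16/25)))) (159143/200000)"
    by (rule lsol_enclosure[OF sq cq point_64(4) point_64(5)]) (simp_all add: prod_simps)
  have sr: "encl (7464943/12500000) (sin ((16/25) :: real)) (11943909/20000000)"
    by (rule sin_enclosure) (simp_all add: power_divide)
  have cr: "encl (3208383/4000000) (cos ((16/25) :: real)) (10026197/12500000)"
    by (rule cos_enclosure) (simp_all add: power_divide)
  have st: "encl (8183651/10000000) (sin (q + (16/25))) (8183653/10000000)"
    by (rule sin_add_enclosure[OF sq cq sr cr]) (simp_all add: prod_simps)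
  have ct: "encl (5746983/10000000) (cos (q + (16/25))) (1149397/2000000)"
    by (rule cos_add_enclosure[OF sq cq sr cr]) (simp_all add: prod_simps)
  have z: "encl (300341/200000) (scaled q (q + (delay + (16/25)))) (1501717/1000000)"
    using scaled_delay(1)[of q "(16/25)"] st ct l by linarith
  have m: "encl (82247/100000) (lsol q (q + (16/25))) (32899/40000)"
    by (rule lsol_enclosure[OF sq cq point_64(1) point_64(2)]) (simp_all add: prod_simps)
  have eg: "q + (delay + (16/25)) - delay = q + (16/25)" "q + (delay + (67/100)) - delay = q + (67/100)" by simp_all
  have g: "encl (- (2677/100000)) (gain q (q + (delay + (16/25)))) (- (5351/200000))"
    unfolding gain_def eg using l m by linarith
  have k: "encl (412971/500000) (lsol q (q + (delay + (67/100)))) (825951/1000000)"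
    by (rule lsol_enclosure[OF sq cq point_67(3) point_67(4)]) (simp_all add: prod_simps)
  have n: "encl (402589/500000) (lsol q (q + (67/100))) (805181/1000000)"
    by (rule lsol_enclosure[OF sq cq point_67(1) point_67(2)]) (simp_all add: prod_simps)
  have h: "0 < gain q (q + (delay + (67/100)))"
    unfolding gain_def eg using k n by linarith
  have w: "encl (201369/200000) (slope q (q + (delay + (16/25)))) (1006861/1000000)"
    by (rule slope_enclosure[OF sq cq point_64(3) point_64(4) point_64(5)]) (simp_all add: prod_simps)
  have qu: "q \<le> (3187/10000)"
  proof (rule ge_of_sin_ge[OF _ q(3,4)])
    have "encl (1566661/5000000) (sin ((3187/10000) :: real)) (3133323/10000000)" by (rule sin_enclosure) (simp_all add: power_divide)
    then show "sin q \<le> sin (3187/10000)" unfolding q(1) by linarith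
  qed (use half_pi_bounds in linarith)+
  have ql: "(3/10) \<le> q"
  proof (rule le_of_sin_le[OF _ q(3,4)])
    have "encl (1477601/5000000) (sin ((3/10) :: real)) (2955203/10000000)" by (rule sin_enclosure) (simp_all add: power_divide)
    then show "sin (3/10) \<le> sin q" unfolding q(1) by linarith
  qed (use half_pi_bounds in linarith)+
  have qp: "q < pi/2" by (rule less_half_pi[OF q(1) _ q(4)]) simp
  have e: "q + (delay + (67/100)) = q + (delay + (16/25)) + (3/100)" by simp
  \<comment> \<open>The signs of the gain place the hit between the offsets
    \<open>delay + 16/25\<close> and \<open>delay + 67/100\<close>, and 2677/100000 bounds the gain
    at the first of them.\<close>
  have t: "threshold q \<le> level q (q + (delay + (16/25))) + exp (17/25 * (q + (delay + (16/25)) + (3/100))) * (2677/100000) * (q + (delay + (16/25)) + (3/100) - (q + (delay + (16/25))))"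
    by (rule threshold_le_late[OF _ qp]) (use g h[unfolded e] w ql qu delay_enclosure half_pi_bounds in linarith)+
  have xd: "encl (1020609/1000000) (exp (17/25 * (3/100) :: real)) (102061/100000)"
    by (rule exp_enclosure) (simp_all add: power_divide)
  have c9: "encl (9216593/10000000) (cos r) (4608297/5000000)"
    by (rule cos_of_sin[OF r(1,2)]) simp_all
  have rl: "(199/500) \<le> r"
  proof (rule le_of_sin_le[OF _ r(3,4)])
    have "encl (1937877/5000000) (sin ((199/500) :: real)) (775151/2000000)" by (rule sin_enclosure) (simp_all add: power_divide)
    then show "sin (199/500) \<le> sin r" unfolding r(1) by linarith
  qed (use half_pi_bounds in linarith)+
  have x: "encl (99373/50000) (exp ((34343/50000) :: real)) (198747/100000)"
    by (rule exp_enclosure8[where l = "(10896510419/10000000000)" and u = "(544825521/500000000)"], rule exp_enclosure) (simp_all add: power_divide)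
  show ?thesis
    by (rule threshold_less_bump[OF t conjunct2[OF xd] _ _ conjunct1[OF x], where w = "(253682081/250000000)"])
      (use z c9 r(1) qu rl pi_approx in \<open>simp_all add: delay_def\<close>)
qed

lemma threshold_260:
  assumes q: "sin q = (- (96/125))" "0 \<le> cos q" "- (pi/2) \<le> q" "q \<le> pi/2"
  shows "threshold q < crest 2"
proof -
  have sq: "encl (- (96/125)) (sin q) (- (96/125))" using q(1) by simp
  have cq: "encl (3202249/5000000) (cos q) (6404499/10000000)"
    by (rule cos_of_sin[OF q(1,2)]) simp_all
  have l: "encl (- (73679/5000)) (lsol q (q + (2 * delay + (38/25)))) (- (14735763/1000000))"
    by (rule lsol_enclosure[OF sq cq point_152(4) point_152(5)]) (simp_all add: prod_simps)
  have sr: "encl (49935507/50000000) (sin ((38/25) :: real)) (19974203/20000000)"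
    by (rule sin_enclosure) (simp_all add: power_divide)
  have cr: "encl (634681/12500000) (cos ((38/25) :: real)) (101549/2000000)"
    by (rule cos_enclosure) (simp_all add: power_divide)
  have st: "encl (375393/625000) (sin (q + (38/25))) (6006291/10000000)"
    by (rule sin_add_enclosure[OF sq cq sr cr]) (simp_all add: prod_simps)
  have ct: "encl (3997639/5000000) (cos (q + (38/25))) (99941/125000)"
    by (rule cos_add_enclosure[OF sq cq sr cr]) (simp_all add: prod_simps)
  have z: "encl (15938913/1000000) (scaled q (q + (2 * delay + (38/25)))) (1992369/125000)"
    using scaled_delay(2)[of q "(38/25)"] st ct l by linarith
  have m: "encl (- (2865127/200000)) (lsol q (q + (delay + (38/25)))) (- (14325623/1000000))"
    by (rule lsol_enclosure[OF sq cq point_152(1) point_152(2)]) (simp_all add: prod_simps)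
  have eg: "q + (2 * delay + (38/25)) - delay = q + (delay + (38/25))" "q + (2 * delay + (39/25)) - delay = q + (delay + (39/25))" by simp_all
  have g: "encl (- (410177/1000000)) (gain q (q + (2 * delay + (38/25)))) (- (25633/62500))"
    unfolding gain_def eg using l m by linarith
  have k: "encl (- (3570119/250000)) (lsol q (q + (2 * delay + (39/25)))) (- (2856087/200000))"
    by (rule lsol_enclosure[OF sq cq point_156(3) point_156(4)]) (simp_all add: prod_simps)
  have n: "encl (- (14493727/1000000)) (lsol q (q + (delay + (39/25)))) (- (14493713/1000000))"
    by (rule lsol_enclosure[OF sq cq point_156(1) point_156(2)]) (simp_all add: prod_simps)
  have h: "0 < gain q (q + (2 * delay + (39/25)))"
    unfolding gain_def eg using k n by linarith
  have w: "encl (11210781/1000000) (slope q (q + (2 * delay + (38/25)))) (2802709/250000)"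
    by (rule slope_enclosure[OF sq cq point_152(3) point_152(4) point_152(5)]) (simp_all add: prod_simps)
  have qu: "q \<le> (- (8757/10000))"
  proof (rule ge_of_sin_ge[OF _ q(3,4)])
    have "encl (- (7679921/10000000)) (sin ((- (8757/10000)) :: real)) (- (95999/125000))" by (rule sin_enclosure) (simp_all add: power_divide)
    then show "sin q \<le> sin (- (8757/10000))" unfolding q(1) by linarith
  qed (use half_pi_bounds in linarith)+
  have ql: "(- (9/10)) \<le> q"
  proof (rule le_of_sin_le[OF _ q(3,4)])
    have "encl (- (783327/1000000)) (sin ((- (9/10)) :: real)) (- (7833269/10000000))" by (rule sin_enclosure) (simp_all add: power_divide)
    then show "sin (- (9/10)) \<le> sin q" unfolding q(1) by linarith
  qed (use half_pi_bounds in linarith)+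
  have e: "q + (2 * delay + (39/25)) = q + (2 * delay + (38/25)) + (1/25)" by simp
  have t: "threshold q \<le> level q (q + (2 * delay + (38/25))) + exp (17/25 * (q + (2 * delay + (38/25)) + (1/25))) * (410177/1000000) * (q + (2 * delay + (38/25)) + (1/25) - (q + (2 * delay + (38/25))))"
    by (rule threshold_le_nonpos[OF q(3)]) (use g h[unfolded e] w ql qu delay_enclosure half_pi_bounds in linarith)+
  have xd: "encl (1027573/1000000) (exp (17/25 * (1/25) :: real)) (513787/500000)"
    by (rule exp_enclosure) (simp_all add: power_divide)
  have x: "encl (1589969/100000) (exp ((27663/10000) :: real)) (158997/10000)"
    by (rule exp_enclosure8[where l = "(3532755749/2500000000)" and u = "(14131022997/10000000000)"], rule exp_enclosure) (simp_all add: power_divide)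
  show ?thesis
    by (rule threshold_less_crest[OF t conjunct2[OF xd] _ _ conjunct1[OF x]])
      (use z qu pi_approx in \<open>simp_all add: delay_def\<close>)
qed

text \<open>The value at 0 is \<open>ret_val (crest 0)\<close>, and \<open>ret_val\<close> inverts
  the passage from p to the bump one period after its start. Together with \<open>bump_222\<close>
  the comparison with \<open>crest 0\<close> therefore encloses the value at 0 between 111/50 and
  56/25.\<close>

lemma bump_224:
  assumes q: "sin q = (- (327/625))" "0 \<le> cos q" "- (pi/2) \<le> q" "q \<le> pi/2"
  shows "bump (q + 2 * pi) < crest 0"
proof -
  have cq: "encl (8522099/10000000) (cos q) (85221/100000)"
    by (rule cos_of_sin[OF q(1,2)]) simp_all
  have eq: "crest 0 = exp (17/25 * (pi/2)) * (15625/15538 * 1)" by (simp add: crest_def bump_def)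
  have qu: "q \<le> (- (2753/5000))"
  proof (rule ge_of_sin_ge[OF _ q(3,4)])
    have "encl (- (5231987/10000000)) (sin ((- (2753/5000)) :: real)) (- (2615993/5000000))" by (rule sin_enclosure) (simp_all add: power_divide)
    then show "sin q \<le> sin (- (2753/5000))" unfolding q(1) by linarith
  qed (use half_pi_bounds in linarith)+
  have x: "encl (1694579/100000) (exp ((141501/50000) :: real)) (84729/5000)"
    by (rule exp_enclosure8[where l = "(14244026031/10000000000)" and u = "(14244026033/10000000000)"], rule exp_enclosure) (simp_all add: power_divide)
  have "17/25 * (q + 2 * pi - pi/2) \<le> (141501/50000)"
    using qu pi_approx by simp
  then have "exp (17/25 * (q + 2 * pi - pi/2)) \<le> exp (141501/50000)" by simp
  then have "exp (17/25 * (q + 2 * pi - pi/2)) * (17/25 * cos q + (- (327/625))) \<le> (84729/5000) * (140757/2500000)"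
    by (intro mult_mono) (use x cq in linarith)+
  then have "exp (17/25 * (q + 2 * pi - pi/2)) * (17/25 * cos q + (- (327/625))) < 1" by linarith
  then show ?thesis unfolding eq bump_factor[of "q + 2 * pi" "pi/2"] cos_periodic sin_periodic q(1)
    by (intro mult_strict_left_mono exp_gt_zero) simp_all
qed

lemma bump_222:
  assumes q: "sin q = (- (637/1250))" "0 \<le> cos q" "- (pi/2) \<le> q" "q \<le> pi/2"
  shows "crest 0 < bump (q + 2 * pi)"
proof -
  have cq: "encl (4302057/5000000) (cos q) (1720823/2000000)"
    by (rule cos_of_sin[OF q(1,2)]) simp_all
  have eq: "crest 0 = exp (17/25 * (pi/2)) * (15625/15538 * 1)" by (simp add: crest_def bump_def)
  have ql: "(- (1337/2500)) \<le> q"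
  proof (rule le_of_sin_le[OF _ q(3,4)])
    have "encl (- (509669/1000000)) (sin ((- (1337/2500)) :: real)) (- (5096689/10000000))" by (rule sin_enclosure) (simp_all add: power_divide)
    then show "sin (- (1337/2500)) \<le> sin q" unfolding q(1) by linarith
  qed (use half_pi_bounds in linarith)+
  have x: "encl (1712877/100000) (exp ((71019/25000) :: real)) (856439/50000)"
    by (rule exp_enclosure8[where l = "(7131580739/5000000000)" and u = "(14263161479/10000000000)"], rule exp_enclosure) (simp_all add: power_divide)
  have "(71019/25000) \<le> 17/25 * (q + 2 * pi - pi/2)"
    using ql pi_approx by simp
  then have "exp (71019/25000) \<le> exp (17/25 * (q + 2 * pi - pi/2))" by simp
  then have "(1712877/100000) * (9434969/125000000) \<le> exp (17/25 * (q + 2 * pi - pi/2)) * (17/25 * cos q + (- (637/1250)))"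
    by (intro mult_mono) (use x cq in linarith)+
  then have "1 < exp (17/25 * (q + 2 * pi - pi/2)) * (17/25 * cos q + (- (637/1250)))" by linarith
  then show ?thesis unfolding eq bump_factor[of "q + 2 * pi" "pi/2"] cos_periodic sin_periodic q(1)
    by (intro mult_strict_left_mono exp_gt_zero) simp_all
qed

section \<open>Data for the critical starting time\<close>

lemma kern_root_enclosure: "(241/200) < kern_root" "kern_root < (6027/5000)"
proof -
  have e: "exp (8/25 * kern_root) = 25/17" by (simp add: kern_root_def)
  have a: "encl (14704963/10000000) (exp (8/25 * (241/200) :: real)) (3676241/2500000)" by (rule exp_enclosure) (simp_all add: power_divide)
  have b: "encl (2941369/2000000) (exp (8/25 * (6027/5000) :: real)) (7353423/5000000)" by (rule exp_enclosure) (simp_all add: power_divide)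
  have "exp (8/25 * (241/200)) < exp (8/25 * kern_root)" "exp (8/25 * kern_root) < exp (8/25 * (6027/5000))" using a b unfolding e by linarith+
  then show "(241/200) < kern_root" "kern_root < (6027/5000)" unfolding exp_less_cancel_iff by simp_all
qed

text \<open>Since \<open>kern\<close> vanishes at the root, the first-phase formulas reduce to sine
  and cosine, and their monotonicity transfers the bounds for the root.\<close>

lemma coord_kern_root:
  "encl (- (39793/50000)) (sin_coord kern_root) (- (49731/62500))"
  "encl (- (502377/1000000)) (cos_coord kern_root) (- (125529/250000))"
proof -
  have s1: "encl (933839/1000000) (sin ((241/200) :: real)) (11673/12500)" by (rule sin_enclosure) (simp_all add: power_divide)
  have s2: "encl (466991/500000) (sin ((6027/5000) :: real)) (933983/1000000)" by (rule sin_enclosure) (simp_all add: power_divide)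
  have c1: "encl (357319/1000000) (cos ((6027/5000) :: real)) (8933/25000)" by (rule cos_enclosure) (simp_all add: power_divide)
  have c2: "encl (357693/1000000) (cos ((241/200) :: real)) (178847/500000)" by (rule cos_enclosure) (simp_all add: power_divide)
  note k = kern_root_enclosure
  have "sin (241/200) \<le> sin kern_root" "sin kern_root \<le> sin (6027/5000)"
    using k half_pi_bounds by (intro sin_monotone_2pi_le; simp)+
  moreover have "cos kern_root \<le> cos (241/200)" "cos (6027/5000) \<le> cos kern_root"
    using k half_pi_bounds by (intro cos_monotone_0_pi_le; simp)+
  moreover have "0 \<le> kern_root" "kern_root \<le> delay" using k delay_enclosure by linarith+
  note coord_phase1[OF this, unfolded kern_root(3)]
  ultimately show "encl (- (39793/50000)) (sin_coord kern_root) (- (49731/62500))" "encl (- (502377/1000000)) (cos_coord kern_root) (- (125529/250000))"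
    using s1 s2 c1 c2 by linarith+
qed

lemma critical_107:
  assumes q: "sin q = (23181/25000)" "0 \<le> cos q" "- (pi/2) \<le> q" "q \<le> pi/2"
  shows "0 < sin q * sin_coord kern_root + sin q + cos q * cos_coord kern_root"
proof -
  have cq: "encl (149787/400000) (cos q) (936169/2500000)"
    by (rule cos_of_sin[OF q(1,2)]) simp_all
  have a: "encl (- (18812391/100000000)) (cos q * cos_coord kern_root) (- (4700653/25000000))"
    by (rule mult_enclosure[OF cq coord_kern_root(2)]) (simp_all add: prod_simps)
  then show ?thesis unfolding q(1) using coord_kern_root by linarith
qed

lemma critical_109:
  assumes q: "sin q = (23147/25000)" "0 \<le> cos q" "- (pi/2) \<le> q" "q \<le> pi/2"
  shows "sin q * sin_coord kern_root + sin q + cos q * cos_coord kern_root < 0"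
proof -
  have cq: "encl (3778177/10000000) (cos q) (1889089/5000000)"
    by (rule cos_of_sin[OF q(1,2)]) simp_all
  have a: "encl (- (9490349/50000000)) (cos q * cos_coord kern_root) (- (18970831/100000000))"
    by (rule mult_enclosure[OF cq coord_kern_root(2)]) (simp_all add: prod_simps)
  then show ?thesis unfolding q(1) using coord_kern_root by linarith
qed

subsection \<open>Critical point and jumps\<close>

definition crit :: "real \<Rightarrow> real" where
  "crit q = sin q * sin_coord kern_root + sin q + cos q * cos_coord kern_root"

lemma gain_kern_root: "17 * gain q (q + kern_root) = 25 * crit q"
proof -
  have "q + kern_root - delay \<le> q" using kern_root(2) delay_enclosure by linarith
  then have "17 * lsol q (q + kern_root - delay) = 25 - 25 * sin q" by (simp add: lsol_init ftilde_alt)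
  then show ?thesis using lsol_coord[of q kern_root] by (simp add: gain_def crit_def algebra_simps)
qed

text \<open>If the hit comes before \<open>q + kern_root\<close>, the solution keeps rising until
  then: the window still starts in the constant history and the cosine is negative. The gain at
  \<open>q + kern_root\<close> is then positive. If the hit comes later, the gain there is negative,
  being before its first zero. The three cases exclude each other, which yields the
  converses.\<close>

lemma hit_compare:
  assumes q: "- (pi/2) \<le> q" "q < pi/2"
  shows "0 < crit q \<Longrightarrow> hit q < q + kern_root" "crit q = 0 \<Longrightarrow> hit q = q + kern_root"
    "crit q < 0 \<Longrightarrow> q + kern_root < hit q"
proof -
  have q': "q \<le> pi/2" using q by simp
  note h = hit_bounds[OF q(1) q']
  have less: "0 < crit q" if lt: "hit q < q + kern_root"
  proof -
    have pos: "0 < slope q t" if t: "hit q < t" "t < q + kern_root" for t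
    proof (rule slope_persists_strict[of _ "hit q"])
      show "0 \<le> slope q (hit q)" using returns_at_hit[OF q] by (simp add: returns_at_def)
      fix r assume r: "hit q < r" "r < t"
      have "r - delay \<le> q" "pi/2 < r" "r < delay"
        using r t h q kern_root(2) half_pi_bounds delay_enclosure by linarith+
      then show "slope q (r - delay) + cos r < 0" by (simp add: slope_init cos_neg_delay)
    qed (use h t kern_root(2) delay_enclosure in linarith)+
    have "lsol q (hit q) < lsol q (q + kern_root)" by (rule lsol_strict_mono[OF lt pos])
    moreover have "hit q - delay \<le> q" "q + kern_root - delay \<le> q"
      using lt kern_root(2) delay_enclosure by linarith+
    ultimately have "0 < gain q (q + kern_root)" using gain_hit[OF q(1) q'] by (simp add: gain_def lsol_init)
    then show ?thesis using gain_kern_root[of q] by linarith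
  qed
  have greater: "crit q < 0" if "q + kern_root < hit q"
    using gain_before_hit[OF q(1) q' _ that] kern_root(1) gain_kern_root[of q] by linarith
  have eq: "crit q = 0" if "hit q = q + kern_root"
    using gain_hit[OF q(1) q'] gain_kern_root[of q] unfolding that by linarith
  show "0 < crit q \<Longrightarrow> hit q < q + kern_root" "crit q = 0 \<Longrightarrow> hit q = q + kern_root"
    "crit q < 0 \<Longrightarrow> q + kern_root < hit q"
    using less greater eq by linarith+
qed

text \<open>With \<open>sin_coord kern_root > - 1\<close> and
  \<open>cos_coord kern_root < 0\<close>, \<open>crit\<close> is a positive multiple of sine plus a
  negative multiple of cosine; both parts increase on the quarter period.\<close>

lemma crit_strict_mono:
  assumes "0 \<le> a" "a < b" "b \<le> pi/2"
  shows "crit a < crit b"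
proof -
  have "sin a < sin b" using assms sin_mono_less_eq[of a b] by simp
  then have "(sin_coord kern_root + 1) * sin a < (sin_coord kern_root + 1) * sin b"
    using coord_kern_root(1) by (intro mult_strict_left_mono) auto
  moreover have "cos b < cos a" using assms cos_monotone_0_pi[of a b] by simp
  then have "cos_coord kern_root * cos a < cos_coord kern_root * cos b"
    using coord_kern_root(2) by (intro mult_strict_left_mono_neg) auto
  ultimately show ?thesis by (simp add: crit_def algebra_simps)
qed

lemma crit_neg:
  assumes "- (pi/2) \<le> q" "q \<le> 0"
  shows "crit q < 0"
proof -
  have a: "0 < sin_coord kern_root + 1" "cos_coord kern_root < 0" using coord_kern_root by auto
  have s: "sin q \<le> 0" using assms sin_ge_zero[of "- q"] by simp
  have "(sin_coord kern_root + 1) * sin q + cos_coord kern_root * cos q < 0"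
  proof (cases "q = - (pi/2)")
    case True
    then have "sin q = - 1" "cos q = 0" by (simp_all only: sin_minus cos_minus sin_pi_half cos_pi_half)
    then show ?thesis using a by simp
  next
    case False
    then have "0 < cos q" using assms by (intro cos_gt_zero_pi) auto
    then show ?thesis using a s by (intro add_nonpos_neg mult_nonneg_nonpos mult_neg_pos) auto
  qed
  then show ?thesis by (simp add: crit_def algebra_simps)
qed

definition speed :: "real \<Rightarrow> real" where
  "speed p = exp (17/25 * hit (start p)) * kern (hit (start p) - start p)"

lemma DERIV_peak_within: "p \<in> K \<Longrightarrow> (peak has_real_derivative - speed p) (at p within K)"
  using DERIV_peak by (simp add: speed_def)

lemma at_within_K: "0 < p \<Longrightarrow> p < 50/17 \<Longrightarrow> at p within K = at p"
  unfolding K_eq_interval by (rule at_within_Icc_at) (simp_all add: field_simps)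

lemma continuous_on_speed: "continuous_on K speed"
  unfolding speed_def by (intro continuous_intros continuous_on_hit_start continuous_on_start)

lemma start_ge:
  assumes "p \<in> K" "sin a \<le> 1 - 17/25 * p" "- (pi/2) \<le> a" "a \<le> pi/2"
  shows "a \<le> start p"
  by (rule le_of_sin_le) (use assms start_bounds[of p] in auto)

lemma start_less_half_pi: "p \<in> K \<Longrightarrow> 0 < p \<Longrightarrow> start p < pi/2"
  using start_antimono[of 0 p] by (simp add: start_zero K_bounds)

lemma cos_start: "p \<in> K \<Longrightarrow> 0 \<le> cos (start p)"
  using start_bounds[of p] by (intro cos_ge_zero) auto

lemma ex_critical:
  "\<exists>p. 107/1000 < p \<and> p < 109/1000 \<and> speed p = 0 \<and> (\<forall>p'. 0 \<le> p' \<longrightarrow> p' < p \<longrightarrow> 0 < speed p') \<and>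
    (\<forall>p'. p < p' \<longrightarrow> p' \<le> 131/50 \<longrightarrow> speed p' < 0)"
proof -
  have inK: "p \<in> K" if "0 \<le> p" "p \<le> 131/50" for p using that by (simp add: K_bounds)
  have K107: "107/1000 \<in> K" "109/1000 \<in> K" by (simp_all add: K_bounds)
  have "0 < crit (start (107/1000))" unfolding crit_def
    by (rule critical_107) (use start_bounds[OF K107(1)] cos_start[OF K107(1)] in auto)
  moreover have "crit (start (109/1000)) < 0" unfolding crit_def
    by (rule critical_109) (use start_bounds[OF K107(2)] cos_start[OF K107(2)] in auto)
  moreover have "continuous_on {107/1000..109/1000} (\<lambda>p. - crit (start p))"
    unfolding crit_def by (intro continuous_intros continuous_on_subset[OF continuous_on_start]) (auto simp: K_bounds)
  ultimately obtain p where p: "107/1000 \<le> p" "p \<le> 109/1000" "crit (start p) = 0"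
    using IVT'[of "\<lambda>p. - crit (start p)" "107/1000" 0 "109/1000"] by auto
  have ne: "p \<noteq> 107/1000" "p \<noteq> 109/1000"
    using p(3) \<open>0 < crit (start (107/1000))\<close> \<open>crit (start (109/1000)) < 0\<close> by (metis less_irrefl)+
  have pK: "p \<in> K" using p by (simp add: K_bounds)
  note h = hit_compare[OF start_bounds(1) start_less_half_pi]
  have s0: "0 < start p"
  proof (rule ccontr)
    assume "\<not> 0 < start p"
    then have "crit (start p) < 0" using start_bounds(1)[OF pK] by (intro crit_neg) auto
    then show False using p by simp
  qed
  show ?thesis
  proof (intro exI[of _ p] conjI allI impI)
    show "speed p = 0" using h(2)[OF pK pK _ p(3)] p kern_root(3) by (simp add: speed_def)
  next
    fix p' :: real assume p': "0 \<le> p'" "p' < p"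
    then have p'K: "p' \<in> K" using p by (intro inK) auto
    show "0 < speed p'"
    proof (cases "p' = 0")
      case True
      then show ?thesis using kern_pos[of 0] kern_root(1) by (simp add: speed_def start_zero)
    next
      case False
      have "start p < start p'" using p' p'K pK by (intro start_antimono) auto
      then have "crit (start p) < crit (start p')"
        using s0 start_bounds(2)[OF p'K] by (intro crit_strict_mono) auto
      then have "hit (start p') < start p' + kern_root" using h(1)[OF p'K p'K] p' p False by simp
      then show ?thesis using kern_pos by (simp add: speed_def)
    qed
  next
    fix p' :: real assume p': "p < p'" "p' \<le> 131/50"
    then have p'K: "p' \<in> K" using p by (intro inK) auto
    note b = start_bounds[OF p'K]
    have lt: "start p' < start p" using p' p'K pK by (intro start_antimono) auto
    have "crit (start p') < 0"
    proof (cases "start p' \<le> 0")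
      case True
      then show ?thesis using b by (intro crit_neg) auto
    next
      case False
      then have "crit (start p') < crit (start p)"
        using lt start_bounds(2)[OF pK] by (intro crit_strict_mono) auto
      then show ?thesis using p by simp
    qed
    then have "start p' + kern_root < hit (start p')" using h(3)[OF p'K p'K] p' p by simp
    \<comment> \<open>For p' up to 131/50 the sine of the start is at least - 0.7816, and
      \<open>sin (49/50)\<close> exceeds 4/5. Together with \<open>hit < horizon\<close> this keeps
      the elapsed time within the range of \<open>kern_neg\<close>.\<close>
    moreover have "- (49/50) \<le> start p'"
    proof (rule start_ge[OF p'K])
      have "4/5 \<le> sin (49/50 :: real) \<and> sin (49/50 :: real) \<le> 1"
        by (rule sin_enclosure) (simp_all add: power_divide)
      then show "sin (- (49/50)) \<le> 1 - 17/25 * p'" using p' unfolding sin_minus by linarith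
    qed (use half_pi_bounds in linarith)+
    then have "hit (start p') - start p' \<le> 2 * delay + 62/25" using hit_bounds(3)[OF b(1,2)] by linarith
    ultimately show "speed p' < 0" using kern_neg[of "hit (start p') - start p'"] by (simp add: speed_def mult_pos_neg)
  qed (use p ne in linarith)+
qed

section \<open>Monotonicity of the peak on both sides of the critical point\<close>

definition p_crit :: real where
  "p_crit = (SOME p. 107/1000 < p \<and> p < 109/1000 \<and> speed p = 0 \<and> (\<forall>p'. 0 \<le> p' \<longrightarrow> p' < p \<longrightarrow> 0 < speed p') \<and>
    (\<forall>p'. p < p' \<longrightarrow> p' \<le> 131/50 \<longrightarrow> speed p' < 0))"

lemma p_crit_bounds: "107/1000 < p_crit" "p_crit < 109/1000"
  and speed_p_crit: "speed p_crit = 0"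
  and speed_pos: "0 \<le> p \<Longrightarrow> p < p_crit \<Longrightarrow> 0 < speed p"
  and speed_neg: "p_crit < p \<Longrightarrow> p \<le> 131/50 \<Longrightarrow> speed p < 0"
  using someI_ex[OF ex_critical, folded p_crit_def] by auto

lemma peak_strict_antimono:
  assumes "0 \<le> a" "a < b" "b \<le> p_crit"
  shows "peak b < peak a"
proof -
  have "- peak a < - peak b"
    using assms(2)
  proof (rule strict_mono_of_deriv)
    show "continuous_on {a..b} (\<lambda>p. - peak p)"
      by (intro continuous_intros continuous_on_subset[OF continuous_on_peak]) (use assms p_crit_bounds in \<open>auto simp: K_bounds\<close>)
    fix p assume p: "a < p" "p < b"
    have pK: "0 < p" "p < 50/17" using p assms p_crit_bounds by auto
    then have "((\<lambda>p. - peak p) has_real_derivative speed p) (at p)"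
      using DERIV_minus[OF DERIV_peak_within[of p]] by (simp add: at_within_K K_bounds)
    then show "\<exists>D. ((\<lambda>p. - peak p) has_real_derivative D) (at p) \<and> 0 < D"
      using speed_pos[of p] p assms pK by (intro exI[of _ "speed p"]) auto
  qed
  then show ?thesis by simp
qed

lemma peak_strict_mono:
  assumes "p_crit \<le> a" "a < b" "b \<le> 131/50"
  shows "peak a < peak b"
  using assms(2)
proof (rule strict_mono_of_deriv)
  show "continuous_on {a..b} peak"
    by (intro continuous_on_subset[OF continuous_on_peak]) (use assms p_crit_bounds in \<open>auto simp: K_bounds\<close>)
  fix p assume p: "a < p" "p < b"
  have pK: "0 < p" "p < 50/17" using p assms p_crit_bounds by auto
  then have "(peak has_real_derivative - speed p) (at p)"
    using DERIV_peak_within[of p] by (simp add: at_within_K K_bounds)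
  then show "\<exists>D. (peak has_real_derivative D) (at p) \<and> 0 < D"
    using speed_neg[of p] p assms by (intro exI[of _ "- speed p"]) auto
qed

lemma peak_ge_crit: "0 \<le> p \<Longrightarrow> p \<le> 131/50 \<Longrightarrow> peak p_crit \<le> peak p"
  using peak_strict_antimono[of p p_crit] peak_strict_mono[of p_crit p] by (cases p p_crit rule: linorder_cases) auto

lemma peak_0: "peak 0 = crest 0"
  by (simp add: peak_def start_zero threshold_half_pi crest_def)

lemma peak_le_crest_0: "0 \<le> p \<Longrightarrow> p \<le> p_crit \<Longrightarrow> peak p \<le> crest 0"
  using peak_strict_antimono[of 0 p] by (cases "p = 0") (auto simp: peak_0)

lemma crest_mono: "i \<le> j \<Longrightarrow> crest i \<le> crest j"
  by (rule lift_Suc_mono_le[of crest]) (auto intro: less_imp_le crest_less_Suc)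

lemma bump_range:
  assumes "- (pi/2) \<le> r" "r \<le> pi/2"
  shows "bump (3 * pi / 2) \<le> bump (r + 2 * pi)" "bump (r + 2 * pi) \<le> crest 1"
proof -
  have mono: "bump a \<le> bump b" if "3 * pi / 2 \<le> a" "a \<le> b" "b \<le> 5 * pi / 2" for a b
    using bump_strict_mono'[of 0 a b] that by (cases "a = b") auto
  show "bump (3 * pi / 2) \<le> bump (r + 2 * pi)" using assms by (intro mono) auto
  show "bump (r + 2 * pi) \<le> crest 1" unfolding crest_1 using assms by (intro mono) auto
qed

text \<open>The threshold, on the first branch, whose return value is p. Comparing the return map
  with a number p amounts to comparing the threshold with \<open>bump_start p\<close>, in reversed
  order.\<close>

definition bump_start :: "real \<Rightarrow> real" where
  "bump_start p = bump (start p + 2 * pi)"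

lemma bump_start_range:
  assumes "p \<in> K"
  shows "bump (3 * pi / 2) \<le> bump_start p" "bump_start p \<le> crest 1"
  unfolding bump_start_def using bump_range start_bounds[OF assms] by auto

lemma ret_val_bump_start: "p \<in> K \<Longrightarrow> ret_val (bump_start p) = p"
  unfolding bump_start_def using start_bounds[of p] by (subst ret_val_eqI) auto

lemma ret_val_less: "p \<in> K \<Longrightarrow> bump_start p < z \<Longrightarrow> z \<le> crest 1 \<Longrightarrow> ret_val z < p"
  using ret_val_strict_antimono[of "bump_start p" z] bump_start_range ret_val_bump_start by simp

lemma less_ret_val: "p \<in> K \<Longrightarrow> z < bump_start p \<Longrightarrow> bump (3 * pi / 2) \<le> z \<Longrightarrow> p < ret_val z"
  using ret_val_strict_antimono[of z "bump_start p"] bump_start_range ret_val_bump_start by simp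

lemma ret_val_antimono: "bump (3 * pi / 2) \<le> z \<Longrightarrow> z \<le> z' \<Longrightarrow> z' \<le> crest 1 \<Longrightarrow> ret_val z' \<le> ret_val z"
  using ret_val_strict_antimono[of z z'] by (cases "z = z'") auto

lemma peak_101: "peak (101/100) < bump_start (9/10)"
  unfolding peak_def bump_start_def
  by (rule threshold_101) (use start_bounds[of "101/100"] start_bounds[of "9/10"] cos_start in \<open>auto simp: K_bounds\<close>)

lemma crest_0_less: "crest 0 < bump_start (9/10)"
proof -
  have "crest 0 < bump_start (111/50)"
    unfolding bump_start_def by (rule bump_222) (use start_bounds[of "111/50"] cos_start in \<open>auto simp: K_bounds\<close>)
  also have "\<dots> < bump_start (9/10)"
    unfolding bump_start_def using start_bounds[of "111/50"] start_bounds[of "9/10"] start_antimono[of "9/10" "111/50"]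
    by (intro bump_strict_mono'[of 0]) (auto simp: K_bounds)
  finally show ?thesis .
qed

lemma ret_val_crest_0: "111/50 < ret_val (crest 0)" "ret_val (crest 0) < 56/25"
proof -
  have "crest 0 < bump_start (111/50)"
    unfolding bump_start_def by (rule bump_222) (use start_bounds[of "111/50"] cos_start in \<open>auto simp: K_bounds\<close>)
  then show "111/50 < ret_val (crest 0)"
    using bump_three_half_neg crest_pos[of 0] by (intro less_ret_val) (auto simp: K_bounds)
  have "bump_start (56/25) < crest 0"
    unfolding bump_start_def by (rule bump_224) (use start_bounds[of "56/25"] cos_start in \<open>auto simp: K_bounds\<close>)
  then show "ret_val (crest 0) < 56/25"
    using crest_less_Suc[of 0] by (intro ret_val_less) (auto simp: K_bounds)
qed

lemma ex_jump:
  assumes "p_crit \<le> a" "a < b" "b \<le> 131/50" "peak a < L" "L < peak b"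
  shows "\<exists>p. a < p \<and> p < b \<and> peak p = L"
proof -
  have "continuous_on {a..b} peak"
    by (intro continuous_on_subset[OF continuous_on_peak]) (use assms p_crit_bounds in \<open>auto simp: K_bounds\<close>)
  then obtain p where p: "a \<le> p" "p \<le> b" "peak p = L" using IVT'[of peak a L b] assms by auto
  then have "p \<noteq> a" "p \<noteq> b" using assms by auto
  then show ?thesis using p by (intro exI[of _ p]) auto
qed

section \<open>The two jumps\<close>

definition jump :: "nat \<Rightarrow> real" where
  "jump k = (THE p. p_crit \<le> p \<and> p \<le> 131/50 \<and> peak p = crest k)"

lemma jump_eqI:
  assumes "p_crit \<le> p" "p \<le> 131/50" "peak p = crest k"
  shows "jump k = p"
  unfolding jump_def
proof (rule the_equality)
  fix p' assume "p_crit \<le> p' \<and> p' \<le> 131/50 \<and> peak p' = crest k"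
  then show "p' = p" using peak_strict_mono[of p p'] peak_strict_mono[of p' p] assms by (cases p p' rule: linorder_cases) auto
qed (use assms in simp)

lemma jump_1: "101/100 < jump 1" "jump 1 < 121/100" "peak (jump 1) = crest 1"
proof -
  have "peak (101/100) < crest 1" using peak_101 bump_start_range(2)[of "9/10"] by (simp add: K_bounds)
  moreover have "crest 1 < peak (121/100)"
    unfolding peak_def by (rule threshold_121) (use start_bounds[of "121/100"] cos_start in \<open>auto simp: K_bounds\<close>)
  ultimately obtain p where p: "101/100 < p" "p < 121/100" "peak p = crest 1"
    using ex_jump[of "101/100" "121/100"] p_crit_bounds by auto
  then have "jump 1 = p" using p_crit_bounds by (intro jump_eqI) auto
  then show "101/100 < jump 1" "jump 1 < 121/100" "peak (jump 1) = crest 1" using p by auto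
qed

lemma jump_2: "13/5 < jump 2" "jump 2 < 131/50" "peak (jump 2) = crest 2"
proof -
  have "peak (13/5) < crest 2"
    unfolding peak_def by (rule threshold_260) (use start_bounds[of "13/5"] cos_start in \<open>auto simp: K_bounds\<close>)
  moreover have "crest 2 < peak (131/50)"
    unfolding peak_def by (rule threshold_262) (use start_bounds[of "131/50"] cos_start in \<open>auto simp: K_bounds\<close>)
  ultimately obtain p where p: "13/5 < p" "p < 131/50" "peak p = crest 2"
    using ex_jump[of "13/5" "131/50"] p_crit_bounds by auto
  then have "jump 2 = p" using p_crit_bounds by (intro jump_eqI) auto
  then show "13/5 < jump 2" "jump 2 < 131/50" "peak (jump 2) = crest 2" using p by auto
qed

lemma peak_growth:
  assumes "jump 1 \<le> p" "p < jump 2"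
  shows "crest 1 \<le> peak p" "peak p < crest 2" "crest 0 \<le> peak p / growth" "peak p / growth < crest 1"
proof -
  have g: "0 < growth" using growth_gt_1 by simp
  show 1: "crest 1 \<le> peak p"
    using peak_strict_mono[of "jump 1" p] assms jump_1 jump_2 p_crit_bounds by (cases "p = jump 1") auto
  show 2: "peak p < crest 2"
    using peak_strict_mono[of p "jump 2"] assms jump_1 jump_2 p_crit_bounds by auto
  show "crest 0 \<le> peak p / growth" using 1 g crest_Suc[of 0] by (simp add: field_simps)
  show "peak p / growth < crest 1" using 2 g crest_Suc[of 1] by (simp add: field_simps numeral_2_eq_2)
qed

text \<open>Below the first jump p is less than 121/100, which forces \<open>start p\<close> to be
  at least 3/25; the hit then precedes \<open>5 * pi / 2\<close>, as \<open>return_map_first\<close>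
  requires.\<close>

lemma return_map_low:
  assumes "0 \<le> p" "p < jump 1"
  shows "return_map p = ret_val (peak p)" "bump (3 * pi / 2) < peak p" "peak p < crest 1"
proof -
  have pK: "p \<in> K" using assms jump_1 by (simp add: K_bounds)
  note b = start_bounds[OF pK]
  show lt: "peak p < crest 1"
  proof (cases "p \<le> p_crit")
    case True
    then show ?thesis using peak_le_crest_0[OF assms(1)] crest_less_Suc[of 0] by simp
  next
    case False
    then show ?thesis using peak_strict_mono[of p "jump 1"] assms jump_1 by simp
  qed
  have "3/25 \<le> start p"
  proof (rule start_ge[OF pK])
    show "sin (3/25) \<le> 1 - 17/25 * p" using sin_x_le_x[of "3/25"] assms jump_1 by simp
  qed (use half_pi_bounds in linarith)+
  then have "hit (start p) < 5 * pi / 2" using hit_less_late[of "start p"] b(2) late_horizon_less by linarith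
  then show "return_map p = ret_val (peak p)" "bump (3 * pi / 2) < peak p"
    using return_map_first[OF b(1,2)] lt unfolding peak_def b(4) by auto
qed

lemma return_map_mid:
  assumes "jump 1 \<le> p" "p < jump 2"
  shows "return_map p = ret_val (peak p / growth)"
proof -
  have pK: "p \<in> K" using assms jump_1 jump_2 by (simp add: K_bounds)
  note b = start_bounds[OF pK]
  show ?thesis
    using return_map_later[OF b(1,2), of 1] peak_growth[OF assms] unfolding peak_def b(4) by (simp add: numeral_2_eq_2)
qed

text \<open>The thresholds may be arbitrarily large, so k is taken as the first index whose next
  crest exceeds the threshold. This serves initial values for which no upper bound on the threshold
  is established.\<close>

lemma ret_val_scaled:
  assumes q: "- (pi/2) \<le> q" "q \<le> pi/2" and L: "crest 0 \<le> threshold q" "hit q < 5 * pi / 2 \<or> crest 1 \<le> threshold q"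
  shows "\<exists>z. crest 0 \<le> z \<and> z \<le> crest 1 \<and> return_map (ftilde q) = ret_val z"
proof -
  have g: "0 < growth" "1 < growth" using growth_gt_1 by simp_all
  obtain n where "threshold q / crest 0 < growth ^ n" using real_arch_pow[OF g(2)] by blast
  then have "threshold q < crest n" using crest_pos[of 0] by (subst crest_eq) (simp add: field_simps)
  also have "crest n < crest (Suc n)" by (rule crest_less_Suc)
  finally have ex: "threshold q < crest (Suc n)" .
  define k where "k = (LEAST k. threshold q < crest (Suc k))"
  have k: "threshold q < crest (Suc k)" unfolding k_def by (rule LeastI[of _ n]) (rule ex)
  have lo: "crest k \<le> threshold q"
  proof (cases k)
    case (Suc j)
    then have "\<not> threshold q < crest (Suc j)" unfolding k_def by (intro not_less_Least) simp
    then show ?thesis using Suc by simp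
  qed (use L in simp)
  show ?thesis
  proof (cases "k = 0")
    case True
    then have "return_map (ftilde q) = ret_val (threshold q)" using return_map_first[OF q] k L by simp
    then show ?thesis using lo k True by (intro exI[of _ "threshold q"]) simp
  next
    case False
    have "return_map (ftilde q) = ret_val (threshold q / growth ^ k)"
      using return_map_later[OF q _ lo k] False by simp
    moreover have "crest 0 \<le> threshold q / growth ^ k" using lo g by (subst (asm) crest_eq) (simp add: field_simps)
    moreover have "crest (Suc k) = growth ^ k * crest 1" using crest_eq[of "Suc k"] crest_eq[of 1] by simp
    then have "threshold q / growth ^ k \<le> crest 1" using k g by (simp add: field_simps)
    ultimately show ?thesis by blast
  qed
qed

section \<open>Initial values beyond the second jump\<close>

lemma lsol_mono_start:
  assumes "- (pi/2) \<le> q" "q \<le> q'" "q' \<le> pi/2" "kern_root < t - q'" "t - q \<le> 2 * delay"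
  shows "lsol q t \<le> lsol q' t"
  using assms(2)
proof (rule mono_on_of_deriv)
  show "continuous_on {q..q'} (\<lambda>q. lsol q t)" using DERIV_lsol_start by (blast intro: DERIV_isCont continuous_at_imp_continuous_on)
  fix r assume r: "q < r" "r < q'"
  have "kern (t - r) < 0" using r assms by (intro kern_neg) auto
  moreover have "0 \<le> cos r" using r assms by (intro cos_ge_zero) auto
  ultimately show "\<exists>D. ((\<lambda>q. lsol q t) has_real_derivative D) (at r) \<and> 0 \<le> D"
    using DERIV_lsol_start[where q = r and t = t]
    by (intro exI[of _ "- 25/17 * kern (t - r) * cos r"]) (auto simp: mult_nonpos_nonneg)
qed

lemma bump_le_level:
  assumes "lsol q t < 0" "sin t = 1"
  shows "bump t \<le> level q t"
proof -
  have "0 < exp (17/25 * t) * (ftilde t - lsol q t)" using assms by (simp add: ftilde_alt mult_pos_neg)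
  then show ?thesis using level_minus_bump[of q t] by linarith
qed

text \<open>Beyond 131/50 no monotonicity of \<open>peak\<close> is established. Instead the
  solution is shown to be negative at \<open>pi/2\<close>, and at \<open>5 * pi / 2\<close> if the
  hit is that late. There the nullcline is 0, so \<open>level\<close> is at least the crest, and
  levels before the hit bound the threshold from below.\<close>

lemma return_map_high:
  assumes p: "p \<in> K" "jump 2 \<le> p"
  shows "\<exists>z. crest 0 \<le> z \<and> z \<le> crest 1 \<and> return_map p = ret_val z"
proof -
  note b = start_bounds[OF p(1)]
  have "crest 0 \<le> threshold (start p) \<and> (hit (start p) < 5 * pi / 2 \<or> crest 1 \<le> threshold (start p))"
  proof (cases "p \<le> 131/50")
    case True
    have "crest 2 \<le> peak p"
      using peak_strict_mono[of "jump 2" p] p True jump_2 p_crit_bounds by (cases "p = jump 2") auto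
    then show ?thesis using crest_mono[of 0 2] crest_mono[of 1 2] by (simp add: peak_def)
  next
    case False
    have "start p \<le> - (1/2)"
    proof (rule ge_of_sin_ge[OF _ b(1,2)])
      have "sin (1/2 :: real) \<le> 1/2" by (rule sin_x_le_x) simp
      then show "sin (start p) \<le> sin (- (1/2))" unfolding b(3) sin_minus using False by linarith
    qed (use half_pi_bounds in linarith)+
    note s = this b(1)
    have "lsol (start p) (pi/2) < 0"
      using lsol_mono_start[OF s(2,1), of "pi/2"] lsol_half_neg s kern_root half_pi_bounds delay_enclosure by linarith
    then have "bump (pi/2) \<le> level (start p) (pi/2)" by (rule bump_le_level) (rule sin_pi_half)
    also have "\<dots> \<le> threshold (start p)"
      using hit_bounds(1)[OF b(1,2)] b(2) by (intro level_le_threshold_before b(1,2)) auto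
    finally have 0: "crest 0 \<le> threshold (start p)" by (simp add: crest_def)
    have "crest 1 \<le> threshold (start p)" if h: "5 * pi / 2 \<le> hit (start p)"
    proof -
      have e: "delay + pi = 5 * pi / 2" by (simp add: delay_def)
      have "lsol (start p) (5 * pi / 2) \<le> lsol 0 (5 * pi / 2)"
        by (rule lsol_mono_start) (use s kern_root half_pi_bounds in \<open>auto simp: delay_def\<close>)
      then have "lsol (start p) (5 * pi / 2) < 0" using lsol_zero_neg unfolding e by linarith
      then have "bump (5 * pi / 2) \<le> level (start p) (5 * pi / 2)"
        using sin_cos_period(2)[of "pi/2" 1] by (intro bump_le_level) simp_all
      also have "\<dots> \<le> threshold (start p)"
        using h b by (intro level_le_threshold_before b(1,2)) auto
      finally show ?thesis by (simp only: crest_1)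
    qed
    then show ?thesis using 0 by linarith
  qed
  then show ?thesis using ret_val_scaled[OF b(1,2)] unfolding b(4) by blast
qed

lemma return_map_0: "return_map 0 = ret_val (crest 0)"
  using return_map_low(1)[of 0] jump_1 by (simp add: peak_0)

lemma return_map_jump_1: "return_map (jump 1) = return_map 0"
proof -
  have "crest 1 / growth = crest 0" using crest_Suc[of 0] growth_gt_1 by simp
  then show ?thesis using return_map_mid[of "jump 1"] jump_1 jump_2 by (simp add: return_map_0)
qed

lemma return_map_jump_2: "return_map (jump 2) = return_map 0"
proof -
  have pK: "jump 2 \<in> K" using jump_2 by (simp add: K_bounds)
  note b = start_bounds[OF pK]
  have L: "threshold (start (jump 2)) = crest 2" using jump_2(3) by (simp add: peak_def)
  have "return_map (jump 2) = ret_val (crest 2 / growth ^ 2)"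
    using return_map_later[OF b(1,2), of 2] crest_less_Suc[of 2] unfolding L b(4) by simp
  also have "crest 2 / growth ^ 2 = crest 0" using growth_gt_1 by (subst crest_eq) simp
  finally show ?thesis by (simp add: return_map_0)
qed

lemma peak_p_crit_pos: "0 < peak p_crit"
proof -
  have pK: "p_crit \<in> K" using p_crit_bounds by (simp add: K_bounds)
  note b = start_bounds[OF pK]
  have "0 < sin (start p_crit)" using b(3) p_crit_bounds by simp
  then have "0 < 17/25 * cos (start p_crit) + sin (start p_crit)" using cos_start[OF pK] by simp
  then have "0 < bump (start p_crit)" by (simp add: bump_def)
  also have "\<dots> = level (start p_crit) (start p_crit)"
    using level_minus_bump[of "start p_crit" "start p_crit"] by (simp add: lsol_init)
  also have "\<dots> \<le> peak p_crit"
    unfolding peak_def using hit_bounds(2)[OF b(1,2)] by (intro level_le_threshold_before b(1,2)) auto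
  finally show ?thesis .
qed

lemma return_map_p_crit: "return_map p_crit = ret_val (peak p_crit)" "peak p_crit < crest 1"
  using return_map_low[of p_crit] p_crit_bounds jump_1 by auto

text \<open>The sine of \<open>start (5/2)\<close> is - 7/10, below - 17/25, so the bump one period
  later is negative while the peak is positive. Since the second jump exceeds 13/5, the image of the
  whole of K stays to its left.\<close>

lemma return_map_p_crit_less: "return_map p_crit < 5/2"
proof -
  have pK: "5/2 \<in> K" by (simp add: K_bounds)
  have "17/25 * cos (start (5/2)) + sin (start (5/2)) < 0"
    using start_bounds(3)[OF pK] cos_le_one[of "start (5/2)"] by linarith
  then have "bump_start (5/2) < 0" by (simp add: bump_start_def bump_def mult_pos_neg)
  then show ?thesis
    unfolding return_map_p_crit using peak_p_crit_pos return_map_p_crit(2) by (intro ret_val_less[OF pK]) auto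
qed

lemma return_map_ret_val:
  assumes "p \<in> K"
  obtains z where "peak p_crit \<le> z" "z \<le> crest 1" "return_map p = ret_val z"
proof -
  have p: "0 \<le> p" using assms by (simp add: K_bounds)
  have c: "peak p_crit \<le> crest 0" using peak_le_crest_0[of p_crit] p_crit_bounds by simp
  consider "p < jump 1" | "jump 1 \<le> p" "p < jump 2" | "jump 2 \<le> p" by linarith
  then show thesis
  proof cases
    case 1
    then show thesis
      using that[of "peak p"] return_map_low[OF p 1] peak_ge_crit[OF p] jump_1 by simp
  next
    case 2
    then show thesis using that[of "peak p / growth"] peak_growth[OF 2] return_map_mid[OF 2] c by simp
  next
    case 3
    then obtain z where "crest 0 \<le> z" "z \<le> crest 1" "return_map p = ret_val z"
      using return_map_high[OF assms] by blast
    then show thesis using that[of z] c by simp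
  qed
qed

lemma return_map_le: "p \<in> K \<Longrightarrow> return_map p \<le> return_map p_crit"
  using return_map_ret_val[of p] ret_val_antimono bump_three_half_neg peak_p_crit_pos unfolding return_map_p_crit(1)
  by (metis less_imp_le less_trans)

lemma return_map_nonneg: "p \<in> K \<Longrightarrow> 0 \<le> return_map p"
  using return_map_ret_val[of p] ret_val_antimono[of _ "crest 1"] bump_three_half_neg peak_p_crit_pos
  unfolding ret_val_crest_1 by (metis less_imp_le less_le_trans less_trans order_refl)

section \<open>Derivative and one-sided limits of the return map\<close>

definition slope_low :: "real \<Rightarrow> real" where
  "slope_low p = exp (- (17/25) * landing (peak p)) * speed p"

definition slope_mid :: "real \<Rightarrow> real" where
  "slope_mid p = exp (- (17/25) * landing (peak p / growth)) * speed p / growth"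

lemma DERIV_return_map_low:
  assumes p: "0 \<le> p" "p < jump 1"
  shows "(return_map has_real_derivative slope_low p) (at p within K)"
proof -
  have pK: "p \<in> K" using assms jump_1 by (simp add: K_bounds)
  note r = return_map_low[OF p]
  have "((\<lambda>p. ret_val (peak p)) has_real_derivative slope_low p) (at p within K)"
    using DERIV_chain2[OF DERIV_ret_val[OF r(2,3)] DERIV_peak_within[OF pK]] by (simp add: slope_low_def)
  then show ?thesis
  proof (rule has_field_derivative_transform_within[where d = "jump 1 - p"])
    fix x assume "x \<in> K" "dist x p < jump 1 - p"
    then show "ret_val (peak x) = return_map x" by (intro return_map_low(1)[symmetric]) (auto simp: K_bounds dist_real_def)
  qed (use p pK in auto)
qed

lemma DERIV_return_map_mid:
  assumes p: "jump 1 < p" "p < jump 2"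
  shows "(return_map has_real_derivative slope_mid p) (at p within K)"
proof -
  have pK: "p \<in> K" using assms jump_1 jump_2 by (simp add: K_bounds)
  have b: "bump (3 * pi / 2) < peak p / growth" "peak p / growth < crest 1"
    using peak_growth[of p] p bump_three_half_neg crest_pos[of 0] by auto
  have "((\<lambda>p. peak p / growth) has_real_derivative - speed p / growth) (at p within K)"
    by (rule DERIV_cdivide[OF DERIV_peak_within[OF pK]])
  from DERIV_chain2[OF DERIV_ret_val[OF b] this]
  have "((\<lambda>p. ret_val (peak p / growth)) has_real_derivative slope_mid p) (at p within K)" by (simp add: slope_mid_def)
  then show ?thesis
  proof (rule has_field_derivative_transform_within[where d = "min (p - jump 1) (jump 2 - p)"])
    fix x assume "x \<in> K" "dist x p < min (p - jump 1) (jump 2 - p)"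
    then show "ret_val (peak x / growth) = return_map x" by (intro return_map_mid[symmetric]) (auto simp: dist_real_def)
  qed (use p pK in auto)
qed

lemma slope_zero_iff: "slope_low p = 0 \<longleftrightarrow> speed p = 0" "slope_mid p = 0 \<longleftrightarrow> speed p = 0"
  using growth_gt_1 by (simp_all add: slope_low_def slope_mid_def)

lemma speed_zero_iff: "0 \<le> p \<Longrightarrow> p \<le> 131/50 \<Longrightarrow> speed p = 0 \<longleftrightarrow> p = p_crit"
  using speed_pos[of p] speed_neg[of p] speed_p_crit by (cases p p_crit rule: linorder_cases) auto

lemma return_map_deriv:
  assumes "0 \<le> p" "p < jump 2" "p \<noteq> jump 1"
  obtains D where "(return_map has_real_derivative D) (at p within K)" "D = 0 \<longleftrightarrow> p = p_crit"
proof (cases "p < jump 1")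
  case True
  then show thesis
    using that[OF DERIV_return_map_low[OF assms(1)]] speed_zero_iff[of p] slope_zero_iff(1) assms jump_2 by simp
next
  case False
  then show thesis
    using that[OF DERIV_return_map_mid] speed_zero_iff[of p] slope_zero_iff(2) assms jump_2 by simp
qed

text \<open>Derivatives within K are unique because every point concerned is a limit point of K;
  this includes the end point 0, where only a one-sided derivative exists.\<close>

lemma return_map_critical_iff:
  assumes "0 \<le> p" "p < jump 2" "p \<noteq> jump 1"
  shows "(return_map has_real_derivative 0) (at p within K) \<longleftrightarrow> p = p_crit"
proof -
  obtain D where D: "(return_map has_real_derivative D) (at p within K)" "D = 0 \<longleftrightarrow> p = p_crit"
    using return_map_deriv[OF assms] by blast
  have "p islimpt K" unfolding K_eq_interval using assms jump_2 by (simp add: islimpt_Icc field_simps)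
  then have "at p within K \<noteq> bot" by (simp add: trivial_limit_within)
  then have "(return_map has_real_derivative 0) (at p within K) \<longleftrightarrow> D = 0"
    using has_field_derivative_unique[OF D(1), of 0] D(1) by auto
  then show ?thesis using D(2) by simp
qed

lemma continuous_on_peak_growth: "continuous_on {jump 1..jump 2} (\<lambda>p. peak p / growth)"
  by (intro continuous_intros continuous_on_subset[OF continuous_on_peak]) (use growth_gt_1 jump_1 jump_2 in \<open>auto simp: K_bounds\<close>)

lemma peak_low_range: "p \<in> {0..jump 1} \<Longrightarrow> peak p \<in> {bump (3 * pi / 2)..crest 1}"
  using return_map_low[of p] jump_1 bump_three_half_neg crest_pos[of 1] by (cases "p = jump 1") auto

lemma peak_mid_range: "p \<in> {jump 1..jump 2} \<Longrightarrow> peak p / growth \<in> {bump (3 * pi / 2)..crest 1}"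
proof (cases "p = jump 2")
  case True
  have "crest 2 / growth = crest 1" using crest_Suc[of 1] growth_gt_1 by (simp add: numeral_2_eq_2)
  then show ?thesis using True jump_2 bump_three_half_neg crest_pos[of 1] by simp
qed (use peak_growth[of p] bump_three_half_neg crest_pos[of 0] in auto)

lemma continuous_on_peak_low: "continuous_on {0..jump 1} peak"
  by (intro continuous_on_subset[OF continuous_on_peak]) (use jump_1 in \<open>auto simp: K_bounds\<close>)

lemma return_map_left_limit:
  "(return_map \<longlongrightarrow> 0) (at_left (jump 1))" "(return_map \<longlongrightarrow> 0) (at_left (jump 2))"
proof -
  have "continuous_on {0..jump 1} (\<lambda>p. ret_val (peak p))"
    by (rule continuous_on_compose2[OF continuous_on_ret_val continuous_on_peak_low]) (use peak_low_range in auto)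
  then have "((\<lambda>p. ret_val (peak p)) \<longlongrightarrow> ret_val (peak (jump 1))) (at_left (jump 1))"
    using jump_1 by (intro continuous_on_Icc_at_leftD[of 0]) auto
  moreover have "\<forall>\<^sub>F p in at_left (jump 1). ret_val (peak p) = return_map p"
    by (rule eventually_at_leftI[of 0]) (use return_map_low jump_1 in auto)
  ultimately show "(return_map \<longlongrightarrow> 0) (at_left (jump 1))"
    unfolding jump_1(3) ret_val_crest_1 by (rule Lim_transform_eventually)
  have e: "peak (jump 2) / growth = crest 1" using jump_2 crest_Suc[of 1] growth_gt_1 by (simp add: numeral_2_eq_2)
  have "continuous_on {jump 1..jump 2} (\<lambda>p. ret_val (peak p / growth))"
    by (rule continuous_on_compose2[OF continuous_on_ret_val continuous_on_peak_growth]) (use peak_mid_range in auto)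
  then have "((\<lambda>p. ret_val (peak p / growth)) \<longlongrightarrow> ret_val (peak (jump 2) / growth)) (at_left (jump 2))"
    using jump_1 jump_2 by (intro continuous_on_Icc_at_leftD[of "jump 1"]) auto
  moreover have "\<forall>\<^sub>F p in at_left (jump 2). ret_val (peak p / growth) = return_map p"
    by (rule eventually_at_leftI[of "jump 1"]) (use return_map_mid jump_1 jump_2 in auto)
  ultimately show "(return_map \<longlongrightarrow> 0) (at_left (jump 2))"
    unfolding e ret_val_crest_1 by (rule Lim_transform_eventually)
qed

lemma return_map_discontinuous:
  assumes "(return_map \<longlongrightarrow> 0) (at_left p)" "return_map p \<noteq> 0" "0 < p" "p < 50/17"
  shows "\<not> continuous (at p within K) return_map"
proof
  assume "continuous (at p within K) return_map"
  then have "(return_map \<longlongrightarrow> return_map p) (at_left p)"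
    using assms by (simp add: at_within_K continuous_within filterlim_at_split)
  then show False using tendsto_unique[OF trivial_limit_at_left_real _ assms(1)] assms(2) by blast
qed

lemma return_map_discontinuities: "{p \<in> {0..jump 2}. \<not> continuous (at p within K) return_map} = {jump 1, jump 2}"
proof
  show "{p \<in> {0..jump 2}. \<not> continuous (at p within K) return_map} \<subseteq> {jump 1, jump 2}"
  proof (rule subsetI, rule ccontr)
    fix p assume p: "p \<in> {p \<in> {0..jump 2}. \<not> continuous (at p within K) return_map}" and "p \<notin> {jump 1, jump 2}"
    then obtain D where "(return_map has_real_derivative D) (at p within K)"
      using return_map_deriv[of p] by auto
    then show False using p DERIV_continuous by auto
  qed
  show "{jump 1, jump 2} \<subseteq> {p \<in> {0..jump 2}. \<not> continuous (at p within K) return_map}"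
    using return_map_discontinuous[OF return_map_left_limit(1)] return_map_discontinuous[OF return_map_left_limit(2)]
      return_map_jump_1 return_map_jump_2 return_map_0 ret_val_crest_0 jump_1 jump_2 by auto
qed

text \<open>Both derivative formulas are continuous up to the jump, because \<open>landing\<close>
  is continuous on its closed interval and the cosines have cancelled in
  \<open>DERIV_ret_val\<close>.\<close>

lemma deriv_return_map_limits:
  "(deriv return_map \<longlongrightarrow> slope_low (jump 1)) (at_left (jump 1))"
  "(deriv return_map \<longlongrightarrow> slope_mid (jump 1)) (at_right (jump 1))"
proof -
  have "continuous_on {0..jump 1} (\<lambda>p. landing (peak p))"
    by (rule continuous_on_compose2[OF continuous_on_landing continuous_on_peak_low]) (use peak_low_range in auto)
  then have "continuous_on {0..jump 1} slope_low"
    unfolding slope_low_def by (intro continuous_intros continuous_on_subset[OF continuous_on_speed]) (use jump_1 in \<open>auto simp: K_bounds\<close>)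
  then have "(slope_low \<longlongrightarrow> slope_low (jump 1)) (at_left (jump 1))"
    using jump_1 by (intro continuous_on_Icc_at_leftD[of 0]) auto
  moreover have "slope_low p = deriv return_map p" if "0 < p" "p < jump 1" for p
    using DERIV_return_map_low[of p] that jump_1 by (intro DERIV_imp_deriv[symmetric]) (simp add: at_within_K)
  then have "\<forall>\<^sub>F p in at_left (jump 1). slope_low p = deriv return_map p"
    using jump_1 by (intro eventually_at_leftI[of 0]) auto
  ultimately show "(deriv return_map \<longlongrightarrow> slope_low (jump 1)) (at_left (jump 1))"
    by (rule Lim_transform_eventually)
  have "continuous_on {jump 1..jump 2} (\<lambda>p. landing (peak p / growth))"
    by (rule continuous_on_compose2[OF continuous_on_landing continuous_on_peak_growth]) (use peak_mid_range in auto)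
  then have "continuous_on {jump 1..jump 2} slope_mid"
    unfolding slope_mid_def
    by (intro continuous_intros continuous_on_subset[OF continuous_on_speed]) (use jump_1 jump_2 growth_gt_1 in \<open>auto simp: K_bounds\<close>)
  then have "(slope_mid \<longlongrightarrow> slope_mid (jump 1)) (at_right (jump 1))"
    using jump_1 jump_2 by (intro continuous_on_Icc_at_rightD[of _ "jump 2"]) auto
  moreover have "slope_mid p = deriv return_map p" if "jump 1 < p" "p < jump 2" for p
    using DERIV_return_map_mid[of p] that jump_1 jump_2 by (intro DERIV_imp_deriv[symmetric]) (simp add: at_within_K)
  then have "\<forall>\<^sub>F p in at_right (jump 1). slope_mid p = deriv return_map p"
    using jump_1 jump_2 by (intro eventually_at_rightI[of _ "jump 2"]) auto
  ultimately show "(deriv return_map \<longlongrightarrow> slope_mid (jump 1)) (at_right (jump 1))"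
    by (rule Lim_transform_eventually)
qed

text \<open>Both sides carry the same negative factor \<open>speed (jump 1)\<close>. The positive
  factors are decaying exponentials of the actual landing times: \<open>5 * pi / 2\<close> on the
  left and at least \<open>7 * pi / 2\<close> on the right, since division by \<open>growth\<close>
  accounts for one more period.\<close>

lemma slope_low_less_slope_mid: "slope_low (jump 1) < slope_mid (jump 1)"
proof -
  have "landing (crest 1) = 5 * pi / 2" unfolding crest_1 by (intro landing_eqI) auto
  moreover have e: "crest 1 / growth = crest 0" using crest_Suc[of 0] growth_gt_1 by simp
  moreover have "3 * pi / 2 \<le> landing (crest 0)"
    using landing(1)[of "crest 0"] bump_three_half_neg crest_pos[of 0] crest_less_Suc[of 0] by simp
  ultimately have "17/25 * landing (crest 1) < 17/25 * landing (crest 0) + 34/25 * pi" using pi_gt_zero by linarith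
  then have "exp (- (17/25) * landing (crest 0) - 34/25 * pi) < exp (- (17/25) * landing (crest 1))" by simp
  then have "exp (- (17/25) * landing (crest 0)) / growth < exp (- (17/25) * landing (crest 1))"
    by (simp add: exp_diff growth_def)
  then have "exp (- (17/25) * landing (crest 1)) * speed (jump 1) < exp (- (17/25) * landing (crest 0)) / growth * speed (jump 1)"
    by (rule mult_strict_right_mono_neg) (use speed_neg[of "jump 1"] p_crit_bounds jump_1 in simp)
  then show ?thesis using jump_1(3) e by (simp add: slope_low_def slope_mid_def)
qed

lemma return_map_greater:
  assumes "0 \<le> p" "p \<le> 9/10"
  shows "p < return_map p"
proof -
  have "peak p < bump_start (9/10)"
  proof (cases "p \<le> p_crit")
    case True
    then show ?thesis using peak_le_crest_0[OF assms(1)] crest_0_less by simp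
  next
    case False
    then show ?thesis using peak_strict_mono[of p "101/100"] peak_101 assms by simp
  qed
  moreover have p: "p < jump 1" using assms jump_1 by simp
  ultimately have "9/10 < ret_val (peak p)"
    using return_map_low[OF assms(1) p] by (intro less_ret_val) (auto simp: K_bounds)
  then show ?thesis using return_map_low[OF assms(1) p] assms by simp
qed

text \<open>The value at 0 lies above 111/50, where \<open>peak\<close> is increasing, and below the
  second jump. So the comparison made at 111/50 carries over to it.\<close>

lemma return_map_return_map_0: "return_map (return_map 0) < 9/10"
proof -
  let ?p = "return_map 0"
  have p: "111/50 < ?p" "?p < 56/25" using ret_val_crest_0 by (simp_all add: return_map_0)
  have m: "jump 1 \<le> ?p" "?p < jump 2" using p jump_1 jump_2 by auto
  have "growth * bump_start (9/10) < peak (111/50)"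
    unfolding peak_def bump_start_def
    by (rule threshold_222) (use start_bounds[of "111/50"] start_bounds[of "9/10"] cos_start in \<open>auto simp: K_bounds\<close>)
  also have "\<dots> < peak ?p" using peak_strict_mono[of "111/50" ?p] p p_crit_bounds by simp
  finally have "bump_start (9/10) < peak ?p / growth" using growth_gt_1 by (simp add: field_simps)
  then show ?thesis
    unfolding return_map_mid[OF m] using peak_growth[OF m] by (intro ret_val_less) (auto simp: K_bounds)
qed

theorem theorem28:
  shows "\<exists>p\<^sub>1 p\<^sub>2 p\<^sub>c :: real.
     \<bar>p\<^sub>1 - 1.11\<bar> < 0.1 \<and> \<bar>p\<^sub>2 - 2.61\<bar> < 0.01 \<and>
     {p \<in> {0..p\<^sub>2}. \<not> continuous (at p within K) return_map} = {p\<^sub>1, p\<^sub>2} \<and>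
     return_map ` K \<subseteq> {0..p\<^sub>2} \<and>
     return_map p\<^sub>1 = return_map 0 \<and> return_map p\<^sub>2 = return_map 0 \<and>
     \<bar>return_map 0 - 2.23\<bar> < 0.01 \<and>
     (return_map \<longlongrightarrow> 0) (at_left p\<^sub>1) \<and> (return_map \<longlongrightarrow> 0) (at_left p\<^sub>2) \<and>
     (\<forall>p \<in> {0..1.316} - {p\<^sub>1}. return_map differentiable (at p within K)) \<and>
     p\<^sub>c \<in> {0..1.316} - {p\<^sub>1} \<and> \<bar>p\<^sub>c - 0.108\<bar> < 0.001 \<and>
     (\<forall>p \<in> {0..1.316} - {p\<^sub>1}.
        (return_map has_real_derivative 0) (at p within K) \<longleftrightarrow> p = p\<^sub>c) \<and>
     (\<forall>p \<in> K. return_map p \<le> return_map p\<^sub>c) \<and>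
     (\<exists>l r. (deriv return_map \<longlongrightarrow> l) (at_left p\<^sub>1) \<and>
            (deriv return_map \<longlongrightarrow> r) (at_right p\<^sub>1) \<and> l < r) \<and>
     (\<forall>p \<in> {0..0.9}. return_map p > p) \<and>
     return_map (return_map 0) < 0.9"
proof (rule exI[of _ "jump 1"], rule exI[of _ "jump 2"], rule exI[of _ p_crit], intro conjI ballI)
  show "return_map ` K \<subseteq> {0..jump 2}"
  proof (rule image_subsetI)
    fix p assume "p \<in> K"
    then show "return_map p \<in> {0..jump 2}"
      using return_map_nonneg return_map_le[of p] return_map_p_crit_less jump_2 by auto
  qed
  fix p :: real assume p: "p \<in> {0..1.316} - {jump 1}"
  then have p': "0 \<le> p" "p < jump 2" "p \<noteq> jump 1" using jump_2 by auto
  show "return_map differentiable (at p within K)"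
    using return_map_deriv[OF p'] by (auto simp: real_differentiable_def)
  show "(return_map has_real_derivative 0) (at p within K) \<longleftrightarrow> p = p_crit" by (rule return_map_critical_iff[OF p'])
qed (use jump_1 jump_2 p_crit_bounds ret_val_crest_0 return_map_discontinuities return_map_left_limit
  return_map_jump_1 return_map_jump_2 return_map_0 return_map_le return_map_greater return_map_return_map_0
  deriv_return_map_limits slope_low_less_slope_mid in \<open>auto simp: abs_if\<close>)

end
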